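(* Let $d\ge5$, $L=BW_{2^d}$, and let $t\in BRW^+(2^d)$ be a nonsplit involution of defect $1$. Then the isometry group $O(L^+(t))$ of the fixed point sublattice $L^+(t)=\{x\in L: xt=x\}$ is not inherited from $L$, and $L^+(t)$ is isometric to the orthogonal direct sum $\sqrt2\,BW_{2^{d-2}}\perp \sqrt2\,BW_{2^{d-2}}$.
   Context: Barnes-Wall lattice: take an orthogonal basis $(e_v)_{v\in\mathbb F_2^d}$ of $\mathbb Q^{2^d}$ with $(e_v,e_v)=2^{-\lceil d/2\rceil}$; $BW_{2^d}$ is the $\mathbb Z$-span of all $2^{\lfloor (d-k+1)/2\rfloor}\sum_{v\in A}e_v$, $A$ an affine subspace of dimension $k$, $0\le k\le d$. $R\cong 2^{1+2d}_+$ is the extraspecial group generated by the translations $e_v\mapsto e_{v+a}$ and, for affine hyperplanes $H$, the maps $\varepsilon_H$ negating $e_v$ for $v\in H$ and fixing the other $e_v$. $G=BRW^+(2^d)$ is the normalizer of $R$ in $O(L)$; $G\cong 2^{1+2d}_+\Omega^+(2d,2)$, and $O(L)=G$ for $d\ge2$, $d\ne3$. An involution of $G$ is nonsplit if it does not centralize any maximal elementary abelian subgroup of $R$; it has defect $k$ if its commutator space on $R/Z(R)$ has dimension $2k$. For a sublattice $M$ of $L$, $O(M)$ is inherited if it equals the image in $O(M)$ (by restriction) of the stabilizer of $M$ in $O(L)$. $\sqrt2\,N$ denotes the lattice $N$ with its bilinear form multiplied by $2$. *)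

theory Defs
  imports "HOL-Algebra.Algebra" "HOL-Library.Z2" "HOL-Library.Function_Algebras"
    "HOL-Library.Product_Plus"
begin

section \<open>Linear algebra over \<open>\<int>\<close> and \<open>\<bbbF>\<^sub>2\<close>\<close>

definition int_scale :: "int \<Rightarrow> ('a \<Rightarrow> rat) \<Rightarrow> 'a \<Rightarrow> rat"
  where "int_scale n x = (\<lambda>v. of_int n * x v)"

interpretation zmod: Modules.module int_scale
  by unfold_locales (auto simp: int_scale_def fun_eq_iff algebra_simps)

definition bit_scale :: "bit \<Rightarrow> (nat \<Rightarrow> bit) \<Rightarrow> nat \<Rightarrow> bit"
  where "bit_scale c v = (\<lambda>i. c * v i)"

interpretation f2: vector_space bit_scale
  by unfold_locales (auto simp: bit_scale_def fun_eq_iff distrib_left distrib_right mult.assoc)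

text \<open>\<open>\<bbbF>\<^sub>2\<^sup>d\<close> consists of the sequences of bits that vanish from position \<open>d\<close> on.\<close>

definition F2 :: "nat \<Rightarrow> (nat \<Rightarrow> bit) set"
  where "F2 d = {v. \<forall>i\<ge>d. v i = 0}"

definition affine_subspace :: "nat \<Rightarrow> nat \<Rightarrow> (nat \<Rightarrow> bit) set \<Rightarrow> bool"
  where "affine_subspace d k A \<longleftrightarrow>
    (\<exists>a\<in>F2 d. \<exists>U. U \<subseteq> F2 d \<and> f2.subspace U \<and> f2.dim U = k \<and> A = (\<lambda>u. a + u) ` U)"


section \<open>Lattices\<close>

text \<open>A lattice is given by its points (an additive subgroup of the underlying type) and a
  bilinear form, of which only the values on the points matter.\<close>

record 'a bilin_lattice =
  points :: "'a set"
  form :: "'a \<Rightarrow> 'a \<Rightarrow> rat"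

definition isometry ::
    "'a::ab_group_add bilin_lattice \<Rightarrow> 'b::ab_group_add bilin_lattice \<Rightarrow> ('a \<Rightarrow> 'b) \<Rightarrow> bool"
  where "isometry M N f \<longleftrightarrow> bij_betw f (points M) (points N) \<and>
    (\<forall>x\<in>points M. \<forall>y\<in>points M. f (x + y) = f x + f y) \<and>
    (\<forall>x\<in>points M. \<forall>y\<in>points M. form N (f x) (f y) = form M x y)"

definition isometric ::
    "'a::ab_group_add bilin_lattice \<Rightarrow> 'b::ab_group_add bilin_lattice \<Rightarrow> bool"
  where "isometric M N \<longleftrightarrow> (\<exists>f. isometry M N f)"

text \<open>\<open>O(M)\<close>; as in \<^const>\<open>BijGroup\<close>, its elements are extensional functions on the points
  and the product is composition. (The action is thus written on the left.)\<close>

definition isometry_group :: "'a::ab_group_add bilin_lattice \<Rightarrow> ('a \<Rightarrow> 'a) monoid"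
  where "isometry_group M =
    BijGroup (points M) \<lparr>carrier := {f \<in> Bij (points M). isometry M M f}\<rparr>"

definition scaled :: "rat \<Rightarrow> 'a bilin_lattice \<Rightarrow> 'a bilin_lattice"
  where "scaled c M = \<lparr>points = points M, form = (\<lambda>x y. c * form M x y)\<rparr>"

definition orth_sum :: "'a bilin_lattice \<Rightarrow> 'b bilin_lattice \<Rightarrow> ('a \<times> 'b) bilin_lattice"
  where "orth_sum M N = \<lparr>points = points M \<times> points N,
    form = (\<lambda>x y. form M (fst x) (fst y) + form N (snd x) (snd y))\<rparr>"

definition fixed_sublattice :: "'a bilin_lattice \<Rightarrow> ('a \<Rightarrow> 'a) \<Rightarrow> 'a bilin_lattice"
  where "fixed_sublattice L t = \<lparr>points = {x \<in> points L. t x = x}, form = form L\<rparr>"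

text \<open>\<open>O(M)\<close> is inherited from \<open>L\<close>, for a sublattice \<open>M\<close> of \<open>L\<close>.\<close>

definition inherited :: "'a::ab_group_add bilin_lattice \<Rightarrow> 'a bilin_lattice \<Rightarrow> bool"
  where "inherited L M \<longleftrightarrow> carrier (isometry_group M) =
    (\<lambda>g. restrict g (points M)) ` {g \<in> carrier (isometry_group L). g ` points M = points M}"


section \<open>Groups\<close>

definition group_center :: "('a, 'b) monoid_scheme \<Rightarrow> 'a set \<Rightarrow> 'a set"
  where "group_center G R = {z \<in> R. \<forall>x\<in>R. z \<otimes>\<^bsub>G\<^esub> x = x \<otimes>\<^bsub>G\<^esub> z}"

definition elementary_abelian_2 :: "('a, 'b) monoid_scheme \<Rightarrow> 'a set \<Rightarrow> bool"
  where "elementary_abelian_2 G E \<longleftrightarrow> subgroup E G \<and>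
    (\<forall>x\<in>E. \<forall>y\<in>E. x \<otimes>\<^bsub>G\<^esub> y = y \<otimes>\<^bsub>G\<^esub> x) \<and> (\<forall>x\<in>E. x \<otimes>\<^bsub>G\<^esub> x = \<one>\<^bsub>G\<^esub>)"

definition maximal_elementary_abelian_2 ::
    "('a, 'b) monoid_scheme \<Rightarrow> 'a set \<Rightarrow> 'a set \<Rightarrow> bool"
  where "maximal_elementary_abelian_2 G R E \<longleftrightarrow> E \<subseteq> R \<and> elementary_abelian_2 G E \<and>
    (\<forall>E'. E' \<subseteq> R \<and> elementary_abelian_2 G E' \<and> E \<subseteq> E' \<longrightarrow> E' = E)"

text \<open>The dimension of an elementary abelian 2-subgroup \<open>C\<close> of an abelian group \<open>Q\<close> as a vector
  space over \<open>\<bbbF>\<^sub>2\<close>. A basis is a set \<open>B\<close> such that each element of \<open>C\<close> is a linear combination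
  of \<open>B\<close> in exactly one way; with coefficients in \<open>\<bbbF>\<^sub>2\<close>, linear combinations are products over
  subsets of \<open>B\<close>.\<close>

definition has_F2_dim :: "('a, 'b) monoid_scheme \<Rightarrow> 'a set \<Rightarrow> nat \<Rightarrow> bool"
  where "has_F2_dim Q C n \<longleftrightarrow> (\<exists>B. B \<subseteq> C \<and> finite B \<and> card B = n \<and>
    bij_betw (\<lambda>S. finprod Q (\<lambda>x. x) S) (Pow B) C)"

text \<open>\<open>R/Z(R)\<close>, and the commutator space on it of an element \<open>t\<close> normalizing \<open>R\<close>, which is
  spanned by the elements \<open>u\<^sup>-\<^sup>1 u\<^sup>t\<close>; for \<open>u = x Z(R)\<close> this is the coset of \<open>x\<^sup>-\<^sup>1 t\<^sup>-\<^sup>1 x t\<close>.\<close>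

definition center_quotient :: "('a, 'b) monoid_scheme \<Rightarrow> 'a set \<Rightarrow> 'a set monoid"
  where "center_quotient G R = (G\<lparr>carrier := R\<rparr>) Mod (group_center G R)"

definition commutator_space :: "('a, 'b) monoid_scheme \<Rightarrow> 'a set \<Rightarrow> 'a \<Rightarrow> 'a set set"
  where "commutator_space G R t = generate (center_quotient G R)
    {group_center G R #>\<^bsub>G\<^esub> (inv\<^bsub>G\<^esub> x \<otimes>\<^bsub>G\<^esub> (inv\<^bsub>G\<^esub> t \<otimes>\<^bsub>G\<^esub> x \<otimes>\<^bsub>G\<^esub> t)) | x. x \<in> R}"


section \<open>Barnes--Wall lattices and the group \<open>BRW\<^sup>+(2\<^sup>d)\<close>\<close>

text \<open>\<open>\<rat>\<close>-valued functions supported on \<open>F2 d\<close> play the role of \<open>\<rat>\<close> to the power \<open>2\<^sup>d\<close>.\<close>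

definition basis_vec :: "(nat \<Rightarrow> bit) \<Rightarrow> (nat \<Rightarrow> bit) \<Rightarrow> rat"
  where "basis_vec v = (\<lambda>w. if w = v then 1 else 0)"

text \<open>Below \<open>(d + 1) div 2\<close> is \<open>\<lceil>d/2\<rceil>\<close>, so that \<open>basis_vec v\<close> has norm \<open>2\<close> to the power \<open>-\<lceil>d/2\<rceil>\<close>.\<close>

definition BW :: "nat \<Rightarrow> ((nat \<Rightarrow> bit) \<Rightarrow> rat) bilin_lattice"
  where "BW d = \<lparr>
    points = zmod.span {int_scale (2 ^ ((d - k + 1) div 2)) (\<Sum>v\<in>A. basis_vec v) | k A.
      k \<le> d \<and> affine_subspace d k A},
    form = (\<lambda>x y. (\<Sum>v\<in>F2 d. x v * y v) / 2 ^ ((d + 1) div 2))\<rparr>"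

text \<open>The linear map sending \<open>basis_vec v\<close> to \<open>\<phi> v\<close> for all \<open>v \<in> F2 d\<close>.\<close>

definition lin_ext ::
    "nat \<Rightarrow> ((nat \<Rightarrow> bit) \<Rightarrow> (nat \<Rightarrow> bit) \<Rightarrow> rat) \<Rightarrow> ((nat \<Rightarrow> bit) \<Rightarrow> rat) \<Rightarrow> (nat \<Rightarrow> bit) \<Rightarrow> rat"
  where "lin_ext d \<phi> x = (\<lambda>w. \<Sum>v\<in>F2 d. x v * \<phi> v w)"

definition translation :: "nat \<Rightarrow> (nat \<Rightarrow> bit) \<Rightarrow> ((nat \<Rightarrow> bit) \<Rightarrow> rat) \<Rightarrow> (nat \<Rightarrow> bit) \<Rightarrow> rat"
  where "translation d a = restrict (lin_ext d (\<lambda>v. basis_vec (v + a))) (points (BW d))"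

definition hyperplane_sign ::
    "nat \<Rightarrow> (nat \<Rightarrow> bit) set \<Rightarrow> ((nat \<Rightarrow> bit) \<Rightarrow> rat) \<Rightarrow> (nat \<Rightarrow> bit) \<Rightarrow> rat"
  where "hyperplane_sign d H =
    restrict (lin_ext d (\<lambda>v. if v \<in> H then - basis_vec v else basis_vec v)) (points (BW d))"

text \<open>The group \<open>O(L)\<close> of \<open>L = BW d\<close>, its extraspecial subgroup \<open>R\<close>, and the normalizer of \<open>R\<close>.\<close>

abbreviation O_BW :: "nat \<Rightarrow> (((nat \<Rightarrow> bit) \<Rightarrow> rat) \<Rightarrow> (nat \<Rightarrow> bit) \<Rightarrow> rat) monoid"
  where "O_BW d \<equiv> isometry_group (BW d)"

definition extraspecial :: "nat \<Rightarrow> (((nat \<Rightarrow> bit) \<Rightarrow> rat) \<Rightarrow> (nat \<Rightarrow> bit) \<Rightarrow> rat) set"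
  where "extraspecial d = generate (O_BW d)
    ({translation d a | a. a \<in> F2 d} \<union>
     {hyperplane_sign d H | H. 1 \<le> d \<and> affine_subspace d (d - 1) H})"

definition BRW :: "nat \<Rightarrow> (((nat \<Rightarrow> bit) \<Rightarrow> rat) \<Rightarrow> (nat \<Rightarrow> bit) \<Rightarrow> rat) set"
  where "BRW d = normalizer (O_BW d) (extraspecial d)"

definition involution :: "nat \<Rightarrow> (((nat \<Rightarrow> bit) \<Rightarrow> rat) \<Rightarrow> (nat \<Rightarrow> bit) \<Rightarrow> rat) \<Rightarrow> bool"
  where "involution d t \<longleftrightarrow> t \<noteq> \<one>\<^bsub>O_BW d\<^esub> \<and> t \<otimes>\<^bsub>O_BW d\<^esub> t = \<one>\<^bsub>O_BW d\<^esub>"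

definition nonsplit :: "nat \<Rightarrow> (((nat \<Rightarrow> bit) \<Rightarrow> rat) \<Rightarrow> (nat \<Rightarrow> bit) \<Rightarrow> rat) \<Rightarrow> bool"
  where "nonsplit d t \<longleftrightarrow>
    \<not> (\<exists>E. maximal_elementary_abelian_2 (O_BW d) (extraspecial d) E \<and>
          (\<forall>x\<in>E. t \<otimes>\<^bsub>O_BW d\<^esub> x = x \<otimes>\<^bsub>O_BW d\<^esub> t))"

definition has_defect :: "nat \<Rightarrow> (((nat \<Rightarrow> bit) \<Rightarrow> rat) \<Rightarrow> (nat \<Rightarrow> bit) \<Rightarrow> rat) \<Rightarrow> nat \<Rightarrow> bool"
  where "has_defect d t k \<longleftrightarrow> has_F2_dim (center_quotient (O_BW d) (extraspecial d))
    (commutator_space (O_BW d) (extraspecial d) t) (2 * k)"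

end

theory Submission
  imports Defs
begin

text \<open>The operators in \<open>R\<close> form a basis of all matrices. If \<open>t\<close> has defect \<open>1\<close> and commutator space
  \<open>W\<close>, its expansion is supported on a coset \<open>r + W\<close>, with coefficients of equal absolute value;
  since \<open>t\<close> is symmetric, all labels in \<open>r + W\<close> are singular. If \<open>W\<close> is totally singular, \<open>t\<close> is
  split. Otherwise \<open>t = (g(1 + z) + a(1 - z))/2\<close> with involutions \<open>g\<close>, \<open>a\<close>, \<open>z\<close> in \<open>R\<close>, where \<open>z\<close>
  commutes with \<open>g\<close> and \<open>a\<close>, and \<open>ga = -ag\<close>. So \<open>t\<close> acts as \<open>g\<close> on one eigenspace of \<open>z\<close> and as
  \<open>a\<close> on the other, and the fixed lattice is the orthogonal sum of the parts fixed by \<open>\<langle>z, g\<rangle>\<close> and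
  by \<open>\<langle>-z, a\<rangle>\<close>. Halved products \<open>(1 + N)(1 + N')/2\<close> with \<open>N\<close>, \<open>N'\<close> in \<open>R\<close> of order \<open>4\<close> are lattice
  isometries; they conjugate \<open>\<langle>z, g\<rangle>\<close> to the sign changes of two coordinates, whose fixed vectors
  form a rescaled Barnes--Wall lattice in dimension \<open>2\<close> to the power \<open>d - 2\<close>. Comparing minimal
  norms shows that such an isometry applied to one of the two summands only does not extend.\<close>

section \<open>Vectors over the field with two elements\<close>

text \<open>The lattice is handled through the whole scale \<open>lat n j\<close>, because level
  counting does the work of the integrality arguments: for \<open>P\<close> in the extraspecial
  group, \<open>1 + P\<close> and \<open>1 - P\<close> climb one level, whereas division by 2 drops
  two. Half of a product of two such factors is therefore harmless, but a projection
  \<open>(1 + z)/2\<close> ends one level too low. This loss is the obstacle: a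
  \<open>z\<close>-component of a lattice vector is in general not a lattice vector, and the
  splitting of the fixed lattice has to be earned. An operator \<tau> that anticommutes with
  \<open>z\<close> and commutes with \<open>g\<close> and \<open>a\<close> repays the lost level,
  there and again in the proof that no extension exists. The shape of \<open>t\<close> rests on two
  facts about its expansion: \<open>t\<close> normalizes the group, so the absolute values of the
  coefficients are constant on cosets of the commutator space; and a symmetric matrix has no
  component along a skew one, so only singular labels occur. The bound 5 leaves the coordinates 1
  and 2 for the partial isometry, away from the last two, which carry the pair to which
  \<open>z\<close> and \<open>g\<close> are conjugated.\<close>

declare add_bit_eq_xor [simp del] mult_bit_eq_and [simp del]

type_synonym vec = "nat \<Rightarrow> bit"
type_synonym qfun = "vec \<Rightarrow> rat"

lemma bit_add_self [simp]: "(b::bit) + b = 0"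
  by (cases b) auto

lemma bit_add_self_left [simp]: "(b::bit) + (b + c) = c"
  by (simp flip: add.assoc)

lemma vec_add_self [simp]: "(v::vec) + v = 0"
  by (simp add: fun_eq_iff)

lemma vec_add_self_left [simp]: "(v::vec) + (v + w) = w"
  by (simp flip: add.assoc)

lemma vec_add_eq_iff: "(v::vec) + a = w \<longleftrightarrow> v = w + a"
  by (auto simp: add.assoc)

definition unit_vec :: "nat \<Rightarrow> nat \<Rightarrow> bit"
  where "unit_vec n = (\<lambda>i. if i = n then 1 else 0)"

lemma unit_vec_apply: "unit_vec n i = (if i = n then 1 else 0)"
  by (simp add: unit_vec_def)

lemma F2_zero [simp]: "0 \<in> F2 n"
  by (simp add: F2_def)

lemma F2_add [intro]: "v \<in> F2 n \<Longrightarrow> w \<in> F2 n \<Longrightarrow> v + w \<in> F2 n"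
  by (simp add: F2_def)

lemma F2_add_iff: "a \<in> F2 n \<Longrightarrow> v + a \<in> F2 n \<longleftrightarrow> v \<in> F2 n"
  by (auto simp: F2_def)

lemma F2_mono: "v \<in> F2 n \<Longrightarrow> n \<le> m \<Longrightarrow> v \<in> F2 m"
  by (simp add: F2_def)

lemma unit_vec_in_F2 [simp]: "unit_vec i \<in> F2 n \<longleftrightarrow> i < n"
  by (auto simp: F2_def unit_vec_def)

lemma F2_0: "F2 0 = {0}"
  by (auto simp: F2_def)

lemma F2_Suc_cases:
  assumes "v \<in> F2 (Suc n)"
  obtains "v \<in> F2 n" | w where "w \<in> F2 n" "v = w + unit_vec n"
proof (cases "v n")
  case zero
  have "v i = 0" if "n \<le> i" for i
    using assms zero that by (cases "i = n") (auto simp: F2_def)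
  then have "v \<in> F2 n"
    by (simp add: F2_def)
  then show ?thesis by (rule that)
next
  case one
  have "(v + unit_vec n) i = 0" if "n \<le> i" for i
    using assms one that by (cases "i = n") (auto simp: F2_def unit_vec_def)
  then have "v + unit_vec n \<in> F2 n"
    by (simp add: F2_def)
  then show ?thesis
    using that(2)[of "v + unit_vec n"] by (simp add: add.assoc)
qed

lemma F2_Suc: "F2 (Suc n) = F2 n \<union> (\<lambda>v. v + unit_vec n) ` F2 n"
proof
  show "F2 (Suc n) \<subseteq> F2 n \<union> (\<lambda>v. v + unit_vec n) ` F2 n"
    by (auto elim!: F2_Suc_cases)
  show "F2 n \<union> (\<lambda>v. v + unit_vec n) ` F2 n \<subseteq> F2 (Suc n)"
    by (auto intro!: F2_add[of _ "Suc n"] intro: F2_mono simp del: plus_fun_apply)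
qed

lemma add_unit_vec_notin_F2: "v \<in> F2 n \<Longrightarrow> v + unit_vec n \<notin> F2 n"
  by (auto simp: F2_def unit_vec_def)

lemma finite_F2 [simp]: "finite (F2 n)"
  by (induction n) (auto simp: F2_0 F2_Suc)

lemma sum_F2_Suc:
  "(\<Sum>v\<in>F2 (Suc n). f v) = (\<Sum>v\<in>F2 n. f v) + (\<Sum>v\<in>F2 n. f (v + unit_vec n))"
proof -
  have "(\<Sum>v\<in>F2 (Suc n). f v) =
      (\<Sum>v\<in>F2 n. f v) + (\<Sum>v\<in>(\<lambda>v. v + unit_vec n) ` F2 n. f v)"
    unfolding F2_Suc by (rule sum.union_disjoint) (auto simp: add_unit_vec_notin_F2)
  also have "(\<Sum>v\<in>(\<lambda>v. v + unit_vec n) ` F2 n. f v) = (\<Sum>v\<in>F2 n. f (v + unit_vec n))"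
    by (subst sum.reindex) (auto simp: inj_on_def)
  finally show ?thesis .
qed

lemma sum_F2_translate:
  assumes "a \<in> F2 n"
  shows "(\<Sum>v\<in>F2 n. f (v + a)) = (\<Sum>v\<in>F2 n. f v)"
  by (rule sum.reindex_bij_witness[where i = "\<lambda>v. v + a" and j = "\<lambda>v. v + a"])
    (use assms in \<open>auto simp: add.assoc\<close>)

lemma card_F2: "card (F2 n) = 2 ^ n"
proof -
  have "of_nat (card (F2 n)) = (2 ^ n :: int)"
  proof (induction n)
    case (Suc n)
    then show ?case
      using sum_F2_Suc[of "\<lambda>_. 1::int" n] by simp
  qed (simp add: F2_0)
  then show ?thesis
    by (metis of_nat_eq_iff of_nat_numeral of_nat_power)
qed

section \<open>Signs, rational functions and their two halves\<close>

definition chi :: "bit \<Rightarrow> rat"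
  where "chi b = (if b = 0 then 1 else - 1)"

lemma chi_simps [simp]: "chi 0 = 1" "chi 1 = - 1"
  by (auto simp: chi_def)

lemma chi_add: "chi (a + b) = chi a * chi b"
  by (cases a; cases b) auto

lemma chi_mult_self [simp]: "chi a * chi a = 1"
  by (cases a) auto

lemma chi_eq_iff [simp]: "chi a = chi b \<longleftrightarrow> a = b"
  by (cases a; cases b) auto

lemma chi_nonzero [simp]: "chi a \<noteq> 0"
  by (cases a) auto

definition sc :: "rat \<Rightarrow> ('a \<Rightarrow> rat) \<Rightarrow> 'a \<Rightarrow> rat"
  where "sc k f = (\<lambda>v. k * f v)"

lemma sc_apply: "sc k f v = k * f v"
  by (simp add: sc_def)

lemma sc_add: "sc k (f + g) = sc k f + sc k g"
  and sc_diff: "sc k (f - g) = sc k f - sc k g"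
  and sc_minus: "sc k (- f) = - sc k f"
  and sc_sc [simp]: "sc k (sc m f) = sc (k * m) f"
  and sc_zero [simp]: "sc k 0 = 0"
  and sc_one [simp]: "sc 1 f = f"
  by (auto simp: sc_def fun_eq_iff algebra_simps)

lemma sc_2: "sc 2 f = f + f"
  by (auto simp: sc_def fun_eq_iff)

definition fsup :: "nat \<Rightarrow> qfun set"
  where "fsup n = {f. \<forall>v. v \<notin> F2 n \<longrightarrow> f v = 0}"

lemma fsup_mono: "f \<in> fsup n \<Longrightarrow> n \<le> m \<Longrightarrow> f \<in> fsup m"
  by (auto simp: fsup_def dest: F2_mono)

lemma fsup_zero [simp]: "0 \<in> fsup n"
  and fsup_add [intro]: "f \<in> fsup n \<Longrightarrow> g \<in> fsup n \<Longrightarrow> f + g \<in> fsup n"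
  and fsup_diff [intro]: "f \<in> fsup n \<Longrightarrow> g \<in> fsup n \<Longrightarrow> f - g \<in> fsup n"
  and fsup_minus [intro]: "f \<in> fsup n \<Longrightarrow> - f \<in> fsup n"
  and fsup_sc [intro]: "f \<in> fsup n \<Longrightarrow> sc k f \<in> fsup n"
  by (auto simp: fsup_def sc_def)

definition lo :: "nat \<Rightarrow> qfun \<Rightarrow> qfun"
  where "lo n f = (\<lambda>v. if v \<in> F2 n then f v else 0)"

text \<open>The upper half is pulled back to \<open>F2 n\<close>, so that both halves live on the
  same set and can be subtracted.\<close>

definition hi :: "nat \<Rightarrow> qfun \<Rightarrow> qfun"
  where "hi n f = (\<lambda>v. if v \<in> F2 n then f (v + unit_vec n) else 0)"

lemma lo_simps [simp]:
  "lo n 0 = 0" "lo n (f + g) = lo n f + lo n g" "lo n (f - g) = lo n f - lo n g"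
  "lo n (- f) = - lo n f" "lo n (sc k f) = sc k (lo n f)"
  and hi_simps [simp]:
  "hi n 0 = 0" "hi n (f + g) = hi n f + hi n g" "hi n (f - g) = hi n f - hi n g"
  "hi n (- f) = - hi n f" "hi n (sc k f) = sc k (hi n f)"
  by (auto simp: lo_def hi_def fun_eq_iff sc_def)

lemma fsup_lo_hi_eqI:
  assumes "f \<in> fsup (Suc n)" "g \<in> fsup (Suc n)" "lo n f = lo n g" "hi n f = hi n g"
  shows "f = g"
proof
  fix v
  consider "v \<in> F2 n" | w where "w \<in> F2 n" "v = w + unit_vec n" | "v \<notin> F2 (Suc n)"
    using F2_Suc_cases by blast
  then show "f v = g v"
  proof cases
    case 1
    then show ?thesis using fun_cong[OF assms(3), of v] by (simp add: lo_def)
  next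
    case 2
    then show ?thesis using fun_cong[OF assms(4), of w] by (simp add: hi_def)
  qed (use assms in \<open>auto simp: fsup_def\<close>)
qed

lemmas fun_pt = plus_fun_apply minus_apply uminus_apply zero_fun_apply

text \<open>As rewrite rules these would expand sums of functions below an abstraction.\<close>

declare fun_pt [simp del]

section \<open>The \<open>(x | x + z)\<close> recursion\<close>

text \<open>The span defining \<^term>\<open>BW d\<close> is \<open>lat d 1\<close>. In general \<open>lat n j\<close> is spanned by the
  vectors \<open>2\<close> to the power \<open>\<lfloor>(n + j - k)/2\<rfloor>\<close> times the sum of \<open>e\<^sub>v\<close> over an affine subspace of
  dimension \<open>k\<close>.\<close>

primrec lat :: "nat \<Rightarrow> nat \<Rightarrow> qfun set" where
  "lat 0 j = {f \<in> fsup 0. \<exists>k. f 0 = of_int k * 2 ^ (j div 2)}"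
| "lat (Suc n) j = {f \<in> fsup (Suc n). lo n f \<in> lat n j \<and> hi n f - lo n f \<in> lat n (Suc j)}"

lemma mem_lat_0: "f \<in> lat 0 j \<longleftrightarrow> f \<in> fsup 0 \<and> (\<exists>k. f 0 = of_int k * 2 ^ (j div 2))"
  and mem_lat_Suc:
    "f \<in> lat (Suc n) j \<longleftrightarrow> f \<in> fsup (Suc n) \<and> lo n f \<in> lat n j \<and> hi n f - lo n f \<in> lat n (Suc j)"
  by simp_all

declare lat.simps [simp del] mem_lat_Suc [simp]

lemma lat_subset_fsup: "f \<in> lat n j \<Longrightarrow> f \<in> fsup n"
  by (cases n) (auto simp: mem_lat_0)

lemma lat_zero [simp]: "0 \<in> lat n j"
  by (induction n arbitrary: j) (auto simp: mem_lat_0 fun_pt)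

lemma lat_minus [intro]: "f \<in> lat n j \<Longrightarrow> - f \<in> lat n j"
proof (induction n arbitrary: j f)
  case 0
  then obtain k where "f \<in> fsup 0" "f 0 = of_int k * 2 ^ (j div 2)" by (auto simp: mem_lat_0)
  then show ?case unfolding mem_lat_0 by (intro conjI fsup_minus exI[of _ "- k"]) (auto simp: fun_pt)
next
  case (Suc n)
  have f: "f \<in> fsup (Suc n)" "lo n f \<in> lat n j" "hi n f - lo n f \<in> lat n (Suc j)"
    using Suc.prems by simp_all
  have "hi n (- f) - lo n (- f) = - (hi n f - lo n f)"
    by (simp add: algebra_simps)
  then show ?case
    unfolding mem_lat_Suc using f Suc.IH by (metis fsup_minus lo_simps(4))
qed

lemma lat_add [intro]: "f \<in> lat n j \<Longrightarrow> g \<in> lat n j \<Longrightarrow> f + g \<in> lat n j"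
proof (induction n arbitrary: j f g)
  case 0
  then obtain k m where "f \<in> fsup 0" "f 0 = of_int k * 2 ^ (j div 2)"
    "g \<in> fsup 0" "g 0 = of_int m * 2 ^ (j div 2)" by (auto simp: mem_lat_0)
  then show ?case unfolding mem_lat_0
    by (intro conjI fsup_add exI[of _ "k + m"]) (auto simp: fun_pt algebra_simps)
next
  case (Suc n)
  have f: "f \<in> fsup (Suc n)" "lo n f \<in> lat n j" "hi n f - lo n f \<in> lat n (Suc j)"
    and g: "g \<in> fsup (Suc n)" "lo n g \<in> lat n j" "hi n g - lo n g \<in> lat n (Suc j)"
    using Suc.prems by simp_all
  have "hi n (f + g) - lo n (f + g) = (hi n f - lo n f) + (hi n g - lo n g)"
    by (simp add: algebra_simps)
  then show ?case
    unfolding mem_lat_Suc using f g Suc.IH by (metis fsup_add lo_simps(2))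
qed

lemma lat_diff [intro]: "f \<in> lat n j \<Longrightarrow> g \<in> lat n j \<Longrightarrow> f - g \<in> lat n j"
  using lat_add[of f n j "- g"] by auto

lemma lat_antimono: "f \<in> lat n (Suc j) \<Longrightarrow> f \<in> lat n j"
proof (induction n arbitrary: j f)
  case 0
  then obtain k where k: "f \<in> fsup 0" "f 0 = of_int k * 2 ^ (Suc j div 2)" by (auto simp: mem_lat_0)
  have "Suc j div 2 = j div 2 \<or> Suc j div 2 = Suc (j div 2)" by auto
  then show ?case
  proof
    assume "Suc j div 2 = Suc (j div 2)"
    with k show ?case unfolding mem_lat_0 by (intro conjI exI[of _ "2 * k"]) auto
  qed (use k in \<open>auto simp: mem_lat_0\<close>)
qed auto

text \<open>At the bottom, \<open>j div 2\<close> grows by one when \<open>j\<close> grows by two,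
  and the recursion is linear. So doubling is worth exactly two levels, in both directions; this is
  the exchange rate of every later level count.\<close>

lemma sc_2_in_lat_iff: "sc 2 f \<in> lat n (Suc (Suc j)) \<longleftrightarrow> f \<in> lat n j"
proof (induction n arbitrary: j f)
  case 0
  have "sc 2 f \<in> fsup 0 \<longleftrightarrow> f \<in> fsup 0"
    by (auto simp: fsup_def sc_def)
  then show ?case by (auto simp: sc_def mem_lat_0)
next
  case (Suc n)
  have "sc 2 f \<in> fsup (Suc n) \<longleftrightarrow> f \<in> fsup (Suc n)"
    by (auto simp: fsup_def sc_def)
  moreover have "sc 2 (hi n f) - sc 2 (lo n f) = sc 2 (hi n f - lo n f)"
    by (simp add: sc_diff)
  ultimately show ?case unfolding mem_lat_Suc hi_simps lo_simps using Suc by presburger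
qed

lemma lat_double: "f \<in> lat n j \<Longrightarrow> f + f \<in> lat n (Suc (Suc j))"
  by (metis sc_2 sc_2_in_lat_iff)

lemma lat_double': "f \<in> lat n j \<Longrightarrow> f + f \<in> lat n (Suc j)"
  by (metis lat_double lat_antimono)

text \<open>The upper half of \<open>f\<close> is zero, so the difference of the halves is
  \<open>- f\<close>, which has to lie one level higher. Vanishing off a hyperplane thus costs one
  level.\<close>

lemma lat_Suc_lower_half:
  assumes "f \<in> fsup n"
  shows "f \<in> lat (Suc n) j \<longleftrightarrow> f \<in> lat n (Suc j)"
proof -
  have "lo n f = f" "hi n f = 0"
    using assms by (auto simp: lo_def hi_def fun_eq_iff fsup_def add_unit_vec_notin_F2 fun_pt)
  moreover have "f \<in> fsup (Suc n)"
    using assms by (auto intro: fsup_mono)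
  ultimately show ?thesis
    using lat_minus[of "- f" n "Suc j"] by (auto intro: lat_antimono)
qed

text \<open>The operators \<open>W c a l\<close> are the elements of the extraspecial group, acting on all functions:
  a sign, a translation and a character. The bound \<open>D\<close> makes \<open>dot\<close> bilinear without side
  conditions; the operators with labels in \<^term>\<open>F2 n\<close> are the same for all \<open>D \<ge> n\<close>.\<close>

locale pauli =
  fixes D :: nat
begin

definition dot :: "vec \<Rightarrow> vec \<Rightarrow> bit"
  where "dot l v = (\<Sum>i<D. l i * v i)"

lemma dot_add_left [simp]: "dot (l + m) v = dot l v + dot m v"
  and dot_add_right [simp]: "dot l (v + w) = dot l v + dot l w"
  by (auto simp: dot_def fun_pt algebra_simps sum.distrib)

lemma dot_zero [simp]: "dot 0 v = 0" "dot l 0 = 0"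
  by (auto simp: dot_def fun_pt)

lemma dot_unit_vec [simp]: "i < D \<Longrightarrow> dot l (unit_vec i) = l i" "i < D \<Longrightarrow> dot (unit_vec i) v = v i"
  by (auto simp: dot_def unit_vec_def if_distrib[of "\<lambda>b. _ * b"] if_distrib[of "\<lambda>b. b * _"] cong: if_cong)

definition W :: "bit \<Rightarrow> vec \<Rightarrow> vec \<Rightarrow> qfun \<Rightarrow> qfun"
  where "W c a l f = (\<lambda>v. chi (c + dot l v) * f (v + a))"

lemma W_W: "W c a l (W c' a' l' f) = W (c + c' + dot l' a) (a + a') (l + l') f"
  by (auto simp: W_def fun_pt fun_eq_iff chi_add algebra_simps)

lemma W_id [simp]: "W 0 0 0 f = f"
  by (simp add: W_def)

lemma W_linear [simp]: "W c a l 0 = 0" "W c a l (f + g) = W c a l f + W c a l g"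
  "W c a l (f - g) = W c a l f - W c a l g" "W c a l (- f) = - W c a l f"
  "W c a l (sc k f) = sc k (W c a l f)"
  by (auto simp: W_def fun_pt fun_eq_iff algebra_simps sc_def)

lemma W_sign: "W (c + e) a l f = sc (chi e) (W c a l f)"
  by (auto simp: W_def sc_def chi_add algebra_simps)

lemma W_neg: "W (c + 1) a l f = - W c a l f"
  by (auto simp: W_def fun_pt fun_eq_iff chi_add)

lemma W_fsup: "f \<in> fsup n \<Longrightarrow> a \<in> F2 n \<Longrightarrow> W c a l f \<in> fsup n"
  by (auto simp: fsup_def W_def F2_add_iff)

lemma lo_W: "a \<in> F2 n \<Longrightarrow> lo n (W c a l f) = W c a l (lo n f)"
  and hi_W: "a \<in> F2 n \<Longrightarrow> hi n (W c a l f) = W (c + dot l (unit_vec n)) a l (hi n f)"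
  and lo_W_swap: "a \<in> F2 n \<Longrightarrow> lo n (W c (a + unit_vec n) l f) = W c a l (hi n f)"
  and hi_W_swap: "a \<in> F2 n \<Longrightarrow>
    hi n (W c (a + unit_vec n) l f) = W (c + dot l (unit_vec n)) a l (lo n f)"
  by (auto simp: lo_def hi_def W_def fun_pt fun_eq_iff F2_add_iff ac_simps)

text \<open>Beyond preserving the lattices, the operators act trivially on each quotient of
  consecutive levels. This second clause is the source of all level gains.\<close>

lemma W_lat_aux:
  "a \<in> F2 n \<Longrightarrow> f \<in> lat n j \<Longrightarrow> W c a l f \<in> lat n j \<and> W c a l f - f \<in> lat n (Suc j)"
proof (induction n arbitrary: j f a c)
  case 0
  then obtain k where k: "f \<in> fsup 0" "f 0 = of_int k * 2 ^ (j div 2)" and a: "a = 0"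
    by (auto simp: F2_0 mem_lat_0)
  have "- f \<in> lat 0 j" "- f - f \<in> lat 0 (Suc j)"
    using 0 lat_minus[of f 0 j] lat_double'[of "- f" 0 j] by (simp_all only: diff_conv_add_uminus)
  moreover have "W c a l f = sc (chi c) f"
  proof
    fix v
    show "W c a l f v = sc (chi c) f v"
      using k a by (cases "v = 0") (simp_all add: W_def fsup_def F2_0 sc_def fun_pt)
  qed
  moreover have "sc (chi c) f = f \<or> sc (chi c) f = - f"
    by (cases c) (auto simp: sc_def fun_pt fun_eq_iff)
  ultimately have "W c a l f = f \<or> W c a l f = - f"
    by simp
  then show ?case
    using 0 \<open>- f \<in> lat 0 j\<close> \<open>- f - f \<in> lat 0 (Suc j)\<close> lat_zero[of 0 "Suc j"]
    by (elim disjE) (simp_all only: diff_self conj_absorb simp_thms)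
next
  case (Suc n)
  define x where "x = lo n f"
  define z where "z = hi n f - lo n f"
  have f: "f \<in> fsup (Suc n)" and x: "x \<in> lat n j" and z: "z \<in> lat n (Suc j)"
    and y: "hi n f = x + z"
    using Suc.prems by (auto simp: x_def z_def)
  have zj: "z \<in> lat n j" by (rule lat_antimono) fact
  have fs: "W c a l f \<in> fsup (Suc n)"
    using f Suc.prems by (auto intro: W_fsup)
  define e where "e = dot l (unit_vec n)"
  \<comment> \<open>The translation part either keeps the two halves or swaps them, and
    \<open>e\<close> is the sign that the character puts on the upper half. In each case the terms
    not covered by the induction hypothesis are doubles, which gain two levels.\<close>
  from Suc.prems(1) show ?case
  proof (cases rule: F2_Suc_cases)
    case 1
    define Wx where "Wx = W c a l x"
    define Wz where "Wz = W c a l z"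
    have IH: "Wx \<in> lat n j" "Wx - x \<in> lat n (Suc j)" "Wz \<in> lat n (Suc j)" "Wz - z \<in> lat n (Suc (Suc j))"
      unfolding Wx_def Wz_def using Suc.IH[OF 1 x] Suc.IH[OF 1 z] by blast+
    have lo: "lo n (W c a l f) = Wx"
      using 1 by (simp add: lo_W Wx_def x_def)
    show ?thesis
    proof (cases e)
      case zero
      then have hi: "hi n (W c a l f) = Wx + Wz"
        using 1 y by (simp add: hi_W Wx_def Wz_def e_def)
      have "(Wx + Wz - (x + z)) - (Wx - x) = Wz - z" by simp
      then show ?thesis
        using IH lo hi fs f y by (auto simp: x_def[symmetric])
    next
      case one
      then have hi: "hi n (W c a l f) = - Wx - Wz"
        using 1 y by (simp add: hi_W Wx_def Wz_def e_def W_neg)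
      have 1: "- Wx - Wz - Wx = - (Wx + Wx) - Wz"
        and 2: "(- Wx - Wz - (x + z)) - (Wx - x) = - (Wz - z) - (z + z) - (Wx + Wx)"
        by (auto simp: algebra_simps)
      have "- (Wx + Wx) - Wz \<in> lat n (Suc j)"
        by (intro lat_diff lat_minus lat_double' IH)
      moreover have "- (Wz - z) - (z + z) - (Wx + Wx) \<in> lat n (Suc (Suc j))"
        by (intro lat_diff lat_minus IH lat_double'[OF z] lat_double)
      ultimately show ?thesis
        using IH lo hi fs f y unfolding mem_lat_Suc
        by (auto simp: x_def[symmetric] 1 2)
    qed
  next
    case (2 b)
    define Wx where "Wx = W c b l x"
    define Wz where "Wz = W c b l z"
    have IH: "Wx \<in> lat n j" "Wx - x \<in> lat n (Suc j)" "Wz \<in> lat n (Suc j)" "Wz - z \<in> lat n (Suc (Suc j))"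
      unfolding Wx_def Wz_def using Suc.IH[OF 2(1) x] Suc.IH[OF 2(1) z] by blast+
    have Zj: "Wz \<in> lat n j" by (rule lat_antimono) fact
    have lo: "lo n (W c a l f) = Wx + Wz"
      using 2 y by (simp add: lo_W_swap Wx_def Wz_def)
    have lo2: "Wx + Wz - x = (Wx - x) + Wz" by simp
    show ?thesis
    proof (cases e)
      case zero
      then have hi: "hi n (W c a l f) = Wx"
        using 2 y by (simp add: hi_W_swap Wx_def x_def e_def)
      have 1: "Wx - (Wx + Wz) = - Wz" and 2: "- (Wz - z) - (z + z) = - Wz - z"
        by (auto simp: algebra_simps)
      have "- (Wz - z) - (z + z) \<in> lat n (Suc (Suc j))"
        by (intro lat_diff lat_minus lat_double' IH z)
      then have "- Wz - z \<in> lat n (Suc (Suc j))"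
        unfolding 2 .
      moreover have "(Wx - x) + Wz \<in> lat n (Suc j)"
        using IH by auto
      ultimately show ?thesis
        using IH Zj lo hi fs f y unfolding mem_lat_Suc
        by (auto simp: x_def[symmetric] 1 lo2)
    next
      case one
      then have hi: "hi n (W c a l f) = - Wx"
        using 2 y by (simp add: hi_W_swap Wx_def x_def e_def W_neg)
      have 1: "- Wx - (Wx + Wz) = - (Wx + Wx) - Wz"
        and 2: "- (Wz - z) - (z + z) - (Wx + Wx) = - Wz - z - 2 * Wx"
        by (auto simp: algebra_simps)
      have "- (Wz - z) - (z + z) - (Wx + Wx) \<in> lat n (Suc (Suc j))"
        by (intro lat_diff lat_minus IH lat_double'[OF z] lat_double)
      then have "- Wz - z - 2 * Wx \<in> lat n (Suc (Suc j))"
        unfolding 2 .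
      moreover have "(Wx - x) + Wz \<in> lat n (Suc j)" "- (Wx + Wx) - Wz \<in> lat n (Suc j)"
        by (intro lat_add lat_diff lat_minus IH lat_double')+
      ultimately show ?thesis
        using IH Zj lo hi fs f y unfolding mem_lat_Suc
        by (auto simp: x_def[symmetric] 1 lo2)
    qed
  qed
qed

lemma W_lat: "a \<in> F2 n \<Longrightarrow> f \<in> lat n j \<Longrightarrow> W c a l f \<in> lat n j"
  and W_diff_lat: "a \<in> F2 n \<Longrightarrow> f \<in> lat n j \<Longrightarrow> W c a l f - f \<in> lat n (Suc j)"
  using W_lat_aux by auto

lemma W_add_lat: "a \<in> F2 n \<Longrightarrow> f \<in> lat n j \<Longrightarrow> f + W c a l f \<in> lat n (Suc j)"
  using lat_add[OF W_diff_lat lat_double'[of f], of a n f j c l] by (simp add: algebra_simps)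

lemma W_diff_lat': "a \<in> F2 n \<Longrightarrow> f \<in> lat n j \<Longrightarrow> f - W c a l f \<in> lat n (Suc j)"
  using lat_minus[OF W_diff_lat, of a n f j c l] by simp

end

section \<open>The inner product and the minimal norm\<close>

definition ip :: "nat \<Rightarrow> qfun \<Rightarrow> qfun \<Rightarrow> rat"
  where "ip n f g = (\<Sum>v\<in>F2 n. f v * g v)"

lemma ip_bilinear [simp]:
  "ip n 0 g = 0" "ip n f 0 = 0"
  "ip n (f + f') g = ip n f g + ip n f' g" "ip n f (g + g') = ip n f g + ip n f g'"
  "ip n (f - f') g = ip n f g - ip n f' g" "ip n f (g - g') = ip n f g - ip n f g'"
  "ip n (- f) g = - ip n f g" "ip n f (- g) = - ip n f g"
  "ip n (sc k f) g = k * ip n f g" "ip n f (sc k g) = k * ip n f g"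
  by (auto simp: ip_def sc_def fun_pt sum.distrib sum_subtractf sum_negf sum_distrib_left algebra_simps)

lemma ip_commute: "ip n f g = ip n g f"
  by (simp add: ip_def mult.commute)

lemma ip_nonneg [simp]: "ip n f f \<ge> 0"
  by (auto simp: ip_def intro: sum_nonneg)

lemma ip_self_eq_0D:
  assumes "ip n f f = 0" "f \<in> fsup n"
  shows "f = 0"
proof
  fix v
  have "\<forall>v\<in>F2 n. f v * f v = 0"
    using assms(1) unfolding ip_def by (subst (asm) sum_nonneg_eq_0_iff) auto
  then show "f v = 0 v"
    using assms(2) by (cases "v \<in> F2 n") (auto simp: fsup_def fun_pt)
qed

lemma ip_Suc: "ip (Suc n) f g = ip n (lo n f) (lo n g) + ip n (hi n f) (hi n g)"
  unfolding ip_def sum_F2_Suc by (auto simp: lo_def hi_def intro!: arg_cong2[of _ _ _ _ "(+)"] sum.cong)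

lemma (in pauli) ip_W_W:
  assumes "a \<in> F2 n"
  shows "ip n (W c a l f) (W c a l g) = ip n f g"
proof -
  have "ip n (W c a l f) (W c a l g) = (\<Sum>v\<in>F2 n. f (v + a) * g (v + a))"
    unfolding ip_def W_def
    by (intro sum.cong refl) (metis (no_types, lifting) chi_mult_self mult.left_neutral mult.assoc mult.left_commute)
  also have "\<dots> = ip n f g"
    using sum_F2_translate[OF assms, of "\<lambda>v. f v * g v"] by (simp add: ip_def)
  finally show ?thesis .
qed

text \<open>If both halves are nonzero, each contributes the bound for \<open>n\<close>. If only one
  is, it lies in level \<open>Suc j\<close> and contributes twice that bound alone. The factor 2 on
  the right absorbs the rounding in \<open>j div 2\<close> for odd \<open>j\<close>; at level 1 the
  bound reads \<open>2 ^ n \<le> ip n f f\<close>.\<close>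

lemma lat_min_norm: "f \<in> lat n j \<Longrightarrow> f \<noteq> 0 \<Longrightarrow> 2 ^ (n + j) \<le> 2 * ip n f f"
proof (induction n arbitrary: j f)
  case 0
  then obtain k where k: "f \<in> fsup 0" "f 0 = of_int k * 2 ^ (j div 2)" by (auto simp: mem_lat_0)
  have "f 0 \<noteq> 0"
  proof
    assume "f 0 = 0"
    with k(1) have "f v = 0" for v by (cases "v = 0") (simp_all add: fsup_def F2_0)
    then have "f = 0" by (simp add: fun_eq_iff fun_pt)
    with 0 show False by simp
  qed
  with k have "k \<noteq> 0" by auto
  then have "1 \<le> k * k"
    by (metis int_one_le_iff_zero_less mult_eq_0_iff not_less_iff_gr_or_eq zero_less_mult_iff)
  then have "(1::rat) \<le> of_int k * of_int k"
    by (metis of_int_1 of_int_le_iff of_int_mult)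
  then have "2 * 2 ^ (j div 2 + j div 2) \<le> (2::rat) * ((of_int k * of_int k) * (2 ^ (j div 2 + j div 2)))"
    by (simp add: mult_le_cancel_right1)
  moreover have "(2::rat) ^ j \<le> 2 * 2 ^ (j div 2 + j div 2)"
  proof -
    have "j \<le> Suc (j div 2 + j div 2)" by linarith
    then have "(2::rat) ^ j \<le> 2 ^ Suc (j div 2 + j div 2)" by (intro power_increasing) auto
    then show ?thesis by simp
  qed
  ultimately have "2 ^ j \<le> (2::rat) * ((of_int k * of_int k) * (2 ^ (j div 2 + j div 2)))"
    by (rule order.trans[rotated])
  then show ?case
    using k by (simp add: ip_def F2_0 power_add algebra_simps)
next
  case (Suc n)
  define x where "x = lo n f"
  define y where "y = hi n f"
  have x: "x \<in> lat n j" and z: "y - x \<in> lat n (Suc j)" and f: "f \<in> fsup (Suc n)"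
    using Suc.prems by (auto simp: x_def y_def)
  have "x + (y - x) \<in> lat n j"
    by (rule lat_add[OF x lat_antimono[OF z]])
  then have y: "y \<in> lat n j" by simp
  have ip: "ip (Suc n) f f = ip n x x + ip n y y"
    by (simp add: ip_Suc x_def y_def)
  consider "x = 0" "y = 0" | "x = 0" "y \<noteq> 0" | "x \<noteq> 0" "y = 0" | "x \<noteq> 0" "y \<noteq> 0" by blast
  then show ?case
  proof cases
    case 1
    then have "f = 0"
      using f by (intro fsup_lo_hi_eqI[of f n 0]) (auto simp: x_def y_def)
    with Suc.prems show ?thesis by simp
  next
    case 2
    then have "2 ^ (n + Suc j) \<le> 2 * ip n y y" by (intro Suc.IH) (use 2 z in simp_all)
    then show ?thesis using 2 ip by simp
  next
    case 3
    then have "x \<in> lat n (Suc j)" using lat_minus[OF z] by simp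
    then have "2 ^ (n + Suc j) \<le> 2 * ip n x x" using 3 by (intro Suc.IH)
    then show ?thesis using 3 ip by simp
  next
    case 4
    then have "2 ^ (n + j) \<le> 2 * ip n x x" "2 ^ (n + j) \<le> 2 * ip n y y"
      using 4 by (simp_all only: Suc.IH[OF x] Suc.IH[OF y])
    then show ?thesis using ip by simp
  qed
qed

section \<open>Clifford isometries\<close>

definition lin :: "(('a \<Rightarrow> rat) \<Rightarrow> 'a \<Rightarrow> rat) \<Rightarrow> bool"
  where "lin \<phi> \<longleftrightarrow> (\<forall>f g. \<phi> (f + g) = \<phi> f + \<phi> g) \<and> (\<forall>k f. \<phi> (sc k f) = sc k (\<phi> f))"

lemma sc_neg_1: "sc (- 1) f = - f"
  by (simp add: sc_def fun_pt fun_eq_iff)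

lemma lin_simps:
  assumes "lin \<phi>"
  shows "\<phi> (f + g) = \<phi> f + \<phi> g" "\<phi> (sc k f) = sc k (\<phi> f)" "\<phi> (- f) = - \<phi> f"
    "\<phi> (f - g) = \<phi> f - \<phi> g" "\<phi> 0 = 0" "\<phi> (2 * f) = 2 * \<phi> f"
proof -
  show a: "\<phi> (f + g) = \<phi> f + \<phi> g" and s: "\<phi> (sc k f) = sc k (\<phi> f)" for f g k
    using assms by (auto simp: lin_def)
  show m: "\<phi> (- f) = - \<phi> f" for f
    using s[of "- 1" f] by (simp add: sc_neg_1)
  show "\<phi> (f - g) = \<phi> f - \<phi> g"
    using a[of f "- g"] m[of g] by simp
  show "\<phi> 0 = 0"
    using a[of 0 0] by simp
  show "\<phi> (2 * f) = 2 * \<phi> f"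
    unfolding mult_2 by (rule a)
qed

lemma lin_comp: "lin \<phi> \<Longrightarrow> lin \<psi> \<Longrightarrow> lin (\<lambda>f. \<phi> (\<psi> f))"
  by (simp add: lin_def)

definition lat_iso :: "nat \<Rightarrow> (qfun \<Rightarrow> qfun) \<Rightarrow>
    (qfun \<Rightarrow> qfun) \<Rightarrow> bool"
  where "lat_iso d \<phi> \<psi> \<longleftrightarrow> lin \<phi> \<and> lin \<psi> \<and> (\<forall>f. \<phi> (\<psi> f) = f \<and> \<psi> (\<phi> f) = f) \<and>
    (\<forall>j. \<forall>f\<in>lat d j. \<phi> f \<in> lat d j \<and> \<psi> f \<in> lat d j) \<and>
    (\<forall>f g. ip d (\<phi> f) (\<phi> g) = ip d f g) \<and> (\<forall>f\<in>fsup d. \<phi> f \<in> fsup d \<and> \<psi> f \<in> fsup d)"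

lemma lat_isoD:
  assumes "lat_iso d \<phi> \<psi>"
  shows "lin \<phi>" "lin \<psi>" "\<phi> (\<psi> f) = f" "\<psi> (\<phi> f) = f"
    "f \<in> lat d j \<Longrightarrow> \<phi> f \<in> lat d j" "f \<in> lat d j \<Longrightarrow> \<psi> f \<in> lat d j"
    "f \<in> fsup d \<Longrightarrow> \<phi> f \<in> fsup d" "f \<in> fsup d \<Longrightarrow> \<psi> f \<in> fsup d"
    "ip d (\<phi> f) (\<phi> g) = ip d f g" "ip d (\<psi> f) (\<psi> g) = ip d f g"
proof -
  show ip: "ip d (\<phi> f) (\<phi> g) = ip d f g" and inv: "\<phi> (\<psi> f) = f" for f g
    using assms by (auto simp: lat_iso_def)
  show "ip d (\<psi> f) (\<psi> g) = ip d f g"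
    using ip[of "\<psi> f" "\<psi> g"] by (simp add: inv)
qed (use assms in \<open>auto simp: lat_iso_def\<close>)

lemma lat_iso_comp:
  assumes "lat_iso d \<phi> \<psi>" "lat_iso d \<phi>' \<psi>'"
  shows "lat_iso d (\<lambda>f. \<phi> (\<phi>' f)) (\<lambda>f. \<psi>' (\<psi> f))"
  using assms unfolding lat_iso_def by (simp add: lin_comp)

context pauli
begin

abbreviation om :: "vec \<Rightarrow> vec \<Rightarrow> vec \<Rightarrow> vec \<Rightarrow> bit"
  where "om a l b m \<equiv> dot l b + dot m a"

abbreviation E :: "nat \<Rightarrow> qfun \<Rightarrow> qfun"
  where "E i \<equiv> W 0 0 (unit_vec i)"

lemma lin_W: "lin (W c a l)"
  by (simp add: lin_def)

lemma W_commute: "W c a l (W c' a' l' f) = sc (chi (om a l a' l')) (W c' a' l' (W c a l f))"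
proof -
  have "c + c' + dot l' a = (c' + c + dot l a') + om a l a' l'"
    by (simp add: ac_simps)
  then show ?thesis
    unfolding W_W by (simp add: W_sign[symmetric] ac_simps)
qed

lemma W_commute_0: "om a l a' l' = 0 \<Longrightarrow> W c a l (W c' a' l' f) = W c' a' l' (W c a l f)"
  and W_commute_1: "om a l a' l' = 1 \<Longrightarrow> W c a l (W c' a' l' f) = - W c' a' l' (W c a l f)"
  by (simp_all add: W_commute[of c a l] sc_neg_1)

text \<open>If the two operators also anticommuted, their product applied to the constant function 1
  would be its own negative, although its values are signs.\<close>

lemma om_eq_0I:
  assumes "\<And>f. W c a l (W c' a' l' f) = W c' a' l' (W c a l f)"
  shows "om a l a' l' = 0"
proof (rule ccontr)
  assume "om a l a' l' \<noteq> 0"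
  then have "W c' a' l' (W c a l f) = - W c' a' l' (W c a l f)" for f
    using W_commute_1[of l a' l' a c c' f] assms[of f] by simp
  then have "W c' a' l' (W c a l (\<lambda>_. 1)) v = - W c' a' l' (W c a l (\<lambda>_. 1)) v" for v
    by (metis fun_pt(3))
  then show False
    by (simp add: W_W) (simp add: W_def)
qed

lemma om_eq_1I:
  assumes "\<And>f. W c a l (W c' a' l' f) = - W c' a' l' (W c a l f)"
  shows "om a l a' l' = 1"
proof (rule ccontr)
  assume "om a l a' l' \<noteq> 1"
  then have "W c' a' l' (W c a l f) = - W c' a' l' (W c a l f)" for f
    using W_commute_0[of l a' l' a c c' f] assms[of f] by simp
  then have "W c' a' l' (W c a l (\<lambda>_. 1)) v = - W c' a' l' (W c a l (\<lambda>_. 1)) v" for v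
    by (metis fun_pt(3))
  then show False
    by (simp add: W_W) (simp add: W_def)
qed

lemma W_involution: "dot l a = 0 \<Longrightarrow> W c a l (W c a l f) = f"
  by (simp add: W_W)

lemma W_skew: "dot l a = 1 \<Longrightarrow> W c a l (W c a l f) = - f"
  using W_neg[of 0 0 0 f] by (simp add: W_W)

lemma dot_eq_0I: "(\<And>f. W c a l (W c a l f) = f) \<Longrightarrow> dot l a = 0"
  using W_skew[of l a c "\<lambda>_. 1"] by (cases "dot l a") (auto simp: fun_pt fun_eq_iff)

text \<open>The clauses are made for composing maps of different sizes: a map built on
  \<open>n\<close> coordinates has to be an isometry in every larger dimension, to permute the
  operators on those coordinates up to sign, and to leave alone every operator that commutes with
  all of them. The last clause lets a second conjugation keep what a first one has achieved.\<close>

definition cliff :: "nat \<Rightarrow> (qfun \<Rightarrow> qfun) \<Rightarrow>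
    (qfun \<Rightarrow> qfun) \<Rightarrow> bool"
  where "cliff n \<phi> \<psi> \<longleftrightarrow> (\<forall>d\<ge>n. lat_iso d \<phi> \<psi>) \<and>
    (\<forall>c. \<forall>a\<in>F2 n. \<forall>l\<in>F2 n. \<exists>c'. \<exists>a'\<in>F2 n. \<exists>l'\<in>F2 n. \<forall>f. \<phi> (W c a l f) = W c' a' l' (\<phi> f)) \<and>
    (\<forall>c a l. (\<forall>b\<in>F2 n. \<forall>m\<in>F2 n. om a l b m = 0) \<longrightarrow> (\<forall>f. \<phi> (W c a l f) = W c a l (\<phi> f)))"

text \<open>\<open>1 + N\<close> for a skew Pauli operator \<open>N\<close> is \<open>\<surd>2\<close> times an orthogonal map and takes
  \<open>lat d j\<close> to \<open>lat d (j + 1)\<close>, so half a product of two such maps is a lattice isometry.\<close>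

definition cay :: "bit \<Rightarrow> vec \<Rightarrow> vec \<Rightarrow> qfun \<Rightarrow> qfun"
  where "cay c a l f = f + W c a l f"

lemma lin_cay: "lin (cay c a l)"
  by (simp add: lin_def cay_def algebra_simps sc_add)

lemma cay_cay:
  assumes "dot l a = 1"
  shows "cay c a l (cay (c + 1) a l f) = sc 2 f" "cay (c + 1) a l (cay c a l f) = sc 2 f"
  using W_skew[OF assms, of c f] by (simp_all add: cay_def W_neg sc_2)

lemma cay_lat: "f \<in> lat d j \<Longrightarrow> a \<in> F2 d \<Longrightarrow> cay c a l f \<in> lat d (Suc j)"
  by (simp add: cay_def W_add_lat)

lemma cay_fsup: "f \<in> fsup d \<Longrightarrow> a \<in> F2 d \<Longrightarrow> cay c a l f \<in> fsup d"
  by (auto simp: cay_def intro: W_fsup)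

lemma ip_W_skew:
  assumes "a \<in> F2 d" "dot l a = 1"
  shows "ip d (W c a l f) g = - ip d f (W c a l g)"
  using ip_W_W[OF assms(1), of c l "W c a l f" g] W_skew[OF assms(2), of c f] by simp

lemma ip_cay:
  assumes "a \<in> F2 d" "dot l a = 1"
  shows "ip d (cay c a l f) (cay c a l g) = 2 * ip d f g"
  using ip_W_skew[OF assms, of c f g] by (simp add: cay_def ip_W_W[OF assms(1)])

text \<open>Let \<open>N\<close> be the skew operator. If \<open>P\<close> commutes with
  \<open>N\<close>, it commutes with \<open>1 + N\<close>. If it anticommutes, then
  \<open>(1 + N) P = P (1 - N)\<close>, and \<open>1 - N = - N (1 + N)\<close> because
  \<open>N\<close> squares to -1; so \<open>P\<close> goes to \<open>- P N\<close>.\<close>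

lemma cay_W:
  assumes "a \<in> F2 n" "l \<in> F2 n" "dot l a = 1" "a' \<in> F2 n" "l' \<in> F2 n"
  shows "\<exists>c''. \<exists>a''\<in>F2 n. \<exists>l''\<in>F2 n. \<forall>f. cay c a l (W c' a' l' f) = W c'' a'' l'' (cay c a l f)"
proof (cases "om a l a' l'")
  case zero
  then have "cay c a l (W c' a' l' f) = W c' a' l' (cay c a l f)" for f
    using W_commute_0[of l a' l' a c c' f] by (simp add: cay_def)
  then show ?thesis using assms by blast
next
  case one
  have "cay c a l (W c' a' l' f) = W (c' + c + dot l a' + 1) (a' + a) (l' + l) (cay c a l f)" for f
  proof -
    have "W (c' + c + dot l a' + 1) (a' + a) (l' + l) g = - W c' a' l' (W c a l g)" for g
      by (simp only: W_neg W_W)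
    moreover have "W c' a' l' (W c a l f) = - W c a l (W c' a' l' f)"
      using W_commute_1[of l a' l' a c c' f] one by simp
    ultimately show ?thesis
      using W_skew[OF assms(3), of c f] by (simp add: cay_def)
  qed
  then show ?thesis using assms by blast
qed

lemma cay_commute:
  assumes "om a l b m = 0"
  shows "cay c a l (W c' b m f) = W c' b m (cay c a l f)"
  using W_commute_0[OF assms, of c c' f] by (simp add: cay_def)

lemma lat_iso_cay_cay:
  assumes "a1 \<in> F2 d" "dot l1 a1 = 1" "a2 \<in> F2 d" "dot l2 a2 = 1"
  shows "lat_iso d (\<lambda>f. sc (1/2) (cay c1 a1 l1 (cay c2 a2 l2 f)))
    (\<lambda>f. sc (1/2) (cay (c2 + 1) a2 l2 (cay (c1 + 1) a1 l1 f)))"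
proof -
  have half: "sc (1/2) g \<in> lat d j" if "g \<in> lat d (Suc (Suc j))" for g j
    using that sc_2_in_lat_iff[of "sc (1/2) g" d j] by simp
  have "lin (\<lambda>f. sc (1/2) (cay c a l (cay c' a' l' f)))" for c a l c' a' l'
    using lin_cay by (simp add: lin_def sc_add mult.commute)
  moreover have "cay c a l (sc k f) = sc k (cay c a l f)" for c a l k f
    using lin_cay by (simp add: lin_def)
  ultimately show ?thesis
    unfolding lat_iso_def using assms
    by (auto simp: cay_cay ip_cay intro!: half cay_lat cay_fsup fsup_sc)
qed

lemma cliff_cay_cay:
  assumes "a1 \<in> F2 n" "l1 \<in> F2 n" "dot l1 a1 = 1" "a2 \<in> F2 n" "l2 \<in> F2 n" "dot l2 a2 = 1"
  shows "cliff n (\<lambda>f. sc (1/2) (cay c1 a1 l1 (cay c2 a2 l2 f)))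
    (\<lambda>f. sc (1/2) (cay (c2 + 1) a2 l2 (cay (c1 + 1) a1 l1 f)))"
  unfolding cliff_def
proof (intro conjI allI impI ballI)
  fix d assume "d \<ge> n"
  then show "lat_iso d (\<lambda>f. sc (1/2) (cay c1 a1 l1 (cay c2 a2 l2 f)))
    (\<lambda>f. sc (1/2) (cay (c2 + 1) a2 l2 (cay (c1 + 1) a1 l1 f)))"
    using assms F2_mono by (intro lat_iso_cay_cay) blast+
next
  fix c a l assume "a \<in> F2 n" "l \<in> F2 n"
  then obtain c' a' l' where 1: "a' \<in> F2 n" "l' \<in> F2 n"
    "\<And>f. cay c2 a2 l2 (W c a l f) = W c' a' l' (cay c2 a2 l2 f)"
    using cay_W[OF assms(4-6), of a l c2 c] by blast
  then obtain c'' a'' l'' where 2: "a'' \<in> F2 n" "l'' \<in> F2 n"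
    "\<And>f. cay c1 a1 l1 (W c' a' l' f) = W c'' a'' l'' (cay c1 a1 l1 f)"
    using cay_W[OF assms(1-3), of a' l' c1 c'] by blast
  show "\<exists>c'. \<exists>a'\<in>F2 n. \<exists>l'\<in>F2 n. \<forall>f. sc (1/2) (cay c1 a1 l1 (cay c2 a2 l2 (W c a l f))) =
      W c' a' l' (sc (1/2) (cay c1 a1 l1 (cay c2 a2 l2 f)))"
    using 1 2 by (intro exI[of _ c''] bexI[of _ a''] bexI[of _ l'']) auto
next
  fix c a l f assume "\<forall>b\<in>F2 n. \<forall>m\<in>F2 n. om a l b m = 0"
  then have "om a1 l1 a l = 0" "om a2 l2 a l = 0"
    using assms by (metis add.commute)+
  then show "sc (1/2) (cay c1 a1 l1 (cay c2 a2 l2 (W c a l f))) =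
      W c a l (sc (1/2) (cay c1 a1 l1 (cay c2 a2 l2 f)))"
    by (simp add: cay_commute)
qed

lemma cay_intertwine:
  assumes "dot lz az = 0" "dot ly ay = 0"
  shows "cay (cy + cz + dot lz ay) (ay + az) (ly + lz) (W cz az lz f) =
    W cy ay ly (cay (cy + cz + dot lz ay) (ay + az) (ly + lz) f)"
proof -
  have "W (cy + cz + dot lz ay) (ay + az) (ly + lz) g = W cy ay ly (W cz az lz g)" for g
    by (simp add: W_W)
  then show ?thesis
    using assms by (simp add: cay_def W_involution)
qed

text \<open>\<open>1 + yz\<close> intertwines \<open>z\<close> with \<open>y\<close>, so two such factors lead from \<open>z\<close> via \<open>y\<close> to \<open>s\<close>.\<close>

lemma cliff_conj_via:
  assumes z: "az \<in> F2 n" "lz \<in> F2 n" "dot lz az = 0"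
    and y: "ay \<in> F2 n" "ly \<in> F2 n" "dot ly ay = 0"
    and s: "as \<in> F2 n" "ls \<in> F2 n" "dot ls as = 0"
    and zy: "om az lz ay ly = 1" and ys: "om ay ly as ls = 1"
  shows "\<exists>\<phi> \<psi>. cliff n \<phi> \<psi> \<and> (\<forall>f. \<phi> (W cz az lz f) = W cs as ls (\<phi> f))"
proof -
  let ?c2 = "0 + cz + dot lz ay" and ?c1 = "cs + 0 + dot ly as"
  let ?\<phi> = "\<lambda>f. sc (1/2) (cay ?c1 (as + ay) (ls + ly) (cay ?c2 (ay + az) (ly + lz) f))"
  let ?\<psi> = "\<lambda>f. sc (1/2) (cay (?c2 + 1) (ay + az) (ly + lz) (cay (?c1 + 1) (as + ay) (ls + ly) f))"
  have "cliff n ?\<phi> ?\<psi>"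
    using assms by (intro cliff_cay_cay F2_add) (simp_all add: ac_simps)
  moreover have "?\<phi> (W cz az lz f) = W cs as ls (?\<phi> f)" for f
    unfolding cay_intertwine[OF z(3) y(3)] cay_intertwine[OF y(3) s(3)] W_linear ..
  ultimately show ?thesis by blast
qed

text \<open>It suffices to find an involution that anticommutes both with the given one and with
  \<open>E (n - 1)\<close>, that is, a singular label \<open>(b, m)\<close> orthogonal to neither of
  theirs. Anticommuting with \<open>E (n - 1)\<close> just means
  \<open>b (n - 1) = 1\<close>.\<close>

lemma cliff_conj:
  assumes n: "2 \<le> n" "n \<le> D" and z: "a \<in> F2 n" "l \<in> F2 n" "dot l a = 0" "a \<noteq> 0 \<or> l \<noteq> 0"
  shows "\<exists>\<phi> \<psi>. cliff n \<phi> \<psi> \<and> (\<forall>f. \<phi> (W c a l f) = E (n - 1) (\<phi> f))"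
proof -
  define N where "N = n - 1"
  have N: "N < D" "N < n" "0 < D" "0 < n" "0 \<noteq> N" using n by (auto simp: N_def)
  have eq_unit: "v = unit_vec N" if "v \<in> F2 n" "\<forall>i<N. v i = 0" "v N = 1" for v
  proof
    fix i show "v i = unit_vec N i"
      using that by (cases i N rule: linorder_cases) (auto simp: unit_vec_def F2_def N_def)
  qed
  have eq_0: "v = 0" if "v \<in> F2 n" "\<forall>i<N. v i = 0" "v N = 0" for v
  proof
    fix i show "v i = 0 i"
      using that by (cases i N rule: linorder_cases) (auto simp: fun_pt F2_def N_def)
  qed
  \<comment> \<open>The translation \<open>b\<close> always contains \<open>unit_vec N\<close>. If
    \<open>a\<close> or \<open>l\<close> is nonzero at some \<open>i < N\<close>, that coordinate
    repairs the value of the form when necessary. If \<open>a\<close> is \<open>unit_vec N\<close>,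
    singularity gives \<open>l N = 0\<close> and coordinate 0 serves instead, which differs from
    \<open>N\<close> because \<open>2 \<le> n\<close>.\<close>
  have "\<exists>b\<in>F2 n. \<exists>m\<in>F2 n. dot m b = 0 \<and> dot m a + dot l b = 1 \<and> b N = 1"
  proof (cases "\<exists>i<N. a i = 1")
    case True
    then obtain i where i: "i < N" "a i = 1" by blast
    then have "i < D" "i < n" using N by auto
    then show ?thesis
      using i N by (cases "l N"; intro bexI[of _ "unit_vec N"] bexI[of _ "if l N = 0 then unit_vec i else 0"])
        (auto simp: unit_vec_apply)
  next
    case noA: False
    show ?thesis
    proof (cases "a N")
      case one
      then have "a = unit_vec N" using noA z by (intro eq_unit) auto
      then have "l N = 0" using z N by simp
      then show ?thesis
        using N one noA
        by (intro bexI[of _ "unit_vec N + unit_vec 0"]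
            bexI[of _ "if l 0 = 0 then unit_vec 0 + unit_vec N else 0"])
          (auto simp: unit_vec_apply fun_pt intro!: F2_add)
    next
      case zero
      then have "a = 0" using noA z by (intro eq_0) auto
      show ?thesis
      proof (cases "\<exists>i<N. l i = 1")
        case True
        then obtain i where i: "i < N" "l i = 1" by blast
        show ?thesis
          using i N \<open>a = 0\<close>
          by (intro bexI[of _ "unit_vec N + (if l N = 0 then unit_vec i else 0)"] bexI[of _ 0])
            (auto simp: unit_vec_apply fun_pt intro!: F2_add)
      next
        case False
        have "l N = 1"
        proof (rule ccontr)
          assume "l N \<noteq> 1"
          then have "l = 0" using False z by (intro eq_0) auto
          with z \<open>a = 0\<close> show False by simp
        qed
        then show ?thesis
          using N by (intro bexI[of _ "unit_vec N"] bexI[of _ 0]) (auto simp: unit_vec_apply)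
      qed
    qed
  qed
  then obtain b m where b: "b \<in> F2 n" "m \<in> F2 n" "dot m b = 0" "dot m a + dot l b = 1" "b N = 1"
    by blast
  show ?thesis
    unfolding N_def[symmetric]
    by (rule cliff_conj_via[of a n l b m]) (use z b N in \<open>simp_all add: ac_simps\<close>)
qed

lemma cliffD:
  assumes "cliff n \<phi> \<psi>"
  shows "n \<le> d \<Longrightarrow> lat_iso d \<phi> \<psi>"
    "a \<in> F2 n \<Longrightarrow> l \<in> F2 n \<Longrightarrow>
      \<exists>c'. \<exists>a'\<in>F2 n. \<exists>l'\<in>F2 n. \<forall>f. \<phi> (W c a l f) = W c' a' l' (\<phi> f)"
    "(\<And>b m. b \<in> F2 n \<Longrightarrow> m \<in> F2 n \<Longrightarrow> om a l b m = 0) \<Longrightarrow> \<phi> (W c a l f) = W c a l (\<phi> f)"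
  using assms unfolding cliff_def by blast+

text \<open>The product \<open>gz\<close> may replace \<open>g\<close> because it agrees with \<open>g\<close> on the fixed vectors of \<open>z\<close>.\<close>

lemma lat_iso_conj_pair:
  assumes D: "3 \<le> D"
    and z: "az \<in> F2 D" "lz \<in> F2 D" "dot lz az = 0" "az \<noteq> 0 \<or> lz \<noteq> 0"
    and g: "ag \<in> F2 D" "lg \<in> F2 D" "dot lg ag = 0"
    and a: "aa \<in> F2 D" "la \<in> F2 D"
    and zg: "om az lz ag lg = 0" and za: "om az lz aa la = 0" and ga: "om ag lg aa la = 1"
  shows "\<exists>\<phi> \<psi>. lat_iso D \<phi> \<psi> \<and> (\<forall>f. \<phi> (W cz az lz f) = E (D - 1) (\<phi> f)) \<and>
    ((\<forall>f. \<phi> (W cg ag lg f) = E (D - 2) (\<phi> f)) \<or>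
     (\<forall>f. \<phi> (W cg ag lg (W cz az lz f)) = E (D - 2) (\<phi> f)))"
proof -
  define n where "n = D - 1"
  have n: "2 \<le> n" "n < D" "n \<le> D" "D - 2 = n - 1" using D by (auto simp: n_def)
  obtain \<phi>1 \<psi>1 where c1: "cliff D \<phi>1 \<psi>1" and \<phi>z: "\<And>f. \<phi>1 (W cz az lz f) = E n (\<phi>1 f)"
    using cliff_conj[of D az lz cz] D z by (auto simp: n_def)
  note iso1 = lat_isoD[OF cliffD(1)[OF c1 order.refl]] and \<phi>lin = lin_simps[OF lat_isoD(1)[OF cliffD(1)[OF c1 order.refl]]]
  obtain cg' ag' lg' where g': "ag' \<in> F2 D" "lg' \<in> F2 D"
    and \<phi>g: "\<And>f. \<phi>1 (W cg ag lg f) = W cg' ag' lg' (\<phi>1 f)"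
    using cliffD(2)[OF c1 g(1,2), of cg] by blast
  obtain ca' aa' la' where a': "aa' \<in> F2 D" "la' \<in> F2 D"
    and \<phi>a: "\<And>f. \<phi>1 (W 0 aa la f) = W ca' aa' la' (\<phi>1 f)"
    using cliffD(2)[OF c1 a, of 0] by blast
  have surj: "\<exists>h. f = \<phi>1 h" for f
    using iso1(3)[of f] by metis
  have sing: "dot lg' ag' = 0"
  proof (rule dot_eq_0I)
    fix f
    obtain h where "f = \<phi>1 h" using surj by blast
    then show "W cg' ag' lg' (W cg' ag' lg' f) = f"
      using W_involution[OF g(3), of cg h] by (simp add: \<phi>g[symmetric])
  qed
  have zg': "om 0 (unit_vec n) ag' lg' = 0"
  proof (rule om_eq_0I)
    fix f
    obtain h where "f = \<phi>1 h" using surj by blast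
    then show "E n (W cg' ag' lg' f) = W cg' ag' lg' (E n f)"
      using W_commute_0[OF zg, of cz cg h] by (simp only: \<phi>g[symmetric] \<phi>z[symmetric])
  qed
  have za': "om 0 (unit_vec n) aa' la' = 0"
  proof (rule om_eq_0I)
    fix f
    obtain h where "f = \<phi>1 h" using surj by blast
    then show "E n (W ca' aa' la' f) = W ca' aa' la' (E n f)"
      using W_commute_0[OF za, of cz 0 h] by (simp only: \<phi>a[symmetric] \<phi>z[symmetric])
  qed
  have ga': "om ag' lg' aa' la' = 1"
  proof (rule om_eq_1I)
    fix f
    obtain h where "f = \<phi>1 h" using surj by blast
    then show "W cg' ag' lg' (W ca' aa' la' f) = - W ca' aa' la' (W cg' ag' lg' f)"
      using W_commute_1[OF ga, of cg 0 h] by (simp only: \<phi>g[symmetric] \<phi>a[symmetric] \<phi>lin(3)[symmetric])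
  qed
  \<comment> \<open>The images of \<open>g\<close> and \<open>a\<close> commute with
    \<open>E n\<close>, so they do not translate the last coordinate. Hence the image of
    \<open>g\<close> is an operator on \<open>n\<close> coordinates, up to a factor
    \<open>E n\<close>, the image of \<open>z\<close>.\<close>
  have agn: "ag' n = 0" and aan: "aa' n = 0"
    using zg' za' n by simp_all
  have restr: "v \<in> F2 n" if "v \<in> F2 D" "v n = 0" for v
  proof -
    have "v i = 0" if "i \<ge> n" for i
      using \<open>v \<in> F2 D\<close> \<open>v n = 0\<close> that by (cases "i = n") (auto simp: F2_def n_def)
    then show ?thesis by (simp add: F2_def)
  qed
  define l where "l = lg' + (if lg' n = 0 then 0 else unit_vec n)"
  have l: "l \<in> F2 n"
    by (rule restr) (use g' n in \<open>auto simp: l_def fun_pt unit_vec_apply intro!: F2_add\<close>)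
  have sing_l: "dot l ag' = 0"
    using sing agn n by (simp add: l_def)
  \<comment> \<open>The image of \<open>a\<close> serves as a witness: it anticommutes with the
    stripped operator, which therefore has a nonzero label and can be conjugated.\<close>
  have "om ag' l aa' la' = 1"
    using ga' aan n by (simp add: l_def)
  then have "ag' \<noteq> 0 \<or> l \<noteq> 0" by auto
  then obtain \<phi>2 \<psi>2 where c2: "cliff n \<phi>2 \<psi>2"
    and \<phi>2: "\<And>f. \<phi>2 (W cg' ag' l f) = E (n - 1) (\<phi>2 f)"
    using cliff_conj[OF n(1,3) restr[OF g'(1) agn] l sing_l] by blast
  have \<phi>2E: "\<phi>2 (E n f) = E n (\<phi>2 f)" for f
    by (rule cliffD(3)[OF c2]) (use n in \<open>auto simp: F2_def\<close>)
  let ?\<phi> = "\<lambda>f. \<phi>2 (\<phi>1 f)" and ?\<psi> = "\<lambda>f. \<psi>1 (\<psi>2 f)"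
  have "lat_iso D ?\<phi> ?\<psi>"
    by (rule lat_iso_comp[OF cliffD(1)[OF c2 n(3)] cliffD(1)[OF c1 order.refl]])
  moreover have "?\<phi> (W cz az lz f) = E (D - 1) (?\<phi> f)" for f
    by (simp only: \<phi>z \<phi>2E n_def[symmetric])
  moreover have "(\<forall>f. ?\<phi> (W cg ag lg f) = E (D - 2) (?\<phi> f)) \<or>
     (\<forall>f. ?\<phi> (W cg ag lg (W cz az lz f)) = E (D - 2) (?\<phi> f))"
  proof (cases "lg' n = 0")
    case True
    then have "lg' = l" by (simp add: l_def)
    then show ?thesis unfolding n(4) by (simp only: \<phi>g \<phi>2) simp
  next
    case False
    then have "W cg' ag' lg' (E n f) = W cg' ag' l f" for f
      using agn n by (simp add: W_W l_def)
    then show ?thesis unfolding n(4) by (simp only: \<phi>g \<phi>z \<phi>2) simp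
  qed
  ultimately show ?thesis
    by (intro exI[of _ ?\<phi>] exI[of _ ?\<psi>] conjI) blast+
qed

end

section \<open>Affine subspaces\<close>

lemma mem_translate:
  fixes v a :: vec
  shows "v \<in> (\<lambda>x. x + a) ` A \<longleftrightarrow> v + a \<in> A" "v \<in> (+) a ` A \<longleftrightarrow> v + a \<in> A"
proof -
  have inv: "(x + a) + a = x" for x
    by (simp only: add.assoc vec_add_self add_0_right)
  show *: "v \<in> (\<lambda>x. x + a) ` A \<longleftrightarrow> v + a \<in> A"
  proof
    assume "v \<in> (\<lambda>x. x + a) ` A"
    then obtain x where "x \<in> A" "v = x + a" by blast
    then show "v + a \<in> A" by (simp only: inv)
  next
    assume "v + a \<in> A"
    then have "(v + a) + a \<in> (\<lambda>x. x + a) ` A" by (rule imageI)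
    then show "v \<in> (\<lambda>x. x + a) ` A" by (simp only: inv)
  qed
  show "v \<in> (+) a ` A \<longleftrightarrow> v + a \<in> A"
    unfolding add.commute[of a] by (rule *)
qed

lemma add_unit_vec_in_F2:
  assumes "v \<in> F2 (Suc n)" "v \<notin> F2 n"
  shows "v + unit_vec n \<in> F2 n"
  using assms(1)
proof (cases rule: F2_Suc_cases)
  case (2 w)
  then show ?thesis by (simp only: add.assoc vec_add_self add_0_right)
qed (use assms in simp)

text \<open>Over two elements, closure under addition and containing 0 already make a subspace, and
  its dimension can be read off its cardinality. In this form a flat can be split along a coordinate
  by counting.\<close>

definition flat :: "nat \<Rightarrow> nat \<Rightarrow> vec set \<Rightarrow> bool"
  where "flat n k A \<longleftrightarrow> (\<exists>a\<in>F2 n. \<exists>U\<subseteq>F2 n. 0 \<in> U \<and> (\<forall>x\<in>U. \<forall>y\<in>U. x + y \<in> U) \<and>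
    card U = 2 ^ k \<and> A = (+) a ` U)"

lemma card_subgroup_coset_union:
  fixes U :: "vec set"
  assumes "finite U" "0 \<in> U" "\<forall>x\<in>U. \<forall>y\<in>U. x + y \<in> U" "u \<notin> U"
  shows "card (U \<union> (+) u ` U) = 2 * card U"
proof -
  have "U \<inter> (+) u ` U = {}"
  proof (rule ccontr)
    assume "U \<inter> (+) u ` U \<noteq> {}"
    then obtain x where "x \<in> U" "u + x \<in> U" by auto
    then have "(u + x) + x \<in> U" using assms by blast
    with assms show False by (simp add: add.assoc)
  qed
  moreover have "card ((+) u ` U) = card U"
    by (rule card_image) (simp add: inj_on_def)
  ultimately show ?thesis
    using assms by (simp add: card_Un_disjoint)
qed

lemma translate_subgroup:
  fixes U :: "vec set"
  assumes "\<forall>x\<in>U. \<forall>y\<in>U. x + y \<in> U" "u \<in> U"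
  shows "(+) u ` U = U"
proof
  show "U \<subseteq> (+) u ` U"
    using assms by (simp add: subset_iff mem_translate)
qed (use assms in auto)

lemma coset_union_closed:
  fixes U :: "vec set"
  assumes "\<forall>x\<in>U. \<forall>y\<in>U. x + y \<in> U"
  shows "\<forall>x\<in>U \<union> (+) u ` U. \<forall>y\<in>U \<union> (+) u ` U. x + y \<in> U \<union> (+) u ` U"
proof (intro ballI)
  have eq: "x + (u + y) = u + (x + y)" "(u + x) + (u + y) = x + y" "(u + x) + y = u + (x + y)"
    for x y by (simp_all add: ac_simps)
  fix x y assume "x \<in> U \<union> (+) u ` U" "y \<in> U \<union> (+) u ` U"
  then show "x + y \<in> U \<union> (+) u ` U"
    using assms by (auto simp: eq)
qed

lemma subspace_f2_iff: "f2.subspace U \<longleftrightarrow> 0 \<in> U \<and> (\<forall>x\<in>U. \<forall>y\<in>U. x + y \<in> U)"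
proof -
  have "bit_scale c x \<in> U" if "0 \<in> U" "x \<in> U" for c x
    using that by (cases c) (simp_all add: bit_scale_def zero_fun_def[symmetric])
  then show ?thesis
    unfolding f2.subspace_def by blast
qed

lemma card_span_f2:
  assumes "finite B" "f2.independent B"
  shows "finite (f2.span B) \<and> card (f2.span B) = 2 ^ card B"
  using assms
proof (induction B)
  case (insert b B)
  have b: "b \<notin> f2.span B" and ind: "f2.independent B"
    using insert by (simp_all add: f2.independent_insert)
  have "f2.span (insert b B) = f2.span B \<union> (+) b ` f2.span B"
  proof
    show "f2.span (insert b B) \<subseteq> f2.span B \<union> (+) b ` f2.span B"
    proof
      fix x assume "x \<in> f2.span (insert b B)"
      then obtain k where k: "x - bit_scale k b \<in> f2.span B"
        by (auto simp: f2.span_insert)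
      show "x \<in> f2.span B \<union> (+) b ` f2.span B"
      proof (cases k)
        case zero
        then show ?thesis using k by (simp add: bit_scale_def zero_fun_def[symmetric])
      next
        case one
        then have "x - b \<in> f2.span B" using k by (simp add: bit_scale_def)
        moreover have "x = b + (x - b)" by simp
        ultimately show ?thesis by blast
      qed
    qed
    show "f2.span B \<union> (+) b ` f2.span B \<subseteq> f2.span (insert b B)"
      using f2.span_mono[of B "insert b B"]
      by (auto intro!: f2.span_add f2.span_base[of b "insert b B"] del: f2.span_base)
  qed
  moreover have "card (f2.span B \<union> (+) b ` f2.span B) = 2 * card (f2.span B)"
    using insert.IH[OF ind] b by (intro card_subgroup_coset_union) (auto intro: f2.span_add f2.span_zero)
  ultimately show ?case
    using insert ind by simp
qed simp

lemma card_subspace_f2: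
  assumes "f2.subspace U" "finite U"
  shows "card U = 2 ^ f2.dim U"
proof -
  obtain B where B: "B \<subseteq> U" "f2.independent B" "U \<subseteq> f2.span B" "card B = f2.dim U"
    using f2.basis_exists by blast
  have "f2.span B = U"
    using B assms f2.span_minimal by blast
  then show ?thesis
    using card_span_f2[of B] B assms finite_subset by metis
qed

lemma affine_subspace_iff_flat: "affine_subspace d k A \<longleftrightarrow> flat d k A"
proof -
  have "f2.subspace U \<and> f2.dim U = k \<longleftrightarrow>
      0 \<in> U \<and> (\<forall>x\<in>U. \<forall>y\<in>U. x + y \<in> U) \<and> card U = 2 ^ k" if "U \<subseteq> F2 d" for U
  proof (cases "f2.subspace U")
    case True
    have "finite U" using that finite_F2 finite_subset by blast
    then show ?thesis
      using True card_subspace_f2[OF True] by (simp add: subspace_f2_iff)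
  qed (auto simp: subspace_f2_iff)
  then show ?thesis
    unfolding affine_subspace_def flat_def by (metis (no_types, lifting))
qed

lemma flat_subset:
  assumes "flat n k A"
  shows "A \<subseteq> F2 n"
proof -
  obtain a U where "a \<in> F2 n" "U \<subseteq> F2 n" "A = (+) a ` U"
    using assms unfolding flat_def by blast
  then show ?thesis by (auto intro!: F2_add)
qed

lemma flat_finite: "flat n k A \<Longrightarrow> finite A"
  by (rule finite_subset[OF flat_subset finite_F2])

lemma flat_dim_le:
  assumes "flat n k A"
  shows "k \<le> n"
proof -
  obtain U where "U \<subseteq> F2 n" "card U = 2 ^ k"
    using assms by (auto simp: flat_def)
  then have "(2::nat) ^ k \<le> 2 ^ n"
    using card_mono[OF finite_F2] card_F2 by metis
  then show ?thesis by simp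
qed

definition ind :: "vec set \<Rightarrow> qfun"
  where "ind A = (\<lambda>v. if v \<in> A then 1 else 0)"

lemma sum_basis_vec: "finite A \<Longrightarrow> (\<Sum>v\<in>A. basis_vec v) = ind A"
proof (induction A rule: finite_induct)
  case (insert a A)
  have "basis_vec a + ind A = ind (insert a A)"
  proof
    fix v show "(basis_vec a + ind A) v = ind (insert a A) v"
      using insert(2) by (cases "v = a") (simp_all add: ind_def basis_vec_def fun_pt)
  qed
  then show ?case using insert by simp
qed (simp add: fun_eq_iff fun_pt ind_def)

lemma int_scale_eq_sc: "int_scale k f = sc (of_int k) f"
  by (simp add: int_scale_def sc_def)

lemma ind_fsup: "A \<subseteq> F2 n \<Longrightarrow> ind A \<in> fsup n"
  by (auto simp: ind_def fsup_def)

text \<open>If the direction space lies in \<open>F2 n\<close>, the flat sits in one half, and the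
  coordinate is traded for a level. Otherwise it meets the halves in parallel flats of dimension one
  less. The exponent is the same in either case.\<close>

lemma flat_lat: "flat n k A \<Longrightarrow> sc (2 ^ ((n + j - k) div 2)) (ind A) \<in> lat n j"
proof (induction n arbitrary: j k A)
  case 0
  have "k = 0" using flat_dim_le[OF 0] by simp
  moreover have "A = {0}" using 0 by (auto simp: flat_def F2_0)
  ultimately show ?case
    unfolding mem_lat_0
    by (intro conjI fsup_sc ind_fsup exI[of _ 1]) (auto simp: sc_def ind_def)
next
  case (Suc n)
  obtain a U where a: "a \<in> F2 (Suc n)" and U: "U \<subseteq> F2 (Suc n)" "0 \<in> U"
    "\<forall>x\<in>U. \<forall>y\<in>U. x + y \<in> U" "card U = 2 ^ k" and A: "A = (+) a ` U"
    using Suc.prems by (auto simp: flat_def)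
  define c :: rat where "c = 2 ^ ((Suc n + j - k) div 2)"
  have fs: "sc c (ind A) \<in> fsup (Suc n)"
    by (intro fsup_sc ind_fsup flat_subset[OF Suc.prems])
  show ?case
  proof (cases "U \<subseteq> F2 n")
    case True
    have fl: "flat n k ((+) b ` U)" if "b \<in> F2 n" for b
      using that True U unfolding flat_def by blast
    from a show ?thesis
    proof (cases rule: F2_Suc_cases)
      case 1
      have "sc c (ind A) \<in> lat n (Suc j)"
        using Suc.IH[OF fl[OF 1], of "Suc j"] by (simp add: A c_def)
      then show ?thesis
        unfolding c_def using lat_Suc_lower_half[OF lat_subset_fsup] by blast
    next
      case (2 b)
      have "lo n (sc c (ind A)) = 0"
        unfolding A 2(2) fun_eq_iff
      proof
        fix v
        have "v \<notin> F2 n" if "v = b + unit_vec n + u" "u \<in> U" for u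
          using add_unit_vec_notin_F2[of "b + u" n] that 2 True by (auto simp: ac_simps)
        then show "lo n (sc c (ind ((\<lambda>u. b + unit_vec n + u) ` U))) v = 0 v"
          by (auto simp: lo_def sc_def ind_def fun_pt)
      qed
      moreover have "hi n (sc c (ind A)) = sc c (ind ((+) b ` U))"
        unfolding A 2(2) fun_eq_iff
      proof
        fix v
        have "v + unit_vec n \<in> (\<lambda>u. b + unit_vec n + u) ` U \<longleftrightarrow> v \<in> (+) b ` U"
          by (simp add: mem_translate ac_simps)
        moreover have "v \<in> F2 n" if "v \<in> (+) b ` U"
          using that 2 True by auto
        ultimately show "hi n (sc c (ind ((\<lambda>u. b + unit_vec n + u) ` U))) v = sc c (ind ((+) b ` U)) v"
          by (auto simp: hi_def sc_def ind_def)
      qed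
      ultimately show ?thesis
        using fs Suc.IH[OF fl[OF 2(1)], of "Suc j"] by (simp add: c_def)
    qed
  next
    case False
    then obtain u where u: "u \<in> U" "u \<notin> F2 n" by blast
    define w where "w = u + unit_vec n"
    have w: "w \<in> F2 n"
      unfolding w_def using U(1) u by (intro add_unit_vec_in_F2) auto
    have uw: "u = w + unit_vec n"
      by (simp only: w_def add.assoc vec_add_self add_0_right)
    define V where "V = U \<inter> F2 n"
    have V: "V \<subseteq> F2 n" "0 \<in> V" "\<forall>x\<in>V. \<forall>y\<in>V. x + y \<in> V" "finite V" "u \<notin> V"
      using U u by (auto simp: V_def)
    have UV: "U = V \<union> (+) u ` V"
    proof
      show "U \<subseteq> V \<union> (+) u ` V"
      proof
        fix x assume x: "x \<in> U"
        show "x \<in> V \<union> (+) u ` V"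
        proof (cases "x \<in> F2 n")
          case False
          have "u + x \<in> U" using U u x by blast
          moreover have "w + (x + unit_vec n) \<in> F2 n"
            by (rule F2_add[OF w add_unit_vec_in_F2]) (use U(1) x False in auto)
          then have "u + x \<in> F2 n"
            by (simp only: uw ac_simps)
          ultimately have "x + u \<in> V" by (simp add: V_def add.commute)
          then show ?thesis by (simp add: mem_translate)
        qed (use x in \<open>simp add: V_def\<close>)
      qed
    qed (use U u in \<open>auto simp: V_def\<close>)
    have "2 ^ k = 2 * card V"
      using card_subgroup_coset_union[OF V(4,2,3,5)] UV U by simp
    then obtain m where k: "k = Suc m" and cV: "card V = 2 ^ m"
      by (cases k) auto
    obtain b where b: "b \<in> F2 n" and Ab: "A = (+) b ` U"
    proof -
      from a show ?thesis
      proof (cases rule: F2_Suc_cases)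
        case 1
        then show ?thesis using that A by blast
      next
        case (2 b)
        have "(+) u ` U = U" by (rule translate_subgroup[OF U(3) u(1)])
        then have "A = (+) a ` (+) u ` U" using A by simp
        also have "\<dots> = (+) (b + w) ` U"
          by (simp add: image_image 2 uw ac_simps)
        finally show ?thesis using that 2 w by blast
      qed
    qed
    have fl: "flat n m ((+) e ` V)" if "e \<in> F2 n" for e
      unfolding flat_def using that V cV by blast
    define A0 where "A0 = (+) b ` V"
    define A1 where "A1 = (+) (b + w) ` V"
    have A0: "A0 \<subseteq> F2 n" and A1: "A1 \<subseteq> F2 n"
      using V b w by (auto simp: A0_def A1_def)
    have mem0: "v \<in> A \<longleftrightarrow> v \<in> A0" if "v \<in> F2 n" for v
    proof -
      have "v \<noteq> b + (u + x)" if "x \<in> V" for x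
        using add_unit_vec_notin_F2[of "b + w + x" n] that b w V \<open>v \<in> F2 n\<close> by (auto simp: uw ac_simps)
      then show ?thesis by (auto simp: Ab A0_def UV image_Un image_image)
    qed
    have mem1: "v + unit_vec n \<in> A \<longleftrightarrow> v \<in> A1" if "v \<in> F2 n" for v
    proof -
      have "v + unit_vec n \<noteq> b + x" if "x \<in> V" for x
        using add_unit_vec_notin_F2[OF \<open>v \<in> F2 n\<close>] F2_add[of b n x] that b V by auto
      moreover have "v + unit_vec n = b + (u + x) \<longleftrightarrow> v = (b + w) + x" for x
        by (simp add: uw vec_add_eq_iff ac_simps)
      ultimately show ?thesis by (auto simp: Ab A1_def UV image_Un image_image)
    qed
    have lo: "lo n (sc c (ind A)) = sc c (ind A0)" and hi: "hi n (sc c (ind A)) = sc c (ind A1)"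
      using mem0 mem1 A0 A1 by (auto simp: lo_def hi_def sc_def ind_def fun_eq_iff)
    have 0: "sc c (ind A0) \<in> lat n j"
      using Suc.IH[OF fl[OF b], of j] k by (simp add: c_def A0_def)
    have "sc c (ind A1) - sc c (ind A0) \<in> lat n (Suc j)"
    proof (cases "w \<in> V")
      case True
      have "(+) w ` V = V" by (rule translate_subgroup[OF V(3) True])
      then have "A1 = A0"
        unfolding A1_def A0_def by (metis (no_types, lifting) add.assoc image_cong image_image)
      then show ?thesis by simp
    next
      case False
      define V' where "V' = V \<union> (+) w ` V"
      have "V' \<subseteq> F2 n" "0 \<in> V'" using V w by (auto simp: V'_def)
      moreover have "\<forall>x\<in>V'. \<forall>y\<in>V'. x + y \<in> V'"
        unfolding V'_def by (rule coset_union_closed[OF V(3)])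
      moreover have "card V' = 2 ^ k"
        using card_subgroup_coset_union[OF V(4,2,3) False] cV k by (simp add: V'_def)
      ultimately have "flat n k ((+) b ` V')"
        unfolding flat_def using b by blast
      then have "sc c (ind ((+) b ` V')) \<in> lat n (Suc j)"
        using Suc.IH[of k _ "Suc j"] by (simp add: c_def)
      \<comment> \<open>The difference of disjoint parallel flats is their union minus a double. The
        union is a flat of dimension \<open>k\<close>, for which \<open>c\<close> is the right
        coefficient at level \<open>Suc j\<close>, and the double reaches that level as
        well.\<close>
      moreover have "sc c (ind A1) - sc c (ind A0) = sc c (ind ((+) b ` V')) - (sc c (ind A0) + sc c (ind A0))"
      proof -
        have un: "(+) b ` V' = A0 \<union> A1"
          by (auto simp: V'_def A0_def A1_def image_Un image_image add.assoc)
        have disj: "A0 \<inter> A1 = {}"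
        proof (rule ccontr)
          assume "A0 \<inter> A1 \<noteq> {}"
          then obtain v where "v \<in> A0" "v \<in> A1" by blast
          then obtain x y where xy: "x \<in> V" "y \<in> V" and "v = b + x" "v = (b + w) + y"
            unfolding A0_def A1_def by blast
          then have "b + x = b + (w + y)" by (simp only: add.assoc)
          then have "x = w + y" by simp
          then have "x + y = w" by (simp only: add.assoc vec_add_self add_0_right)
          with V xy False show False by blast
        qed
        show ?thesis
          unfolding un using disj by (auto simp: fun_eq_iff fun_pt sc_def ind_def)
      qed
      ultimately show ?thesis
        using lat_diff[OF _ lat_double'[OF 0]] by (simp only:)
    qed
    then show ?thesis
      unfolding mem_lat_Suc c_def[symmetric] lo hi using fs 0 by blast
  qed
qed

definition flat_gens :: "nat \<Rightarrow> nat \<Rightarrow> qfun set"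
  where "flat_gens n j = {sc (2 ^ ((n + j - k) div 2)) (ind A) | k A. flat n k A}"

lemma subspace_lat: "zmod.subspace (lat n j)"
proof -
  have "sc (of_int k) f \<in> lat n j" if "f \<in> lat n j" for k f
  proof -
    have nat: "sc (of_nat i) f \<in> lat n j" for i
    proof (induction i)
      case 0
      have "sc 0 f = 0" by (simp add: sc_def fun_eq_iff fun_pt)
      then show ?case by simp
    next
      case (Suc i)
      have "sc (of_nat (Suc i)) f = f + sc (of_nat i) f"
        by (simp add: sc_def fun_eq_iff fun_pt algebra_simps)
      then show ?case using Suc that by (metis lat_add)
    qed
    show ?thesis
    proof (cases k rule: int_cases2)
      case (nonpos i)
      have "sc (of_int k) f = - sc (of_nat i) f"
        by (simp add: nonpos sc_def fun_eq_iff fun_pt)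
      then show ?thesis using nat[of i] by (simp add: lat_minus)
    qed (use nat in simp)
  qed
  then show ?thesis
    unfolding zmod.subspace_def by (auto simp: int_scale_eq_sc)
qed

text \<open>The reason is the decomposition \<open>(x | x + z) = (x | x) + (0 | z)\<close>.
  Extending a flat along the new coordinate raises \<open>n\<close> and \<open>k\<close> together,
  and moving it to the upper half trades the coordinate for a level; so both maps send generators to
  generators with the same coefficient.\<close>

lemma lat_subset_span: "f \<in> lat n j \<Longrightarrow> f \<in> zmod.span (flat_gens n j)"
proof (induction n arbitrary: j f)
  case 0
  then obtain k where k: "f \<in> fsup 0" "f 0 = of_int k * 2 ^ (j div 2)"
    by (auto simp: mem_lat_0)
  have "flat 0 0 {0}" by (auto simp: flat_def F2_0 intro!: exI[of _ "{0}"])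
  then have "sc (2 ^ (j div 2)) (ind {0}) \<in> flat_gens 0 j"
    by (force simp: flat_gens_def)
  then have "int_scale k (sc (2 ^ (j div 2)) (ind {0})) \<in> zmod.span (flat_gens 0 j)"
    by (intro zmod.span_scale zmod.span_base)
  moreover have "f = int_scale k (sc (2 ^ (j div 2)) (ind {0}))"
  proof
    fix v show "f v = int_scale k (sc (2 ^ (j div 2)) (ind {0})) v"
      using k by (cases "v = 0") (auto simp: int_scale_def sc_def ind_def fsup_def F2_0)
  qed
  ultimately show ?case by metis
next
  case (Suc n)
  define dup :: "qfun \<Rightarrow> qfun"
    where "dup x = (\<lambda>v. x v + x (v + unit_vec n))" for x
  define up :: "qfun \<Rightarrow> qfun"
    where "up x = (\<lambda>v. x (v + unit_vec n))" for x
  let ?S = "zmod.span (flat_gens (Suc n) j)"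
  have x: "lo n f \<in> lat n j" and z: "hi n f - lo n f \<in> lat n (Suc j)" and f: "f \<in> fsup (Suc n)"
    using Suc.prems by auto
  have dup_gen: "dup g \<in> ?S" if "g \<in> flat_gens n j" for g
  proof -
    from that obtain k A where g: "g = sc (2 ^ ((n + j - k) div 2)) (ind A)" and fl: "flat n k A"
      by (auto simp: flat_gens_def)
    then obtain a U where a: "a \<in> F2 n" and U: "U \<subseteq> F2 n" "0 \<in> U"
      "\<forall>x\<in>U. \<forall>y\<in>U. x + y \<in> U" "card U = 2 ^ k" and A: "A = (+) a ` U"
      by (auto simp: flat_def)
    define V where "V = U \<union> (\<lambda>x. unit_vec n + x) ` U"
    have nU: "unit_vec n \<notin> U" using U by auto
    have "finite U" using U finite_F2 finite_subset by blast
    have "V \<subseteq> F2 (Suc n)" "0 \<in> V" using U by (auto simp: V_def F2_mono intro!: F2_add)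
    moreover have "\<forall>x\<in>V. \<forall>y\<in>V. x + y \<in> V"
      unfolding V_def by (rule coset_union_closed[OF U(3)])
    moreover have "card V = 2 ^ Suc k"
      using card_subgroup_coset_union[OF \<open>finite U\<close> U(2,3) nU] U by (simp add: V_def)
    ultimately have "flat (Suc n) (Suc k) ((+) a ` V)"
      unfolding flat_def using a F2_mono[of a n "Suc n"] by (intro bexI[of _ a] exI[of _ V]) auto
    then have "sc (2 ^ ((n + j - k) div 2)) (ind ((+) a ` V)) \<in> flat_gens (Suc n) j"
      unfolding flat_gens_def by force
    moreover have "dup g = sc (2 ^ ((n + j - k) div 2)) (ind ((+) a ` V))"
    proof
      fix v
      have 1: "(+) a ` V = A \<union> (\<lambda>x. x + unit_vec n) ` A"
        by (simp add: V_def A image_Un image_image ac_simps)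
      have 2: "v \<in> (\<lambda>x. x + unit_vec n) ` A \<longleftrightarrow> v + unit_vec n \<in> A"
        by (rule mem_translate)
      have "v \<notin> A \<or> v + unit_vec n \<notin> A"
        using add_unit_vec_notin_F2[of v n] flat_subset[OF fl] by blast
      then show "dup g v = sc (2 ^ ((n + j - k) div 2)) (ind ((+) a ` V)) v"
        unfolding 1 using 2 by (auto simp: dup_def g sc_def ind_def)
    qed
    ultimately show ?thesis by (metis zmod.span_base)
  qed
  have up_gen: "up g \<in> ?S" if "g \<in> flat_gens n (Suc j)" for g
  proof -
    from that obtain k A where g: "g = sc (2 ^ ((n + Suc j - k) div 2)) (ind A)" and "flat n k A"
      by (auto simp: flat_gens_def)
    then obtain a U where a: "a \<in> F2 n" and U: "U \<subseteq> F2 n" "0 \<in> U"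
      "\<forall>x\<in>U. \<forall>y\<in>U. x + y \<in> U" "card U = 2 ^ k" and A: "A = (+) a ` U"
      by (auto simp: flat_def)
    have "a + unit_vec n \<in> F2 (Suc n)" using a F2_mono[of a n "Suc n"] by (auto intro!: F2_add)
    moreover have "U \<subseteq> F2 (Suc n)" using U F2_mono[of _ n "Suc n"] by auto
    ultimately have "flat (Suc n) k ((+) (a + unit_vec n) ` U)"
      unfolding flat_def using U by blast
    then have "sc (2 ^ ((n + Suc j - k) div 2)) (ind ((+) (a + unit_vec n) ` U)) \<in> flat_gens (Suc n) j"
      unfolding flat_gens_def by force
    moreover have "up g = sc (2 ^ ((n + Suc j - k) div 2)) (ind ((+) (a + unit_vec n) ` U))"
    proof
      fix v
      have "v \<in> (+) (a + unit_vec n) ` U \<longleftrightarrow> v + unit_vec n \<in> A"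
        by (simp add: A mem_translate ac_simps)
      then show "up g v = sc (2 ^ ((n + Suc j - k) div 2)) (ind ((+) (a + unit_vec n) ` U)) v"
        by (auto simp: up_def g sc_def ind_def)
    qed
    ultimately show ?thesis by (metis zmod.span_base)
  qed
  have "dup (lo n f) \<in> ?S"
  proof (rule zmod.span_induct[OF Suc.IH[OF x], of "\<lambda>x. dup x \<in> ?S"])
    have "dup 0 = 0" "dup (x + y) = dup x + dup y" "dup (int_scale c x) = int_scale c (dup x)" for x y c
      by (auto simp: dup_def fun_eq_iff fun_pt int_scale_def algebra_simps)
    then show "zmod.subspace (Collect (\<lambda>x. dup x \<in> ?S))"
      unfolding zmod.subspace_def by (auto intro: zmod.span_zero zmod.span_add zmod.span_scale)
  qed (rule dup_gen)
  moreover have "up (hi n f - lo n f) \<in> ?S"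
  proof (rule zmod.span_induct[OF Suc.IH[OF z], of "\<lambda>x. up x \<in> ?S"])
    have "up 0 = 0" "up (x + y) = up x + up y" "up (int_scale c x) = int_scale c (up x)" for x y c
      by (auto simp: up_def fun_eq_iff fun_pt int_scale_def algebra_simps)
    then show "zmod.subspace (Collect (\<lambda>x. up x \<in> ?S))"
      unfolding zmod.subspace_def by (auto intro: zmod.span_zero zmod.span_add zmod.span_scale)
  qed (rule up_gen)
  moreover have "f = dup (lo n f) + up (hi n f - lo n f)"
  proof
    fix v
    consider "v \<in> F2 n" | w where "w \<in> F2 n" "v = w + unit_vec n" | "v \<notin> F2 (Suc n)"
      using F2_Suc_cases by blast
    then show "f v = (dup (lo n f) + up (hi n f - lo n f)) v"
    proof cases
      case 3
      then have "v \<notin> F2 n" "v + unit_vec n \<notin> F2 n"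
        using F2_Suc[of n] F2_add_iff[of "unit_vec n" "Suc n" v] F2_mono[of _ n "Suc n"] by auto
      then show ?thesis using 3 f by (simp add: dup_def up_def lo_def hi_def fun_pt fsup_def)
    qed (auto simp: dup_def up_def lo_def hi_def fun_pt add_unit_vec_notin_F2 add.assoc)
  qed
  ultimately show ?case by (metis zmod.span_add)
qed

lemma points_BW: "points (BW d) = lat d 1"
proof -
  have "{int_scale (2 ^ ((d - k + 1) div 2)) (\<Sum>v\<in>A. basis_vec v) | k A. k \<le> d \<and> affine_subspace d k A}
      = flat_gens d 1"
  proof -
    have "int_scale (2 ^ ((d - k + 1) div 2)) (\<Sum>v\<in>A. basis_vec v) = sc (2 ^ ((d + 1 - k) div 2)) (ind A)"
      if "flat d k A" for k A
      using flat_dim_le[OF that] by (simp add: int_scale_eq_sc sum_basis_vec flat_finite[OF that] Suc_diff_le)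
    then show ?thesis
      unfolding flat_gens_def affine_subspace_iff_flat using flat_dim_le by (metis (no_types, lifting))
  qed
  moreover have "zmod.span (flat_gens d 1) \<subseteq> lat d 1"
    by (rule zmod.span_minimal[OF _ subspace_lat]) (unfold flat_gens_def, use flat_lat in blast)
  ultimately show ?thesis
    using lat_subset_span by (auto simp: BW_def)
qed

lemma form_BW: "form (BW d) f g = ip d f g / 2 ^ ((d + 1) div 2)"
  by (simp add: BW_def ip_def)

section \<open>The fixed lattice of \<open>(g(1 + z) + a(1 - z))/2\<close>\<close>

lemma lat_iso_sym: "lat_iso d \<phi> \<psi> \<Longrightarrow> lat_iso d \<psi> \<phi>"
  unfolding lat_iso_def[of d \<psi>] by (auto simp: lat_isoD)

lemma half_lat: "f \<in> lat n (Suc (Suc j)) \<Longrightarrow> sc (1/2) f \<in> lat n j"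
  using sc_2_in_lat_iff[of "sc (1/2) f" n j] by simp

lemma ip_sub_fsup:
  assumes "f \<in> fsup n" "n \<le> m"
  shows "ip m f g = ip n f g"
  unfolding ip_def
  by (rule sum.mono_neutral_right) (use assms in \<open>auto simp: fsup_def intro: F2_mono\<close>)

context pauli
begin

definition pop :: "(qfun \<Rightarrow> qfun) \<Rightarrow> bool"
  where "pop P \<longleftrightarrow> (\<exists>c. \<exists>a\<in>F2 D. \<exists>l. P = W c a l)"

lemma popD:
  assumes "pop P"
  shows "lin P" "f \<in> lat D j \<Longrightarrow> P f \<in> lat D j"
    "f \<in> lat D j \<Longrightarrow> f + P f \<in> lat D (Suc j)" "f \<in> lat D j \<Longrightarrow> f - P f \<in> lat D (Suc j)"
    "f \<in> fsup D \<Longrightarrow> P f \<in> fsup D" "ip D (P f) (P h) = ip D f h"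
  using assms by (auto simp: pop_def lin_W W_lat W_add_lat W_diff_lat' W_fsup ip_W_W)

lemma E_fixed_fsup:
  assumes "i < D" "f \<in> fsup (Suc i)"
  shows "E i f = f \<longleftrightarrow> f \<in> fsup i"
proof
  assume eq: "E i f = f"
  have "f v = 0" if "v \<notin> F2 i" for v
  proof (cases "v \<in> F2 (Suc i)")
    case True
    have "v i = 1"
    proof (rule ccontr)
      assume "v i \<noteq> 1"
      then have "v j = 0" if "i \<le> j" for j
        using True that by (cases "j = i") (auto simp: F2_def)
      then show False using \<open>v \<notin> F2 i\<close> by (simp add: F2_def)
    qed
    then show ?thesis
      using fun_cong[OF eq, of v] assms(1) by (simp add: W_def)
  qed (use assms in \<open>simp add: fsup_def\<close>)
  then show "f \<in> fsup i" by (simp add: fsup_def)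
next
  assume f: "f \<in> fsup i"
  show "E i f = f"
  proof
    fix v show "E i f v = f v"
      using f assms(1) by (cases "v \<in> F2 i") (auto simp: W_def F2_def fsup_def)
  qed
qed

text \<open>The fixed vectors are those supported on \<open>F2 (D - 2)\<close>. Two vanishing
  coordinates raise the level from 1 to 3, and halving brings it back to 1.\<close>

lemma E_pair_fixed_lat:
  assumes "2 \<le> D"
  shows "f \<in> lat D 1 \<and> E (D - 1) f = f \<and> E (D - 2) f = f \<longleftrightarrow> sc (1/2) f \<in> lat (D - 2) 1"
proof -
  define n where "n = D - 2"
  have D: "D = Suc (Suc n)" "D - 1 = Suc n" "D - 2 = n" "Suc n < D" "n < D"
    using assms by (auto simp: n_def)
  have sup: "f \<in> fsup n" if "sc (1/2) f \<in> fsup n"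
    using fsup_sc[OF that, of 2] by simp
  have "sc (1/2) f \<in> lat n 1 \<longleftrightarrow> f \<in> lat n 3"
    using sc_2_in_lat_iff[of "sc (1/2) f" n 1] by (simp add: numeral_3_eq_3)
  moreover have "f \<in> lat D 1 \<longleftrightarrow> f \<in> lat n 3" if "f \<in> fsup n"
    using lat_Suc_lower_half[OF that, of 2] lat_Suc_lower_half[of f "Suc n" 1]
      fsup_mono[OF that, of "Suc n"]
    by (simp add: D(1) numeral_3_eq_3 numeral_2_eq_2 del: mem_lat_Suc)
  moreover have "E (D - 1) f = f \<and> E (D - 2) f = f \<longleftrightarrow> f \<in> fsup n" if "f \<in> fsup D"
    using E_fixed_fsup[of "Suc n" f] E_fixed_fsup[of n f] that fsup_mono[of f n "Suc n"] D by auto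
  ultimately show ?thesis
    using lat_subset_fsup[of f n 3] lat_subset_fsup[of f D 1] D(3) by metis
qed

end

text \<open>The operator \<tau> exchanges the eigenspaces of \<open>z\<close> while respecting those
  of \<open>g\<close> and \<open>a\<close>. The two isometries \<open>\<phi>1\<close> and
  \<open>\<phi>2\<close> are separate because \<open>t\<close> acts as \<open>g\<close> where
  \<open>z\<close> is 1 and as \<open>a\<close> where \<open>z\<close> is -1, so the second one
  starts from \<open>- z\<close>.\<close>

locale frame = pauli +
  fixes t z g a \<tau> \<phi>1 \<psi>1 \<phi>2 \<psi>2 :: "qfun \<Rightarrow> qfun"
  assumes D: "5 \<le> D"
    and pops: "pop z" "pop g" "pop a" "pop \<tau>"
    and invol: "z (z f) = f" "g (g f) = f" "a (a f) = f"
    and comm: "z (g f) = g (z f)" "z (a f) = a (z f)" "g (a f) = - a (g f)"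
      "z (\<tau> f) = - \<tau> (z f)" "g (\<tau> f) = \<tau> (g f)" "a (\<tau> f) = \<tau> (a f)"
    and iso1: "lat_iso D \<phi>1 \<psi>1" "\<phi>1 (z f) = E (D - 1) (\<phi>1 f)" "\<phi>1 (g f) = E (D - 2) (\<phi>1 f)"
    and iso2: "lat_iso D \<phi>2 \<psi>2" "\<phi>2 (- z f) = E (D - 1) (\<phi>2 f)" "\<phi>2 (a f) = E (D - 2) (\<phi>2 f)"
    and t_eq: "f \<in> lat D 1 \<Longrightarrow> t f = sc (1/2) (g (f + z f) + a (f - z f))"
begin

lemmas nf = invol comm lin_simps[OF popD(1)[OF pops(1)]] lin_simps[OF popD(1)[OF pops(2)]]
  lin_simps[OF popD(1)[OF pops(3)]] lin_simps[OF popD(1)[OF pops(4)]]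

lemmas pt = fun_pt sc_apply

lemma adj: "ip D (z f) h = ip D f (z h)" "ip D (g f) h = ip D f (g h)" "ip D (a f) h = ip D f (a h)"
  using popD(6)[OF pops(1), of "z f" h] popD(6)[OF pops(2), of "g f" h]
    popD(6)[OF pops(3), of "a f" h] by (simp_all add: nf)

lemma t_eq_g: "f \<in> lat D 1 \<Longrightarrow> z f = f \<Longrightarrow> t f = g f"
  and t_eq_a: "f \<in> lat D 1 \<Longrightarrow> z f = - f \<Longrightarrow> t f = a f"
  by (simp_all add: t_eq nf) (simp_all add: fun_eq_iff pt)

text \<open>The point is that the two \<open>z\<close>-components of a fixed vector are again in the lattice. Applying
  \<open>(g + 1)(a - 1)(1 - \<tau>)\<close> to \<open>f\<close> raises the level by \<open>3\<close> and gives \<open>- 2 (1 - \<tau>) p\<close>.\<close>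

lemma split_fixed:
  assumes f: "f \<in> lat D 1" "t f = f"
  defines "p \<equiv> sc (1/2) (f + z f)" and "q \<equiv> sc (1/2) (f - z f)"
  shows "f = p + q" "z p = p" "z q = - q" "g p = p" "a q = q" "p \<in> lat D 1" "q \<in> lat D 1"
proof -
  show fpq: "f = p + q"
    by (simp add: p_def q_def fun_eq_iff pt field_simps)
  show zp: "z p = p" and zq: "z q = - q"
    by (simp_all add: p_def q_def nf fun_eq_iff pt field_simps)
  have "g p + a q = p + q"
  proof -
    have "t f = g p + a q"
      by (simp add: t_eq[OF f(1)] p_def q_def nf) (simp add: fun_eq_iff pt algebra_simps)
    with f(2) fpq show ?thesis by metis
  qed
  then have e1: "g p v + a q v = p v + q v" for v
    by (metis plus_fun_apply)
  \<comment> \<open>Since \<open>z\<close> commutes with \<open>g\<close> and \<open>a\<close>,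
    applying it changes the sign of the \<open>q\<close> terms only; sum and difference with the
    previous equation separate the two components.\<close>
  have "z (g p + a q) = z (p + q)"
    using \<open>g p + a q = p + q\<close> by simp
  then have "g p - a q = p - q"
    by (simp add: nf zp zq)
  then have e2: "g p v - a q v = p v - q v" for v
    by (metis minus_apply)
  show gp: "g p = p"
  proof
    fix v show "g p v = p v" using e1[of v] e2[of v] by linarith
  qed
  show aq: "a q = q"
  proof
    fix v show "a q v = q v" using e1[of v] e2[of v] by linarith
  qed
  define w where "w = f - \<tau> f"
  define s where "s = a w - w"
  have "w \<in> lat D 2"
    using popD(4)[OF pops(4) f(1)] by (simp add: w_def numeral_2_eq_2)
  then have "- s \<in> lat D 3"
    using popD(4)[OF pops(3), of w 2] by (simp add: s_def numeral_3_eq_3 numeral_2_eq_2)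
  then have "- s + g (- s) \<in> lat D (Suc (Suc 2))"
    using popD(3)[OF pops(2), of "- s" 3] by (simp add: numeral_3_eq_3 numeral_2_eq_2)
  then have "sc (1/2) (- s + g (- s)) \<in> lat D 2"
    by (rule half_lat)
  \<comment> \<open>The factor \<open>1 - a\<close> kills \<open>q\<close> and
    \<open>\<tau> q\<close>. On vectors fixed by \<open>g\<close>, the product
    \<open>(1 + g)(1 - a)\<close> is doubling, because \<open>g a = - a g\<close>.\<close>
  moreover have "sc (1/2) (- s + g (- s)) = p - \<tau> p"
    by (simp add: s_def w_def fpq nf gp aq fun_eq_iff pt field_simps)
  ultimately have "p - \<tau> p \<in> lat D 2" by simp
  then have "(p - \<tau> p) + z (p - \<tau> p) \<in> lat D (Suc (Suc 1))"
    using popD(3)[OF pops(1), of "p - \<tau> p" 2] by (simp add: numeral_2_eq_2)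
  then have "sc (1/2) ((p - \<tau> p) + z (p - \<tau> p)) \<in> lat D 1"
    by (rule half_lat)
  \<comment> \<open>The vector \<open>\<tau> p\<close> lies in the other eigenspace of
    \<open>z\<close>, so \<open>1 + z\<close> removes it and doubles \<open>p\<close>.\<close>
  moreover have "sc (1/2) ((p - \<tau> p) + z (p - \<tau> p)) = p"
    by (simp add: nf zp fun_eq_iff pt field_simps)
  ultimately show "p \<in> lat D 1" by simp
  then have "f - p \<in> lat D 1" using f by auto
  then show "q \<in> lat D 1" using fpq by simp
qed

lemma fixed1_iff: "p \<in> lat D 1 \<and> z p = p \<and> g p = p \<longleftrightarrow> sc (1/2) (\<phi>1 p) \<in> lat (D - 2) 1"
proof -
  note i = lat_isoD[OF iso1(1)]
  have "z p = p \<longleftrightarrow> E (D - 1) (\<phi>1 p) = \<phi>1 p" "g p = p \<longleftrightarrow> E (D - 2) (\<phi>1 p) = \<phi>1 p"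
    unfolding iso1(2,3)[symmetric] by (metis i(4))+
  moreover have "p \<in> lat D 1 \<longleftrightarrow> \<phi>1 p \<in> lat D 1"
    by (metis i(4,5,6))
  ultimately show ?thesis
    using E_pair_fixed_lat[of "\<phi>1 p"] D by auto
qed

lemma fixed2_iff: "q \<in> lat D 1 \<and> z q = - q \<and> a q = q \<longleftrightarrow> sc (1/2) (\<phi>2 q) \<in> lat (D - 2) 1"
proof -
  note i = lat_isoD[OF iso2(1)]
  have "z q = - q \<longleftrightarrow> E (D - 1) (\<phi>2 q) = \<phi>2 q"
    unfolding iso2(2)[symmetric] by (metis i(4) minus_minus)
  moreover have "a q = q \<longleftrightarrow> E (D - 2) (\<phi>2 q) = \<phi>2 q"
    unfolding iso2(3)[symmetric] by (metis i(4))
  moreover have "q \<in> lat D 1 \<longleftrightarrow> \<phi>2 q \<in> lat D 1"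
    by (metis i(4,5,6))
  ultimately show ?thesis
    using E_pair_fixed_lat[of "\<phi>2 q"] D by auto
qed

lemma z_eigen_orth: "z p = p \<Longrightarrow> z q = - q \<Longrightarrow> ip D p q = 0"
  using adj(1)[of p q] by simp

lemma isometric_fixed:
  "isometric (fixed_sublattice (BW D) t) (orth_sum (scaled 2 (BW (D - 2))) (scaled 2 (BW (D - 2))))"
proof -
  let ?M = "fixed_sublattice (BW D) t"
  let ?N = "orth_sum (scaled 2 (BW (D - 2))) (scaled 2 (BW (D - 2)))"
  have M: "points ?M = {x \<in> lat D 1. t x = x}"
    by (simp add: fixed_sublattice_def points_BW)
  have N: "points ?N = lat (D - 2) 1 \<times> lat (D - 2) 1"
    by (simp add: orth_sum_def scaled_def points_BW)
  define p where "p f = sc (1/2) (f + z f)" for f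
  define q where "q f = sc (1/2) (f - z f)" for f
  note sp = split_fixed[folded p_def q_def]
  note i1 = lat_isoD[OF iso1(1)] and i2 = lat_isoD[OF iso2(1)]
  define F where "F f = (sc (1/2) (\<phi>1 (p f)), sc (1/2) (\<phi>2 (q f)))" for f
  define H where "H = (\<lambda>(u, w). \<psi>1 (sc 2 u) + \<psi>2 (sc 2 w))"
  have FM: "F f \<in> points ?N" if "f \<in> points ?M" for f
    using that sp[of f] fixed1_iff[of "p f"] fixed2_iff[of "q f"] by (auto simp: M N F_def)
  have HN: "H (u, w) \<in> points ?M" "F (H (u, w)) = (u, w)" if "(u, w) \<in> points ?N" for u w
  proof -
    define p' where "p' = \<psi>1 (sc 2 u)"
    define q' where "q' = \<psi>2 (sc 2 w)"
    have \<phi>p: "\<phi>1 p' = sc 2 u" and \<phi>q: "\<phi>2 q' = sc 2 w"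
      by (simp_all add: p'_def q'_def i1 i2)
    have P: "p' \<in> lat D 1" "z p' = p'" "g p' = p'" and Q: "q' \<in> lat D 1" "z q' = - q'" "a q' = q'"
      using fixed1_iff[of p'] fixed2_iff[of q'] that by (simp_all add: N \<phi>p \<phi>q)
    have h: "H (u, w) = p' + q'" by (simp add: H_def p'_def q'_def)
    have pq: "p (p' + q') = p'" "q (p' + q') = q'"
      by (simp_all add: p_def q_def nf P Q fun_eq_iff pt)
    have "t (p' + q') = p' + q'"
      by (simp add: t_eq[OF lat_add[OF P(1) Q(1)]] nf P Q) (simp add: fun_eq_iff pt)
    then show "H (u, w) \<in> points ?M"
      using P Q h by (simp add: M lat_add)
    show "F (H (u, w)) = (u, w)"
      by (simp add: h F_def pq \<phi>p \<phi>q)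
  qed
  have HF: "H (F f) = f" if "f \<in> points ?M" for f
    using that sp(1)[of f] by (simp add: M F_def H_def i1 i2)
  have "bij_betw F (points ?M) (points ?N)"
    by (rule bij_betw_byWitness[of _ H]) (use FM HN HF in auto)
  moreover have "F (x + y) = F x + F y" for x y
    by (simp add: F_def p_def q_def nf lin_simps[OF i1(1)] lin_simps[OF i2(1)] sc_add sc_diff algebra_simps)
  moreover have "form ?N (F x) (F y) = form ?M x y" if "x \<in> points ?M" "y \<in> points ?M" for x y
  proof -
    have x: "x \<in> lat D 1" "t x = x" and y: "y \<in> lat D 1" "t y = y" using that by (auto simp: M)
    have sup: "sc (1/2) (\<phi>1 (p x)) \<in> fsup (D - 2)" "sc (1/2) (\<phi>2 (q x)) \<in> fsup (D - 2)"
      using FM[OF that(1)] lat_subset_fsup by (auto simp: N F_def)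
    have "ip (D - 2) (sc (1/2) (\<phi>1 (p x))) (sc (1/2) (\<phi>1 (p y))) = ip D (p x) (p y) / 4"
      "ip (D - 2) (sc (1/2) (\<phi>2 (q x))) (sc (1/2) (\<phi>2 (q y))) = ip D (q x) (q y) / 4"
      unfolding ip_sub_fsup[OF sup(1) diff_le_self, symmetric] ip_sub_fsup[OF sup(2) diff_le_self, symmetric]
      by (simp_all add: i1 i2)
    moreover have "ip D x y = ip D (p x) (p y) + ip D (q x) (q y)"
    proof -
      have "ip D (p x) (q y) = 0" "ip D (q x) (p y) = 0"
        using sp(2,3)[OF x] sp(2,3)[OF y] z_eigen_orth ip_commute by metis+
      then show ?thesis
        by (subst sp(1)[OF x], subst sp(1)[OF y]) simp
    qed
    \<comment> \<open>Halving the vectors divides the norms by 4, while lowering the dimension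
      exponent by two changes the normalization of the form by a factor 2 in the other direction.
      The remaining factor 2 is the scaling of the summands.\<close>
    moreover have "(2::rat) ^ ((D + 1) div 2) = 2 * 2 ^ ((D - 2 + 1) div 2)"
    proof -
      have "(D + 1) div 2 = Suc ((D - 2 + 1) div 2)" using D by simp
      then show ?thesis by simp
    qed
    ultimately show ?thesis
      by (simp add: orth_sum_def scaled_def form_BW fixed_sublattice_def F_def field_simps)
  qed
  ultimately show ?thesis
    unfolding isometric_def isometry_def by blast
qed


section \<open>An isometry of one of the two summands\<close>

definition U0 :: "qfun \<Rightarrow> qfun"
  where "U0 f = sc (1/2) (cay 0 (unit_vec 1) (unit_vec 1) (cay 0 (unit_vec 2) (unit_vec 2) f))"

definition V0 :: "qfun \<Rightarrow> qfun"
  where "V0 f = sc (1/2) (cay (0 + 1) (unit_vec 2) (unit_vec 2) (cay (0 + 1) (unit_vec 1) (unit_vec 1) f))"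

text \<open>\<open>U0\<close> involves only the coordinates 1 and 2, which differ from
  \<open>D - 2\<close> and \<open>D - 1\<close> since \<open>5 \<le> D\<close>. It therefore
  commutes with \<open>E (D - 1)\<close> and \<open>E (D - 2)\<close>, and its conjugate
  \<open>U\<close> commutes with \<open>z\<close> and \<open>g\<close>.\<close>

definition U :: "qfun \<Rightarrow> qfun"
  where "U f = \<psi>1 (U0 (\<phi>1 f))"

definition V :: "qfun \<Rightarrow> qfun"
  where "V f = \<psi>1 (V0 (\<phi>1 f))"

lemma iso_U0: "lat_iso D U0 V0"
  unfolding U0_def[abs_def] V0_def[abs_def]
  by (rule lat_iso_cay_cay) (use D in \<open>simp_all add: unit_vec_apply\<close>)

lemma iso_U: "lat_iso D U V"
  unfolding U_def[abs_def] V_def[abs_def]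
  using lat_iso_comp[OF lat_iso_sym[OF iso1(1)] lat_iso_comp[OF iso_U0 iso1(1)]] .

lemma U_commute: "U (z f) = z (U f)" "U (g f) = g (U f)" "V (z f) = z (V f)" "V (g f) = g (V f)"
proof -
  have E: "U0 (E (D - 1) f) = E (D - 1) (U0 f)" "U0 (E (D - 2) f) = E (D - 2) (U0 f)" for f
    using D by (simp_all add: U0_def cay_commute unit_vec_apply)
  have \<psi>: "\<psi>1 (E (D - 1) f) = z (\<psi>1 f)" "\<psi>1 (E (D - 2) f) = g (\<psi>1 f)" for f
    using iso1(2)[of "\<psi>1 f"] iso1(3)[of "\<psi>1 f"] lat_isoD(3,4)[OF iso1(1)] by metis+
  show 1: "U (z f) = z (U f)" "U (g f) = g (U f)" for f
    unfolding U_def iso1(2,3) E \<psi> by simp_all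
  show "V (z f) = z (V f)" "V (g f) = g (V f)"
    using 1[of "V f"] lat_isoD(3,4)[OF iso_U] by metis+
qed

lemmas U_iso = lat_isoD[OF iso_U]
lemmas U_lin = lin_simps[OF U_iso(1)]

text \<open>This is \<open>U\<close> on the 1-eigenspace of \<open>z\<close> and the identity on the
  other. It maps the fixed lattice to itself because the components of a fixed vector are again
  lattice vectors.\<close>

definition \<gamma> :: "qfun \<Rightarrow> qfun"
  where "\<gamma> f = U (sc (1/2) (f + z f)) + sc (1/2) (f - z f)"

definition \<gamma>' :: "qfun \<Rightarrow> qfun"
  where "\<gamma>' f = V (sc (1/2) (f + z f)) + sc (1/2) (f - z f)"

lemma t_sum:
  assumes "p \<in> lat D 1" "z p = p" "g p = p" "q \<in> lat D 1" "z q = - q" "a q = q"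
  shows "t (p + q) = p + q"
  by (simp add: t_eq[OF lat_add[OF assms(1,4)]] nf assms) (simp add: fun_eq_iff pt)

lemma \<gamma>_fixed:
  assumes f: "f \<in> lat D 1" "t f = f"
  shows "\<gamma> f \<in> lat D 1" "t (\<gamma> f) = \<gamma> f" "\<gamma>' f \<in> lat D 1" "t (\<gamma>' f) = \<gamma>' f"
    "\<gamma>' (\<gamma> f) = f" "\<gamma> (\<gamma>' f) = f"
proof -
  define p where "p = sc (1/2) (f + z f)"
  define q where "q = sc (1/2) (f - z f)"
  note s = split_fixed[OF f, folded p_def q_def]
  have \<gamma>: "\<gamma> f = U p + q" "\<gamma>' f = V p + q"
    by (simp_all add: \<gamma>_def \<gamma>'_def p_def q_def)
  have zg: "z (U p) = U p" "g (U p) = U p" "z (V p) = V p" "g (V p) = V p"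
    using U_commute[of p] s by simp_all
  show "\<gamma> f \<in> lat D 1" "\<gamma>' f \<in> lat D 1"
    unfolding \<gamma> using s U_iso(5,6) by blast+
  show "t (\<gamma> f) = \<gamma> f" "t (\<gamma>' f) = \<gamma>' f"
    unfolding \<gamma> by (rule t_sum; use s zg U_iso(5,6) in blast)+
  have half: "sc (1/2) ((x + q) + z (x + q)) = x" "sc (1/2) ((x + q) - z (x + q)) = q"
    if "z x = x" for x
    by (simp_all add: that s nf) (simp_all add: fun_eq_iff pt)
  show "\<gamma>' (\<gamma> f) = f"
    unfolding \<gamma>(1) unfolding \<gamma>'_def half[OF zg(1)] using s(1) U_iso(4) by metis
  show "\<gamma> (\<gamma>' f) = f"
    unfolding \<gamma>(2) unfolding \<gamma>_def half[OF zg(3)] using s(1) U_iso(3) by metis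
qed

lemma \<gamma>_add: "\<gamma> (f + h) = \<gamma> f + \<gamma> h"
  by (simp add: \<gamma>_def U_lin nf sc_add sc_diff algebra_simps)

lemma ip_\<gamma>: "ip D (\<gamma> f) (\<gamma> h) = ip D f h"
proof -
  define p where "p f = sc (1/2) (f + z f)" for f
  define q where "q f = sc (1/2) (f - z f)" for f
  have e: "z (p f) = p f" "z (q f) = - q f" "z (U (p f)) = U (p f)" "f = p f + q f" for f
    using U_commute(1)[of "p f", symmetric] by (simp_all add: p_def q_def nf U_lin fun_eq_iff pt field_simps)
  have "ip D (p f) (q h) = 0" "ip D (q f) (p h) = 0" "ip D (U (p f)) (q h) = 0" "ip D (q f) (U (p h)) = 0"
    using z_eigen_orth e ip_commute by metis+
  then show ?thesis
    using U_iso(9) by (subst (3) e(4), subst (5) e(4)) (simp add: \<gamma>_def p_def[symmetric] q_def[symmetric])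
qed

section \<open>The minimal vector used against an extension\<close>

definition one :: "vec \<Rightarrow> rat"
  where "one = ind (F2 D)"

definition w0 :: "vec \<Rightarrow> rat"
  where "w0 = one + E (D - 2) one"

text \<open>Twice the indicator of the subspace where the coordinates 1 and \<open>D - 2\<close>
  vanish, a generator of the lattice. Written with \<open>E 1\<close> and \<open>E (D - 2)\<close>,
  its norm and eigenvalues follow from orthogonality of eigenvectors.\<close>

definition v0 :: "vec \<Rightarrow> rat"
  where "v0 = sc (1/2) (w0 + E 1 w0)"

definition u0 :: "vec \<Rightarrow> rat"
  where "u0 = sc (1/2) (v0 + E (D - 1) v0)"

lemma anti_orth:
  assumes "pop P" "P x = x" "P y = - y"
  shows "ip D x y = 0" "ip D y x = 0"
  using popD(6)[OF assms(1), of x y] popD(6)[OF assms(1), of y x] assms(2,3) by simp_all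

lemma v0_facts: "v0 \<in> lat D 1" "E (D - 2) v0 = v0" "ip D v0 v0 = 2 ^ D" "ip D u0 u0 = 2 ^ D / 2"
  "ip D (U0 u0) u0 = 2 ^ D / 4"
proof -
  define T where "T i = W 0 (unit_vec i) 0" for i
  have T: "pop (T i)" if "i < D" for i
    unfolding pop_def T_def using that unit_vec_in_F2 by blast
  have Tone: "T i one = one" if "i < D" for i
  proof -
    have "unit_vec i \<in> F2 D" using that by simp
    then show ?thesis by (auto simp: T_def one_def W_def ind_def fun_eq_iff F2_add_iff simp del: unit_vec_in_F2)
  qed
  have TE: "T i (E i f) = - E i (T i f)" if "i < D" for i f
    unfolding T_def using that by (intro W_commute_1) (simp add: unit_vec_apply)
  have TE': "T i (E j f) = E j (T i f)" if "i < D" "j < D" "i \<noteq> j" for i j f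
    unfolding T_def using that by (intro W_commute_0) (simp add: unit_vec_apply)
  have Tlin: "T i (f + h) = T i f + T i h" "T i (sc k f) = sc k (T i f)" for i f h k
    by (simp_all add: T_def)
  have EE: "E i (E i f) = f" for i f by (rule W_involution) simp
  have Ecomm: "E i (E j f) = E j (E i f)" for i j f by (rule W_commute_0) simp
  have Eip: "ip D (E i f) (E i h) = ip D f h" for i f h by (rule ip_W_W) simp
  have d: "1 < D" "D - 1 < D" "D - 2 < D" "D - 1 \<noteq> D - 2" "1 \<noteq> D - 2" "D - 1 \<noteq> 1" using D by auto
  have popE: "pop (E i)" if "i < D" for i unfolding pop_def by (intro exI bexI[of _ 0]) auto
  have flat: "flat D D (F2 D)"
    unfolding flat_def by (intro bexI[of _ 0] exI[of _ "F2 D"]) (auto simp: card_F2)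
  have one: "one \<in> lat D 1"
    using flat_lat[OF flat, of 1] by (simp add: one_def)
  have ip1: "ip D one one = 2 ^ D"
    by (simp add: ip_def one_def ind_def card_F2)
  have w: "T 1 w0 = w0" "T (D - 1) w0 = w0"
    using d by (simp_all only: w0_def Tlin TE' Tone not_False_eq_True)
  have "ip D one (E (D - 2) one) = 0" "ip D (E (D - 2) one) one = 0"
    by (rule anti_orth[OF T[OF d(3)] Tone[OF d(3)]]; simp only: TE d Tone)+
  then have ipw: "ip D w0 w0 = 2 * 2 ^ D"
    by (simp add: w0_def ip1 Eip)
  have "ip D w0 (E 1 w0) = 0" "ip D (E 1 w0) w0 = 0"
    by (rule anti_orth[OF T[OF d(1)] w(1)]; simp only: TE d w)+
  then show ipv: "ip D v0 v0 = 2 ^ D"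
    by (simp add: v0_def ipw Eip)
  have Tv: "T (D - 1) v0 = v0"
    using d by (simp only: v0_def Tlin TE' w not_False_eq_True)
  have "ip D v0 (E (D - 1) v0) = 0" "ip D (E (D - 1) v0) v0 = 0"
    by (rule anti_orth[OF T[OF d(2)] Tv]; simp only: TE d Tv)+
  then show ipu: "ip D u0 u0 = 2 ^ D / 2"
    by (simp add: u0_def ipv Eip)
  have "w0 \<in> lat D 2"
    using popD(3)[OF popE[OF d(3)] one] by (simp add: w0_def numeral_2_eq_2)
  then have "w0 + E 1 w0 \<in> lat D (Suc (Suc 1))"
    using popD(3)[OF popE[OF d(1)], of w0 2] by (simp add: numeral_2_eq_2)
  then show "v0 \<in> lat D 1"
    unfolding v0_def by (rule half_lat)
  have "E (D - 2) w0 = w0"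
    by (simp add: w0_def EE add.commute)
  then show "E (D - 2) v0 = v0"
    by (simp only: v0_def W_linear Ecomm[of "D - 2" 1])
  have "E 1 v0 = v0"
    by (simp add: v0_def EE add.commute)
  then have Eu: "E 1 u0 = u0"
    by (simp only: u0_def W_linear Ecomm[of 1 "D - 1"])
  let ?N1 = "W 0 (unit_vec 1) (unit_vec 1)" and ?N2 = "W 0 (unit_vec 2) (unit_vec 2)"
  have d2: "2 < D" using D by simp
  have "ip D (?N1 u0) u0 = 0" "ip D (?N2 u0) u0 = 0"
    using ip_W_skew[of "unit_vec 1" D "unit_vec 1" 0 u0 u0] ip_W_skew[of "unit_vec 2" D "unit_vec 2" 0 u0 u0]
      ip_commute[of D u0 "?N1 u0"] ip_commute[of D u0 "?N2 u0"] d d2 by (simp_all add: unit_vec_apply)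
  \<comment> \<open>\<open>?N1\<close> and \<open>?N2\<close> are commuting skew operators, so their
    product is symmetric and skewness does not help here. The product vanishes because
    \<open>E 1\<close> fixes \<open>u0\<close> and anticommutes with \<open>?N1\<close> only; this
    is why \<open>v0\<close> is made symmetric under \<open>E 1\<close>.\<close>
  moreover have "ip D (?N1 (?N2 u0)) u0 = 0"
  proof -
    have "E 1 (?N1 (?N2 u0)) = - ?N1 (E 1 (?N2 u0))"
      using d d2 by (intro W_commute_1) (simp add: unit_vec_apply)
    also have "E 1 (?N2 u0) = ?N2 (E 1 u0)"
      using d d2 by (intro W_commute_0) (simp add: unit_vec_apply)
    finally have "E 1 (?N1 (?N2 u0)) = - ?N1 (?N2 u0)" by (simp only: Eu)
    then have "- ip D (?N1 (?N2 u0)) u0 = ip D (?N1 (?N2 u0)) u0"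
      using Eip[of 1 "?N1 (?N2 u0)" u0] by (simp only: Eu ip_bilinear)
    then show ?thesis by linarith
  qed
  ultimately show "ip D (U0 u0) u0 = 2 ^ D / 4"
    using ipu by (simp add: U0_def cay_def)
qed

text \<open>An extension \<open>G\<close> moves the minimal vector \<open>v\<close> to some \<open>y\<close> whose component \<open>b\<close> in the fourth
  common eigenspace is congruent to that of \<open>v\<close>, namely \<open>v4\<close>, modulo the lattice and not longer.
  Minimality forces \<open>b = \<plusminus> v4\<close>; then \<open>U v1 - v1\<close> is a lattice vector of less than minimal norm.\<close>

lemma no_extension:
  assumes G: "\<And>f. f \<in> lat D 1 \<Longrightarrow> G f \<in> lat D 1"
    and Gip: "\<And>f h. f \<in> lat D 1 \<Longrightarrow> h \<in> lat D 1 \<Longrightarrow> ip D (G f) (G h) = ip D f h"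
    and G\<gamma>: "\<And>f. f \<in> lat D 1 \<Longrightarrow> t f = f \<Longrightarrow> G f = \<gamma> f"
  shows False
proof -
  note i1 = lat_isoD[OF iso1(1)] and l1 = lin_simps[OF lat_isoD(1)[OF iso1(1)]]
  define v where "v = \<psi>1 v0"
  have \<phi>v: "\<phi>1 v = v0" by (simp add: v_def i1)
  have v: "v \<in> lat D 1" unfolding v_def using v0_facts(1) i1(6) by blast
  have gv: "g v = v"
    by (metis \<phi>v i1(4) iso1(3) v0_facts(2))
  have gzv: "g (z v) = z v"
    using comm(1)[of v] gv by simp
  define v1 where "v1 = sc (1/2) (v + z v)"
  have \<phi>v1: "\<phi>1 v1 = u0"
    by (simp add: v1_def l1 \<phi>v iso1(2) u0_def)
  have Nv: "ip D v v = 2 ^ D" using v0_facts(3) i1(9)[of v v] \<phi>v by simp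
  have Nv1: "ip D v1 v1 = 2 ^ D / 2" using v0_facts(4) i1(9)[of v1 v1] \<phi>v1 by simp
  have "\<phi>1 (U v1) = U0 u0" by (simp add: U_def i1 \<phi>v1)
  then have ipU: "ip D (U v1) v1 = 2 ^ D / 4" using v0_facts(5) i1(9)[of "U v1" v1] \<phi>v1 by simp
  define y where "y = G v"
  have y: "y \<in> lat D 1" using G v by (simp add: y_def)
  define e where "e = y - v"
  have e: "e \<in> lat D 1" using y v by (auto simp: e_def)
  define k where "k = y - U v"
  define k1 where "k1 = k + z k"
  \<comment> \<open>Up to the factor 4, \<open>m\<close> is the projection of \<open>y - U v\<close>
    to the common eigenspace where \<open>z\<close> and \<open>g\<close> are 1; the vector
    \<open>m'\<close> below does the same for \<open>y - v\<close> where \<open>z\<close> is -1 and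
    \<open>a\<close> is 1.\<close>
  define m where "m = k1 + g k1"
  have k: "k \<in> lat D 1" using y v U_iso(5) by (auto simp: k_def)
  have k1: "k1 \<in> lat D 1" using k popD(2)[OF pops(1)] by (auto simp: k1_def)
  have m: "m \<in> lat D 1" using k1 popD(2)[OF pops(2)] by (auto simp: m_def)
  have zk1: "z k1 = k1" by (simp add: k1_def nf add.commute)
  have zm: "z m = m" by (simp add: m_def nf zk1)
  have gm: "g m = m" by (simp add: m_def nf add.commute)
  \<comment> \<open>On \<open>V m\<close>, a vector fixed by \<open>t\<close>, the map
    \<open>G\<close> agrees with \<open>\<gamma>\<close> and gives \<open>m\<close>. Since
    \<open>G\<close> and \<open>U\<close> are isometries, \<open>y\<close> and \<open>U v\<close>
    have the same product with \<open>m\<close>; hence the projection \<open>m\<close> of their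
    difference is orthogonal to itself.\<close>
  have "m = 0"
  proof -
    have p: "V m \<in> lat D 1" "z (V m) = V m" "g (V m) = V m"
      using m U_iso(6) U_commute(3,4)[of m] zm gm by simp_all
    have "t (V m) = V m" using t_eq_g[OF p(1,2)] p by simp
    moreover have "\<gamma> (V m) = m"
      by (simp add: \<gamma>_def p U_lin U_iso) (simp add: fun_eq_iff pt)
    ultimately have "G (V m) = m" using G\<gamma> p by simp
    then have "ip D y m = ip D v (V m)"
      using Gip[OF v p(1)] by (simp add: y_def)
    also have "\<dots> = ip D (U v) m"
      using U_iso(9)[of v "V m"] U_iso(3) by simp
    finally have "ip D k m = 0" by (simp add: k_def)
    moreover have "ip D k1 m = 2 * ip D k m"
      by (simp add: k1_def adj zm)
    moreover have "ip D m m = 2 * ip D k1 m"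
      by (subst m_def) (simp add: adj gm)
    ultimately show "m = 0"
      using ip_self_eq_0D lat_subset_fsup[OF m] by simp
  qed
  define e1 where "e1 = e - z e"
  define m' where "m' = e1 + a e1"
  have e1: "e1 \<in> lat D 1" using e popD(2)[OF pops(1)] by (auto simp: e1_def)
  have m': "m' \<in> lat D 1" using e1 popD(2)[OF pops(3)] by (auto simp: m'_def)
  have ze1: "z e1 = - e1" by (simp add: e1_def nf)
  have zm': "z m' = - m'" by (simp add: m'_def nf ze1)
  have am': "a m' = m'" by (simp add: m'_def nf add.commute)
  have "m' = 0"
  proof -
    have "t m' = m'" using t_eq_a[OF m' zm'] am' by simp
    moreover have "\<gamma> m' = m'"
      by (simp add: \<gamma>_def zm' U_lin) (simp add: fun_eq_iff pt)
    ultimately have "G m' = m'" using G\<gamma> m' by simp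
    then have "ip D y m' = ip D v m'"
      using Gip[OF v m'] by (simp add: y_def)
    then have "ip D e m' = 0" by (simp add: e_def)
    moreover have "ip D e1 m' = 2 * ip D e m'"
      by (simp add: e1_def adj zm')
    moreover have "ip D m' m' = 2 * ip D e1 m'"
      by (subst m'_def) (simp add: adj am')
    ultimately show "m' = 0"
      using ip_self_eq_0D lat_subset_fsup[OF m'] by simp
  qed
  then have ae1: "a e1 = - e1"
    unfolding m'_def by (simp add: eq_neg_iff_add_eq_0 add.commute)
  \<comment> \<open>From here on vectors are compared in four eigenspaces, given by
    \<open>z = 1\<close> with \<open>g = 1\<close> or \<open>g = -1\<close>, and
    \<open>z = -1\<close> with \<open>a = 1\<close> or \<open>a = -1\<close>. In this order
    \<open>v\<close> has the components \<open>v1\<close>, 0, \<open>v2\<close>, \<open>v4\<close>,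
    and \<open>y\<close> has \<open>U v1\<close>, \<open>d3\<close>, \<open>v2\<close>,
    \<open>b\<close>.\<close>
  define c where "c = sc (1/2) e1"
  have zc: "z c = - c" and ac: "a c = - c"
    by (simp_all add: c_def nf ze1 ae1 sc_minus)
  define x where "x = sc (1/2) (e + z e)"
  have zx: "z x = x" by (simp add: x_def nf add.commute)
  have exc: "e = x + c"
    by (simp add: x_def c_def e1_def fun_eq_iff pt field_simps)
  define d1 where "d1 = U v1 - v1"
  define d3 where "d3 = x - d1"
  have gv1: "g v1 = v1" and zv1: "z v1 = v1"
    by (simp_all add: v1_def nf gv gzv add.commute)
  have gd1: "g d1 = d1" and zd1: "z d1 = d1"
    using U_commute(1,2)[of v1] by (simp_all add: d1_def nf gv1 zv1)
  have d1: "d1 = sc (1/2) (x + g x)"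
  proof -
    have 1: "k1 = sc 2 (x - d1)"
      by (simp add: k1_def k_def x_def d1_def e_def v1_def U_lin U_commute nf fun_eq_iff pt field_simps)
    have 2: "k1 + g k1 = 0" using \<open>m = 0\<close> m_def by simp
    have "x v - d1 v + g x v - d1 v = 0" for v
      using fun_cong[OF 2, of v] by (simp add: 1 nf gd1 pt)
    then show ?thesis
      by (simp add: fun_eq_iff pt field_simps)
  qed
  have gd3: "g d3 = - d3"
    by (simp add: d3_def d1 nf fun_eq_iff pt field_simps)
  have xgx: "x - g x = sc 2 d3"
    by (simp add: d3_def d1 fun_eq_iff pt field_simps)
  have zd3: "z d3 = d3" by (simp add: d3_def nf zx zd1)
  have x0: "x \<in> lat D 0"
    using half_lat[of "e + z e" D 0] popD(3)[OF pops(1) e] by (simp add: x_def)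
  have "U v - v \<in> lat D 1" using v U_iso(5) by auto
  then have "sc (1/2) ((U v - v) + z (U v - v)) \<in> lat D 0"
    using half_lat popD(3)[OF pops(1), of "U v - v" 1] by simp
  moreover have "sc (1/2) ((U v - v) + z (U v - v)) = d1"
    by (simp add: d1_def v1_def U_lin U_commute nf fun_eq_iff pt field_simps)
  ultimately have "d3 \<in> lat D 0" using x0 by (auto simp: d3_def)
  then have \<tau>d: "\<tau> (d3 - a d3) \<in> lat D 1"
    using popD(2)[OF pops(4)] popD(4)[OF pops(3), of d3 0] by simp
  \<comment> \<open>Projecting \<open>e\<close> to the eigenspace \<open>z = -1\<close> directly
    would end at level 0. The route through \<open>e - \<tau> e\<close> ends at level 1 but leaves
    the error \<open>\<tau> (d3 - a d3)\<close>, which is harmless: \<open>d3\<close> has level 0,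
    and \<open>1 - a\<close> adds one.\<close>
  have c: "c \<in> lat D 1"
  proof -
    define s where "s = e - \<tau> e"
    have "s \<in> lat D 2" using popD(4)[OF pops(4) e] by (simp add: s_def numeral_2_eq_2)
    then have "s - z s \<in> lat D (Suc (Suc 1))"
      using popD(4)[OF pops(1), of s 2] by (simp add: numeral_2_eq_2)
    then have "sc (1/2) (s - z s) \<in> lat D 1" by (rule half_lat)
    moreover have "sc (1/2) (s - z s) = c - \<tau> x"
      by (simp add: s_def exc nf zx zc fun_eq_iff pt field_simps)
    ultimately have r: "c - \<tau> x \<in> lat D 1" by simp
    define r where "r = (c - \<tau> x) - g (c - \<tau> x)"
    have "r \<in> lat D 2" using popD(4)[OF pops(2) r] by (simp add: r_def numeral_2_eq_2)
    then have "r - a r \<in> lat D (Suc (Suc 1))"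
      using popD(4)[OF pops(3), of r 2] by (simp add: numeral_2_eq_2)
    then have "sc (1/2) (r - a r) \<in> lat D 1" by (rule half_lat)
    moreover have "sc (1/2) (r - a r) = c - \<tau> (d3 - a d3)"
    proof -
      have "g x = x - sc 2 d3" using xgx by (simp add: algebra_simps)
      moreover have "a (g c) = g c" using comm(3)[of c] ac by (simp add: nf)
      ultimately have "r - a r = sc 2 c - sc 2 (\<tau> (d3 - a d3))"
        by (simp add: r_def nf ac) (simp add: fun_eq_iff pt algebra_simps)
      then show ?thesis by (simp add: sc_diff)
    qed
    ultimately have "(c - \<tau> (d3 - a d3)) + \<tau> (d3 - a d3) \<in> lat D 1"
      using \<tau>d lat_add by metis
    then show ?thesis by simp
  qed
  define vm where "vm = sc (1/2) (v - z v)"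
  define v2 where "v2 = sc (1/2) (vm + a vm)"
  define v4 where "v4 = sc (1/2) (vm - a vm)"
  define b where "b = c + v4"
  have zvm: "z vm = - vm" and gvm: "g vm = vm"
    by (simp add: vm_def nf fun_eq_iff pt field_simps) (simp add: vm_def nf gv gzv)
  have ev: "z v2 = - v2" "a v2 = v2" "z v4 = - v4" "a v4 = - v4"
    by (simp_all add: v2_def v4_def nf zvm fun_eq_iff pt field_simps)
  have eb: "z b = - b" "a b = - b"
    by (simp_all add: b_def nf zc ac ev)
  have "(v - z v) - a (v - z v) \<in> lat D (Suc (Suc 1))"
    using popD(4)[OF pops(3), of "v - z v" 2] popD(4)[OF pops(1) v] by (simp add: numeral_2_eq_2)
  then have "sc (1/2) ((v - z v) - a (v - z v)) \<in> lat D 1" by (rule half_lat)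
  moreover have "sc (1/2) ((v - z v) - a (v - z v)) = v4 + v4"
    by (simp add: v4_def vm_def nf fun_eq_iff pt field_simps)
  ultimately have "c + (v4 + v4) \<in> lat D 1" using c by auto
  then have bv4: "b + v4 \<in> lat D 1" by (simp add: b_def add.assoc)
  have v_eq: "v = v1 + vm" "vm = v2 + v4"
    by (simp_all add: v1_def vm_def v2_def v4_def fun_eq_iff pt field_simps)
  have zU: "z (U v1) = U v1" "g (U v1) = U v1"
    using U_commute(1,2)[of v1] gv1 zv1 by simp_all
  have y_eq: "y = (U v1 + d3) + (v2 + b)"
  proof -
    have "y = e + v" by (simp add: e_def)
    also have "\<dots> = (x + c) + (v1 + (v2 + v4))" using exc v_eq by metis
    also have "x = d3 + (U v1 - v1)" by (simp add: d3_def d1_def)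
    finally show ?thesis by (simp add: b_def algebra_simps)
  qed
  have a_orth: "ip D f h = 0" if "a f = f" "a h = - h" for f h
    using adj(3)[of f h] that by simp
  have g_orth: "ip D f h = 0" if "g f = f" "g h = - h" for f h
    using adj(2)[of f h] that by simp
  have Ny: "ip D y y = 2 ^ D" using Gip[OF v v] Nv by (simp add: y_def)
  have "ip D (U v1 + d3) (v2 + b) = 0"
    by (rule z_eigen_orth) (simp_all add: nf zU zd3 ev eb)
  then have Ny': "ip D y y = ip D (U v1 + d3) (U v1 + d3) + ip D (v2 + b) (v2 + b)"
    using ip_commute[of D "v2 + b" "U v1 + d3"] unfolding y_eq
    by (simp only: ip_bilinear(3)[of D "U v1 + d3" "v2 + b"] ip_bilinear(4)[of D _ "U v1 + d3" "v2 + b"])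
  have "ip D (U v1) d3 = 0" "ip D v2 b = 0" "ip D v2 v4 = 0" "ip D v1 vm = 0"
    using g_orth[OF zU(2) gd3] a_orth[OF ev(2) eb(2)] a_orth[OF ev(2,4)] z_eigen_orth[OF zv1 zvm] by simp_all
  then have orth: "ip D (U v1) d3 = 0" "ip D v2 b = 0" "ip D v2 v4 = 0" "ip D v1 vm = 0"
    "ip D d3 (U v1) = 0" "ip D b v2 = 0" "ip D v4 v2 = 0" "ip D vm v1 = 0"
    by (simp_all add: ip_commute)
  have N1: "2 ^ D = ip D v1 v1 + ip D d3 d3 + ip D v2 v2 + ip D b b"
    using Ny Ny' orth U_iso(9)[of v1 v1] by simp
  have Nvm: "ip D vm vm = 2 ^ D / 2"
    using Nv Nv1 orth unfolding v_eq(1) by simp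
  have N2: "2 ^ D = ip D v1 v1 + ip D v2 v2 + ip D v4 v4"
    using Nvm Nv1 orth unfolding v_eq(2) by simp
  \<comment> \<open>\<open>g\<close> fixes \<open>vm\<close> and sends \<open>a vm\<close> to its
    negative. Hence \<open>vm\<close> distributes its norm equally over the two eigenspaces of
    \<open>a\<close>.\<close>
  have "ip D vm (a vm) = 0"
    using popD(6)[OF pops(2), of vm "a vm"] by (simp add: nf gvm)
  then have N4: "ip D v4 v4 = 2 ^ D / 4"
    using Nvm popD(6)[OF pops(3), of vm vm] ip_commute[of D "a vm" vm] by (simp add: v4_def)
  have N3: "ip D d3 d3 + ip D b b = 2 ^ D / 4"
    using N1 N2 N4 by linarith
  \<comment> \<open>\<open>c = b - v4\<close> and \<open>b + v4\<close> are lattice vectors. By the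
    parallelogram law their norms add up to at most \<open>2 ^ D\<close>, the minimal norm, so they
    cannot both be nonzero.\<close>
  have "c = 0 \<or> b + v4 = 0"
  proof (rule ccontr)
    assume "\<not> ?thesis"
    then have "2 ^ (D + 1) \<le> 2 * ip D c c" "2 ^ (D + 1) \<le> 2 * ip D (b + v4) (b + v4)"
      using lat_min_norm[OF c] lat_min_norm[OF bv4] by auto
    moreover have "c = b - v4" by (simp add: b_def)
    then have "ip D c c + ip D (b + v4) (b + v4) = 2 * ip D b b + 2 * ip D v4 v4"
      by simp
    moreover have "ip D b b \<le> 2 ^ D / 4"
      using N3 ip_nonneg[of D d3] by linarith
    moreover have "(2::rat) ^ (D + 1) = 2 * 2 ^ D" "(0::rat) < 2 ^ D" by simp_all
    ultimately show False
      using N4 by linarith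
  qed
  then have "b = v4 \<or> b = - v4"
    by (auto simp: b_def eq_neg_iff_add_eq_0)
  then have "ip D b b = ip D v4 v4" by auto
  then have "ip D d3 d3 = 0" using N3 N4 by simp
  then have "d3 = 0"
    using ip_self_eq_0D lat_subset_fsup[OF \<open>d3 \<in> lat D 0\<close>] by blast
  then have "d1 = e - c" using exc by (simp add: d3_def)
  then have "d1 \<in> lat D 1" using e c by auto
  \<comment> \<open>\<open>U v1\<close> and \<open>v1\<close> have norm \<open>2 ^ D / 2\<close> and
    inner product \<open>2 ^ D / 4\<close>, so the norm of their difference is half the
    minimum.\<close>
  moreover have N: "ip D d1 d1 = 2 ^ D / 2"
    using Nv1 ipU U_iso(9)[of v1 v1] by (simp add: d1_def ip_commute[of D v1 "U v1"])
  moreover from N have "d1 \<noteq> 0" by auto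
  ultimately have "2 ^ D \<le> ip D d1 d1"
    using lat_min_norm[of d1 D 1] by simp
  moreover have "(0::rat) < 2 ^ D" by simp
  ultimately show False using N by linarith
qed

lemma not_inherited: "\<not> inherited (BW D) (fixed_sublattice (BW D) t)"
proof
  let ?M = "fixed_sublattice (BW D) t"
  assume inh: "inherited (BW D) ?M"
  have M: "points ?M = {x \<in> lat D 1. t x = x}"
    by (simp add: fixed_sublattice_def points_BW)
  have form: "form ?M = form (BW D)" by (simp add: fixed_sublattice_def)
  define r where "r = restrict \<gamma> (points ?M)"
  have r: "r f = \<gamma> f" if "f \<in> points ?M" for f
    using that by (simp add: r_def)
  have add: "x + y \<in> points ?M" if "x \<in> points ?M" "y \<in> points ?M" for x y
  proof -
    have x: "x \<in> lat D 1" "t x = x" and y: "y \<in> lat D 1" "t y = y" using that by (auto simp: M)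
    have "t (x + y) = t x + t y"
      by (simp add: t_eq[OF lat_add[OF x(1) y(1)]] t_eq[OF x(1)] t_eq[OF y(1)] nf)
        (simp add: fun_eq_iff pt algebra_simps)
    then show ?thesis using x y by (simp add: M lat_add del: One_nat_def)
  qed
  have "bij_betw \<gamma> (points ?M) (points ?M)"
    by (rule bij_betw_byWitness[of _ \<gamma>']) (use \<gamma>_fixed in \<open>auto simp: M\<close>)
  then have bij: "bij_betw r (points ?M) (points ?M)"
    using bij_betw_cong[of "points ?M" \<gamma> r] r by auto
  have "r \<in> carrier (isometry_group ?M)"
    unfolding isometry_group_def
    by (simp add: Bij_def bij isometry_def add \<gamma>_add form form_BW ip_\<gamma> r)
      (simp add: r_def)
  then obtain G where G: "G \<in> carrier (isometry_group (BW D))" "r = restrict G (points ?M)"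
    using inh unfolding inherited_def by blast
  have iso: "isometry (BW D) (BW D) G"
    using G(1) by (simp add: isometry_group_def)
  show False
  proof (rule no_extension[of G])
    fix f assume "f \<in> lat D 1"
    then show "G f \<in> lat D 1"
      using iso unfolding isometry_def points_BW using bij_betw_apply by metis
  next
    fix f h assume "f \<in> lat D 1" "h \<in> lat D 1"
    then have "form (BW D) (G f) (G h) = form (BW D) f h"
      using iso unfolding isometry_def points_BW by blast
    then show "ip D (G f) (G h) = ip D f h"
      by (simp add: form_BW)
  next
    fix f assume "f \<in> lat D 1" "t f = f"
    then have "f \<in> points ?M" by (simp add: M)
    then show "G f = \<gamma> f"
      using fun_cong[OF G(2), of f] r[of f] by simp
  qed
qed

end

section \<open>From commutation relations to a frame\<close>

context pauli
begin

lemma om_nondegenerate: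
  assumes "a \<in> F2 D" "l \<in> F2 D" "a \<noteq> 0 \<or> l \<noteq> 0"
  shows "\<exists>b\<in>F2 D. \<exists>m\<in>F2 D. om b m a l = 1"
proof -
  have nz: "\<exists>i<D. v i = 1" if "v \<in> F2 D" "v \<noteq> 0" for v
  proof (rule ccontr)
    assume "\<not> ?thesis"
    then have "v i = 0" for i
      using that(1) by (cases "i < D") (auto simp: F2_def)
    then show False using that(2) by (simp add: fun_eq_iff fun_pt)
  qed
  show ?thesis
  proof (cases "a = 0")
    case False
    then obtain i where "i < D" "a i = 1" using nz assms by blast
    then show ?thesis by (intro bexI[of _ 0] bexI[of _ "unit_vec i"]) auto
  next
    case True
    then obtain i where "i < D" "l i = 1" using nz assms by blast
    then show ?thesis by (intro bexI[of _ "unit_vec i"] bexI[of _ 0]) auto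
  qed
qed

text \<open>Whichever of \<open>g\<close> and \<open>g z\<close> is conjugated is returned as a
  Pauli operator of its own. It agrees with \<open>g\<close> on the image of \<open>1 + z\<close>,
  which is all that enters into \<open>t\<close>, and it keeps the relations with \<open>z\<close>
  and \<open>a\<close>, so that the lemma can be used again with \<open>a\<close> in the place of
  \<open>g\<close>.\<close>

lemma lat_iso_conj_pair':
  assumes D: "3 \<le> D"
    and z: "az \<in> F2 D" "lz \<in> F2 D" "dot lz az = 0" "az \<noteq> 0 \<or> lz \<noteq> 0"
    and g: "ag \<in> F2 D" "lg \<in> F2 D" "dot lg ag = 0"
    and a: "aa \<in> F2 D" "la \<in> F2 D"
    and zg: "om az lz ag lg = 0" and za: "om az lz aa la = 0" and ga: "om ag lg aa la = 1"
  shows "\<exists>\<phi> \<psi> c b m. lat_iso D \<phi> \<psi> \<and> (\<forall>f. \<phi> (W cz az lz f) = E (D - 1) (\<phi> f)) \<and>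
    (\<forall>f. \<phi> (W c b m f) = E (D - 2) (\<phi> f)) \<and> b \<in> F2 D \<and> m \<in> F2 D \<and> dot m b = 0 \<and>
    om az lz b m = 0 \<and> om b m aa la = 1 \<and>
    (\<forall>f. W c b m (f + W cz az lz f) = W cg ag lg (f + W cz az lz f))"
proof -
  obtain \<phi> \<psi> where iso: "lat_iso D \<phi> \<psi>" "\<forall>f. \<phi> (W cz az lz f) = E (D - 1) (\<phi> f)"
    and alt: "(\<forall>f. \<phi> (W cg ag lg f) = E (D - 2) (\<phi> f)) \<or>
      (\<forall>f. \<phi> (W cg ag lg (W cz az lz f)) = E (D - 2) (\<phi> f))"
    using lat_iso_conj_pair[OF D z g a zg za ga] by blast
  show ?thesis
  proof (cases "\<forall>f. \<phi> (W cg ag lg f) = E (D - 2) (\<phi> f)")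
    case True
    then show ?thesis using iso g zg ga by blast
  next
    case False
    let ?P = "W (cg + cz + dot lz ag) (ag + az) (lg + lz)"
    have eq: "?P f = W cg ag lg (W cz az lz f)" for f
      by (simp add: W_W)
    have "\<forall>f. \<phi> (?P f) = E (D - 2) (\<phi> f)"
      unfolding eq using False alt by blast
    moreover have "\<forall>f. ?P (f + W cz az lz f) = W cg ag lg (f + W cz az lz f)"
      unfolding eq by (simp add: W_involution[OF z(3)] add.commute)
    moreover have "dot (lg + lz) (ag + az) = 0" "om az lz (ag + az) (lg + lz) = 0"
      using z g zg by (cases "dot lz ag"; cases "dot lg az"; simp)+
    moreover have "om (ag + az) (lg + lz) aa la = 1"
      using ga za by (cases "dot lz aa"; cases "dot la az") simp_all
    moreover have "ag + az \<in> F2 D" "lg + lz \<in> F2 D" using z g by auto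
    ultimately show ?thesis using iso by blast
  qed
qed

lemma fixed_lattice_of_pauli_combination:
  assumes D: "5 \<le> D"
    and z: "az \<in> F2 D" "lz \<in> F2 D" "dot lz az = 0" "az \<noteq> 0 \<or> lz \<noteq> 0"
    and g: "ag \<in> F2 D" "lg \<in> F2 D" "dot lg ag = 0"
    and a: "aa \<in> F2 D" "la \<in> F2 D" "dot la aa = 0"
    and zg: "om az lz ag lg = 0" and za: "om az lz aa la = 0" and ga: "om ag lg aa la = 1"
    and t: "\<And>f. f \<in> lat D 1 \<Longrightarrow>
      t f = sc (1/2) (W cg ag lg (f + W cz az lz f) + W ca aa la (f - W cz az lz f))"
  shows "\<not> inherited (BW D) (fixed_sublattice (BW D) t) \<and>
    isometric (fixed_sublattice (BW D) t) (orth_sum (scaled 2 (BW (D - 2))) (scaled 2 (BW (D - 2))))"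
proof -
  have D3: "3 \<le> D" using D by simp
  obtain \<phi>1 \<psi>1 cg' ag' lg' where
    iso1: "lat_iso D \<phi>1 \<psi>1" "\<And>f. \<phi>1 (W cz az lz f) = E (D - 1) (\<phi>1 f)"
    and \<phi>g: "\<And>f. \<phi>1 (W cg' ag' lg' f) = E (D - 2) (\<phi>1 f)"
    and g': "ag' \<in> F2 D" "lg' \<in> F2 D" "dot lg' ag' = 0" "om az lz ag' lg' = 0" "om ag' lg' aa la = 1"
    and g'g: "\<And>f. W cg' ag' lg' (f + W cz az lz f) = W cg ag lg (f + W cz az lz f)"
    using lat_iso_conj_pair'[OF D3 z g a(1,2) zg za ga, of cz cg] by blast
  have ag: "om aa la ag' lg' = 1" using g'(5) by (simp add: add.commute)
  \<comment> \<open>\<open>a\<close> matters only on the image of \<open>1 - z\<close>, so the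
    second use is for \<open>- z\<close>, with sign bit \<open>cz + 1\<close>. The operator already
    chosen for \<open>g\<close> acts as the anticommuting partner.\<close>
  obtain \<phi>2 \<psi>2 ca' aa' la' where
    iso2: "lat_iso D \<phi>2 \<psi>2" "\<And>f. \<phi>2 (W (cz + 1) az lz f) = E (D - 1) (\<phi>2 f)"
    and \<phi>a: "\<And>f. \<phi>2 (W ca' aa' la' f) = E (D - 2) (\<phi>2 f)"
    and a': "aa' \<in> F2 D" "la' \<in> F2 D" "dot la' aa' = 0" "om az lz aa' la' = 0" "om aa' la' ag' lg' = 1"
    and a'a': "\<And>f. W ca' aa' la' (f + W (cz + 1) az lz f) = W ca aa la (f + W (cz + 1) az lz f)"
    using lat_iso_conj_pair'[OF D3 z a g'(1,2) za g'(4) ag, of "cz + 1" ca] by blast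
  have a'a: "W ca' aa' la' (f - W cz az lz f) = W ca aa la (f - W cz az lz f)" for f
    using a'a'[of f] unfolding W_neg by (simp only: diff_conv_add_uminus)
  have ga': "om ag' lg' aa' la' = 1" using a'(5) by (simp add: add.commute)
  obtain b m where y: "b \<in> F2 D" "m \<in> F2 D" "om b m az lz = 1"
    using om_nondegenerate[OF z(1,2,4)] by blast
  \<comment> \<open>The operator at \<open>(b, m)\<close> anticommutes with \<open>z\<close>.
    Multiplying it by the operator for \<open>g\<close> corrects the relation with \<open>a\<close>,
    and conversely, because these two anticommute; neither factor disturbs the relation with
    \<open>z\<close>.\<close>
  define pa where "pa = om b m aa' la'"
  define pg where "pg = om b m ag' lg'"
  define ta where "ta = b + (if pa = 0 then 0 else ag') + (if pg = 0 then 0 else aa')"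
  define tl where "tl = m + (if pa = 0 then 0 else lg') + (if pg = 0 then 0 else la')"
  have \<tau>: "ta \<in> F2 D" "tl \<in> F2 D"
    using y g' a' by (auto simp: ta_def tl_def)
  have \<tau>z: "om az lz ta tl = 1"
    using y(3) g'(4) a'(4) by (simp add: ta_def tl_def ac_simps)
  have \<tau>g: "om ag' lg' ta tl = 0"
    using g'(3) ga' pa_def pg_def by (simp add: ta_def tl_def)
      (cases "dot la' ag'"; cases "dot lg' aa'"; cases "dot m ag'"; cases "dot lg' b"; simp)
  have \<tau>a: "om aa' la' ta tl = 0"
    using a'(3) ga' pa_def pg_def by (simp add: ta_def tl_def)
      (cases "dot la' ag'"; cases "dot lg' aa'"; cases "dot m aa'"; cases "dot la' b"; simp)
  interpret frame D t "W cz az lz" "W cg' ag' lg'" "W ca' aa' la'" "W 0 ta tl" \<phi>1 \<psi>1 \<phi>2 \<psi>2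
  proof
    show "pop (W cz az lz)" "pop (W cg' ag' lg')" "pop (W ca' aa' la')" "pop (W 0 ta tl)"
      using z g' a' \<tau> by (auto simp: pop_def)
    show "W cz az lz (W cg' ag' lg' f) = W cg' ag' lg' (W cz az lz f)"
      "W cz az lz (W ca' aa' la' f) = W ca' aa' la' (W cz az lz f)"
      "W cg' ag' lg' (W ca' aa' la' f) = - W ca' aa' la' (W cg' ag' lg' f)"
      "W cz az lz (W 0 ta tl f) = - W 0 ta tl (W cz az lz f)"
      "W cg' ag' lg' (W 0 ta tl f) = W 0 ta tl (W cg' ag' lg' f)"
      "W ca' aa' la' (W 0 ta tl f) = W 0 ta tl (W ca' aa' la' f)" for f
      by (rule W_commute_0 W_commute_1; fact)+
    show "\<phi>2 (- W cz az lz f) = E (D - 1) (\<phi>2 f)" for f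
      using iso2(2)[of f] by (simp only: W_neg)
    show "t f = sc (1/2) (W cg' ag' lg' (f + W cz az lz f) + W ca' aa' la' (f - W cz az lz f))"
      if "f \<in> lat D 1" for f
      unfolding g'g a'a by (rule t[OF that])
  qed (use D z g' a' iso1 iso2 \<phi>g \<phi>a W_involution in blast)+
  show ?thesis
    using not_inherited isometric_fixed by blast
qed

end

section \<open>The extraspecial group\<close>

lemma group_isometry_group:
  fixes M :: "'a::ab_group_add bilin_lattice"
  assumes add: "\<And>x y. x \<in> points M \<Longrightarrow> y \<in> points M \<Longrightarrow> x + y \<in> points M"
  shows "group (isometry_group M)"
proof -
  let ?S = "points M"
  interpret B: group "BijGroup ?S" by (rule group_BijGroup)
  have car: "carrier (BijGroup ?S) = Bij ?S" by (simp add: BijGroup_def)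
  have "subgroup {f \<in> Bij ?S. isometry M M f} (BijGroup ?S)"
  proof (rule B.subgroupI)
    show "{f \<in> Bij ?S. isometry M M f} \<subseteq> carrier (BijGroup ?S)" by (auto simp: car)
    have "(\<lambda>x\<in>?S. x) \<in> {f \<in> Bij ?S. isometry M M f}"
      by (auto simp: id_Bij isometry_def add bij_betw_def inj_on_def)
    then show "{f \<in> Bij ?S. isometry M M f} \<noteq> {}" by blast
  next
    fix f assume "f \<in> {f \<in> Bij ?S. isometry M M f}"
    then have f: "f \<in> Bij ?S" "isometry M M f" by auto
    define h where "h = inv_into ?S f"
    have bij: "bij_betw f ?S ?S" using f by (simp add: Bij_def)
    have h: "h x \<in> ?S" "f (h x) = x" if "x \<in> ?S" for x
      using that bij by (auto simp: h_def bij_betw_def inv_into_into f_inv_into_f)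
    have hf: "h (f x) = x" if "x \<in> ?S" for x
      using that bij by (simp add: h_def bij_betw_def)
    have "isometry M M (restrict h ?S)"
      unfolding isometry_def
    proof (intro conjI ballI)
      show "bij_betw (restrict h ?S) ?S ?S"
        using bij_betw_inv_into[OF bij] by (simp add: h_def)
    next
      fix x y assume xy: "x \<in> ?S" "y \<in> ?S"
      then have "f (h x + h y) = x + y" using f(2) h by (simp add: isometry_def)
      then show "restrict h ?S (x + y) = restrict h ?S x + restrict h ?S y"
        using hf[of "h x + h y"] xy h add by simp
      show "form M (restrict h ?S x) (restrict h ?S y) = form M x y"
        using f(2) h xy unfolding isometry_def by (metis restrict_apply')
    qed
    then show "inv\<^bsub>BijGroup ?S\<^esub> f \<in> {f \<in> Bij ?S. isometry M M f}"
      using f restrict_inv_into_Bij[OF f(1)] by (simp add: inv_BijGroup h_def)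
  next
    fix f g assume "f \<in> {f \<in> Bij ?S. isometry M M f}" "g \<in> {f \<in> Bij ?S. isometry M M f}"
    then have f: "f \<in> Bij ?S" "isometry M M f" and g: "g \<in> Bij ?S" "isometry M M g" by auto
    have gS: "g x \<in> ?S" if "x \<in> ?S" for x using g that by (auto simp: Bij_def bij_betw_def)
    have "isometry M M (compose ?S f g)"
      using compose_Bij[OF f(1) g(1)] f(2) g(2) gS add
      by (simp add: isometry_def Bij_def compose_eq)
    then show "f \<otimes>\<^bsub>BijGroup ?S\<^esub> g \<in> {f \<in> Bij ?S. isometry M M f}"
      using f g compose_Bij by (simp add: BijGroup_def)
  qed
  then show ?thesis
    unfolding isometry_group_def by (rule B.subgroup_imp_group)
qed

lemma isometry_group_simps:
  "f \<in> carrier (isometry_group M) \<longleftrightarrow> f \<in> Bij (points M) \<and> isometry M M f"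
  "f \<in> Bij (points M) \<Longrightarrow> g \<in> Bij (points M) \<Longrightarrow>
    f \<otimes>\<^bsub>isometry_group M\<^esub> g = compose (points M) f g"
  "\<one>\<^bsub>isometry_group M\<^esub> = (\<lambda>x\<in>points M. x)"
  by (auto simp: isometry_group_def BijGroup_def)

lemma lat_add_mem: "x \<in> points (BW d) \<Longrightarrow> y \<in> points (BW d) \<Longrightarrow> x + y \<in> points (BW d)"
  unfolding points_BW by (rule lat_add)

section \<open>Labels and the group \<open>R\<close>\<close>

context pauli
begin

abbreviation G where "G \<equiv> O_BW D"
abbreviation mult_G (infixl "\<cdot>" 70) where "x \<cdot> y \<equiv> x \<otimes>\<^bsub>G\<^esub> y"
abbreviation invG where "invG x \<equiv> inv\<^bsub>G\<^esub> x"
abbreviation L where "L \<equiv> lat D 1"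

definition lab :: "(vec \<times> vec) set"
  where "lab = F2 D \<times> F2 D"

definition omp :: "vec \<times> vec \<Rightarrow> vec \<times> vec \<Rightarrow> bit"
  where "omp p q = dot (snd p) (fst q) + dot (snd q) (fst p)"

definition qf :: "vec \<times> vec \<Rightarrow> bit"
  where "qf p = dot (snd p) (fst p)"

definition WP :: "bit \<Rightarrow> vec \<times> vec \<Rightarrow> qfun \<Rightarrow> qfun"
  where "WP c p = W c (fst p) (snd p)"

definition wr :: "bit \<Rightarrow> vec \<times> vec \<Rightarrow> qfun \<Rightarrow> qfun"
  where "wr c p = restrict (WP c p) L"

text \<open>The cocycle of signs in products of operators. \<open>omp\<close> is its symmetrization
  and records commutators; \<open>qf\<close> is its diagonal and records squares.\<close>

definition tw :: "vec \<times> vec \<Rightarrow> vec \<times> vec \<Rightarrow> bit"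
  where "tw p q = dot (snd q) (fst p)"

lemma pair_add_self [simp]: "(p :: vec \<times> vec) + p = 0"
  by (cases p) (simp add: zero_prod_def)

lemma pair_add_self_left [simp]: "(p :: vec \<times> vec) + (p + q) = q"
  by (simp flip: add.assoc)

lemma omp_simps [simp]: "omp p 0 = 0" "omp 0 p = 0" "omp p p = 0"
  "omp (p + q) r = omp p r + omp q r" "omp p (q + r) = omp p q + omp p r"
  by (simp_all add: omp_def ac_simps)

lemma omp_commute: "omp p q = omp q p"
  by (simp add: omp_def add.commute)

lemma qf_simps [simp]: "qf 0 = 0" "qf (p + q) = qf p + qf q + omp p q"
  by (simp_all add: qf_def omp_def ac_simps)

lemma tw_simps [simp]: "tw p 0 = 0" "tw 0 p = 0" "tw p p = qf p"
  by (simp_all add: tw_def qf_def)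

lemma tw_omp: "tw p q + tw q p = omp p q"
  by (simp add: tw_def omp_def add.commute)

lemma lab_zero [simp]: "0 \<in> lab"
  and lab_add [intro]: "p \<in> lab \<Longrightarrow> q \<in> lab \<Longrightarrow> p + q \<in> lab"
  by (auto simp: lab_def zero_prod_def)

lemma finite_lab [simp]: "finite lab"
  by (simp add: lab_def)

lemma WP_WP: "WP c p (WP c' q f) = WP (c + c' + tw p q) (p + q) f"
  by (simp add: WP_def W_W tw_def)

lemma WP_zero [simp]: "WP 0 0 f = f"
  by (simp add: WP_def)

lemma WP_lat: "p \<in> lab \<Longrightarrow> f \<in> L \<Longrightarrow> WP c p f \<in> L"
  unfolding WP_def by (rule W_lat) (auto simp: lab_def)

lemma WP_fsup: "p \<in> lab \<Longrightarrow> f \<in> fsup D \<Longrightarrow> WP c p f \<in> fsup D"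
  unfolding WP_def by (rule W_fsup) (auto simp: lab_def)

lemma ip_WP: "p \<in> lab \<Longrightarrow> ip D (WP c p f) (WP c p g) = ip D f g"
  unfolding WP_def by (rule ip_W_W) (auto simp: lab_def)

text \<open>The coefficient of a single point in the spanning set of the lattice; thus
  \<open>ev v\<close> is a multiple of a basis vector that lies in the lattice.\<close>

definition N :: nat where "N = 2 ^ ((D + 1) div 2)"

definition ev :: "vec \<Rightarrow> qfun"
  where "ev v = sc (of_nat N) (ind {v})"

lemma N_pos [simp]: "N \<noteq> 0" "of_nat N \<noteq> (0::rat)"
  by (simp_all add: N_def)

lemma ev_apply: "ev v w = (if w = v then of_nat N else 0)"
  by (simp add: ev_def sc_def ind_def)

lemma ev_lat: "v \<in> F2 D \<Longrightarrow> ev v \<in> L"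
proof -
  assume "v \<in> F2 D"
  then have "flat D 0 {v}"
    unfolding flat_def by (intro bexI[of _ v] exI[of _ "{0}"]) auto
  from flat_lat[OF this, of 1] show ?thesis
    by (simp add: ev_def N_def)
qed

lemma W_ev: "W c a l (ev v) = sc (chi (c + dot l (v + a))) (ev (v + a))"
proof
  fix w
  show "W c a l (ev v) w = sc (chi (c + dot l (v + a))) (ev (v + a)) w"
    by (simp add: W_def sc_def ev_apply vec_add_eq_iff)
qed

lemma WP_inj:
  assumes "p \<in> lab" "q \<in> lab" and eq: "\<And>f. f \<in> L \<Longrightarrow> WP c p f = WP c' q f"
  shows "c = c' \<and> p = q"
proof -
  obtain a l b m where p: "p = (a, l)" and q: "q = (b, m)" by (cases p, cases q)
  have F: "a \<in> F2 D" "l \<in> F2 D" "b \<in> F2 D" "m \<in> F2 D"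
    using assms by (auto simp: p q lab_def)
  have e: "chi (c + dot l (v + a)) * ev (v + a) w = chi (c' + dot m (v + b)) * ev (v + b) w"
    if "v \<in> F2 D" for v w
    using fun_cong[OF eq[OF ev_lat[OF that]], of w] by (simp add: WP_def p q W_ev sc_def)
  have ab: "a = b"
    using e[of 0 a] by (simp add: ev_apply split: if_splits)
  have "c + dot l w = c' + dot m w" if "w \<in> F2 D" for w
    using e[of "w + a" w] F that by (simp add: ab ev_apply F2_add add.assoc)
  note this[of 0] this
  then have c: "c = c'" and lm: "\<And>w. w \<in> F2 D \<Longrightarrow> dot l w = dot m w"
    by (simp_all add: F2_zero)
  have "l i = m i" for i
  proof (cases "i < D")
    case True
    then show ?thesis using lm[of "unit_vec i"] by simp
  qed (use F in \<open>simp add: F2_def\<close>)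
  then show ?thesis by (simp add: p q ab c fun_eq_iff)
qed

lemma wr_eq_iff: "p \<in> lab \<Longrightarrow> q \<in> lab \<Longrightarrow> wr c p = wr c' q \<longleftrightarrow> c = c' \<and> p = q"
  using WP_inj[of p q c c'] unfolding wr_def by (metis restrict_apply')

lemma group_G: "group G"
  by (rule group_isometry_group[OF lat_add_mem])

lemma G_carrier: "f \<in> carrier G \<longleftrightarrow> f \<in> Bij L \<and> isometry (BW D) (BW D) f"
  by (simp add: isometry_group_simps points_BW)

lemma G_mult: "f \<in> carrier G \<Longrightarrow> g \<in> carrier G \<Longrightarrow> f \<cdot> g = compose L f g"
  using isometry_group_simps(1,2)[of _ "BW D"] by (simp add: points_BW)

lemma G_one: "\<one>\<^bsub>G\<^esub> = wr 0 0"
  by (simp add: isometry_group_simps(3) points_BW wr_def fun_eq_iff)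

lemma wr_carrier:
  assumes "p \<in> lab"
  shows "wr c p \<in> carrier G"
proof -
  have inv: "WP (c + qf p) p (WP c p f) = f" "WP c p (WP (c + qf p) p f) = f" for f
    by (simp_all add: WP_WP ac_simps)
  have bij: "bij_betw (wr c p) L L"
    by (rule bij_betw_byWitness[of _ "WP (c + qf p) p"])
      (use inv WP_lat[OF assms] in \<open>auto simp: wr_def\<close>)
  have "isometry (BW D) (BW D) (wr c p)"
    unfolding isometry_def points_BW form_BW using bij lat_add[of _ D 1] ip_WP[OF assms]
    by (simp add: wr_def WP_def)
  then show ?thesis
    using bij by (simp add: G_carrier Bij_def wr_def)
qed

lemma wr_mult:
  assumes "p \<in> lab" "q \<in> lab"
  shows "wr c p \<cdot> wr c' q = wr (c + c' + tw p q) (p + q)"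
proof -
  have "compose L (wr c p) (wr c' q) = wr (c + c' + tw p q) (p + q)"
    using WP_lat[OF assms(2)] by (auto simp: compose_def wr_def WP_WP restrict_def fun_eq_iff)
  then show ?thesis
    using wr_carrier assms by (simp add: G_mult)
qed

lemma wr_inv:
  assumes "p \<in> lab"
  shows "invG (wr c p) = wr (c + qf p) p"
  by (rule group.inv_equality[OF group_G])
    (use assms in \<open>simp_all add: wr_mult wr_carrier G_one ac_simps\<close>)

definition R where "R = {wr c p | c p. p \<in> lab}"

lemma wr_in_R: "p \<in> lab \<Longrightarrow> wr c p \<in> R"
  unfolding R_def by blast

lemma R_cases:
  assumes "x \<in> R"
  obtains c p where "x = wr c p" "p \<in> lab"
  using assms unfolding R_def by blast

lemma subgroup_R: "subgroup R G"
proof (rule group.subgroupI[OF group_G])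
  show "R \<subseteq> carrier G" unfolding R_def using wr_carrier by blast
  show "R \<noteq> {}" using wr_in_R[OF lab_zero] by blast
next
  fix x assume "x \<in> R"
  then obtain c p where x: "x = wr c p" "p \<in> lab" by (rule R_cases)
  show "invG x \<in> R" unfolding x(1) wr_inv[OF x(2)] by (rule wr_in_R[OF x(2)])
next
  fix x y assume "x \<in> R" "y \<in> R"
  then obtain c p c' q where x: "x = wr c p" "p \<in> lab" and y: "y = wr c' q" "q \<in> lab"
    by (elim R_cases)
  show "x \<cdot> y \<in> R"
    unfolding x(1) y(1) wr_mult[OF x(2) y(2)] by (rule wr_in_R[OF lab_add[OF x(2) y(2)]])
qed

lemma translation_eq: "a \<in> F2 D \<Longrightarrow> translation D a = wr 0 (a, 0)"
proof -
  assume a: "a \<in> F2 D"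
  have "lin_ext D (\<lambda>v. basis_vec (v + a)) f = W 0 a 0 f" if "f \<in> L" for f
  proof
    fix w
    have f: "f \<in> fsup D" by (rule lat_subset_fsup[OF that])
    have "lin_ext D (\<lambda>v. basis_vec (v + a)) f w = (\<Sum>v\<in>F2 D. if v = w + a then f v else 0)"
      unfolding lin_ext_def by (rule sum.cong) (auto simp: basis_vec_def vec_add_eq_iff add.assoc)
    also have "\<dots> = W 0 a 0 f w"
      using f by (auto simp: W_def fsup_def)
    finally show "lin_ext D (\<lambda>v. basis_vec (v + a)) f w = W 0 a 0 f w" .
  qed
  then show ?thesis
    unfolding translation_def wr_def points_BW WP_def by (intro restrict_ext) simp
qed

lemma hyperplane_sign_eq:
  assumes H: "\<And>v. v \<in> F2 D \<Longrightarrow> v \<in> H \<longleftrightarrow> c + dot l v = 1"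
  shows "hyperplane_sign D H = wr c (0, l)"
proof -
  have "lin_ext D (\<lambda>v. if v \<in> H then - basis_vec v else basis_vec v) f = W c 0 l f" if "f \<in> L" for f
  proof
    fix w
    have f: "f \<in> fsup D" by (rule lat_subset_fsup[OF that])
    have "lin_ext D (\<lambda>v. if v \<in> H then - basis_vec v else basis_vec v) f w =
        (\<Sum>v\<in>F2 D. if v = w then chi (c + dot l v) * f v else 0)"
      unfolding lin_ext_def using H by (intro sum.cong) (auto simp: basis_vec_def chi_def fun_pt)
    also have "\<dots> = W c 0 l f w"
      using f by (auto simp: W_def fsup_def)
    finally show "lin_ext D (\<lambda>v. if v \<in> H then - basis_vec v else basis_vec v) f w = W c 0 l f w" .
  qed
  then show ?thesis
    unfolding hyperplane_sign_def wr_def points_BW WP_def by (intro restrict_ext) simp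
qed

lemma additive_eq_dot:
  assumes "\<And>v w. v \<in> F2 D \<Longrightarrow> w \<in> F2 D \<Longrightarrow> h (v + w) = h v + h w"
  shows "\<exists>l\<in>F2 D. \<forall>v\<in>F2 D. h v = dot l v"
proof -
  define l where "l = (\<lambda>i. if i < D then h (unit_vec i) else 0)"
  have "v \<in> F2 n \<longrightarrow> h v = dot l v" if "n \<le> D" for n v
    using that
  proof (induction n arbitrary: v)
    case 0
    have "h (0 + 0) = h 0 + h 0" by (rule assms) auto
    then show ?case by (simp add: F2_0)
  next
    case (Suc n)
    show ?case
    proof
      assume "v \<in> F2 (Suc n)"
      then show "h v = dot l v"
      proof (cases rule: F2_Suc_cases)
        case 1
        then show ?thesis using Suc by simp
      next
        case (2 w)
        have "h v = h w + h (unit_vec n)"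
          unfolding 2(2) using Suc.prems 2(1) by (intro assms) (auto intro: F2_mono)
        then show ?thesis using Suc 2 by (simp add: l_def)
      qed
    qed
  qed
  moreover have "l \<in> F2 D" by (simp add: l_def F2_def)
  ultimately show ?thesis by blast
qed

text \<open>The direction space has index 2, so two vectors outside it add up to a vector inside.
  The indicator of its complement is therefore additive, hence given by some
  \<open>l\<close>.\<close>

lemma hyperplane_eq:
  assumes "flat D (D - 1) H" "1 \<le> D"
  shows "\<exists>c. \<exists>l\<in>F2 D. \<forall>v\<in>F2 D. v \<in> H \<longleftrightarrow> c + dot l v = 1"
proof -
  obtain a U where a: "a \<in> F2 D" and U: "U \<subseteq> F2 D" "0 \<in> U" "\<forall>x\<in>U. \<forall>y\<in>U. x + y \<in> U"
    "card U = 2 ^ (D - 1)" and H: "H = (+) a ` U"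
    using assms by (auto simp: flat_def)
  define h :: "vec \<Rightarrow> bit" where "h v = (if v \<in> U then 0 else 1)" for v
  have fin: "finite U" using U finite_F2 finite_subset by blast
  have outside: "v + w \<in> U" if "v \<in> F2 D" "w \<in> F2 D" "v \<notin> U" "w \<notin> U" for v w
  proof -
    have "card (U \<union> (+) v ` U) = 2 ^ D"
      using card_subgroup_coset_union[OF fin U(2,3) that(3)] U(4) assms(2) by (simp flip: power_Suc)
    moreover have "U \<union> (+) v ` U \<subseteq> F2 D" using U that by auto
    ultimately have "U \<union> (+) v ` U = F2 D"
      by (intro card_subset_eq) (simp_all add: card_F2)
    then have "w \<in> (+) v ` U" using that by blast
    then show ?thesis by (simp add: mem_translate add.commute)
  qed
  have mixed: "v + w \<notin> U" if "v \<in> U" "w \<notin> U" for v w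
  proof
    assume "v + w \<in> U"
    then have "v + (v + w) \<in> U" using U that by blast
    then show False using that by simp
  qed
  have "h (v + w) = h v + h w" if "v \<in> F2 D" "w \<in> F2 D" for v w
    using outside[OF that] mixed[of v w] mixed[of w v] U(3) by (auto simp: h_def add.commute[of w v])
  then obtain l where l: "l \<in> F2 D" "\<And>v. v \<in> F2 D \<Longrightarrow> h v = dot l v"
    using additive_eq_dot[of h] by blast
  have "v \<in> H \<longleftrightarrow> (1 + dot l a) + dot l v = 1" if "v \<in> F2 D" for v
  proof -
    have "v \<in> H \<longleftrightarrow> h (v + a) = 0" by (simp add: H mem_translate h_def)
    also have "\<dots> \<longleftrightarrow> dot l v + dot l a = 0" using l(2)[OF F2_add[OF that a]] by simp
    also have "\<dots> \<longleftrightarrow> (1 + dot l a) + dot l v = 1" by (cases "dot l v"; cases "dot l a") simp_all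
    finally show ?thesis .
  qed
  then show ?thesis using l(1) by blast
qed

lemma coordinate_hyperplane: "i < D \<Longrightarrow> flat D (D - 1) {v \<in> F2 D. v i = 1}"
proof -
  assume i: "i < D"
  define U where "U = {v \<in> F2 D. v i = 0}"
  have fin: "finite U" by (simp add: U_def)
  have U: "0 \<in> U" "\<forall>x\<in>U. \<forall>y\<in>U. x + y \<in> U" "unit_vec i \<notin> U"
    by (auto simp: U_def fun_pt unit_vec_apply)
  have img: "(\<lambda>x. unit_vec i + x) ` U = {v \<in> F2 D. v i = 1}"
  proof (rule Set.set_eqI)
    fix v
    have "v + unit_vec i \<in> F2 D \<longleftrightarrow> v \<in> F2 D" by (rule F2_add_iff) (use i in simp)
    then show "v \<in> (\<lambda>x. unit_vec i + x) ` U \<longleftrightarrow> v \<in> {v \<in> F2 D. v i = 1}"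
      by (cases "v i") (simp_all add: mem_translate U_def fun_pt unit_vec_apply)
  qed
  have "U \<union> {v \<in> F2 D. v i = 1} = F2 D"
    by (auto simp: U_def)
  then have "2 * card U = 2 * 2 ^ (D - 1)"
    using card_subgroup_coset_union[OF fin U] i unfolding img by (simp add: card_F2 flip: power_Suc)
  then show ?thesis
    unfolding flat_def img[symmetric] using U i
    by (intro bexI[of _ "unit_vec i"] exI[of _ U]) (auto simp: U_def)
qed

lemma extraspecial_eq:
  assumes D: "1 \<le> D"
  shows "extraspecial D = R"
proof
  let ?gens = "{translation D a | a. a \<in> F2 D} \<union>
     {hyperplane_sign D H | H. 1 \<le> D \<and> affine_subspace D (D - 1) H}"
  have "?gens \<subseteq> R"
  proof
    fix x assume "x \<in> ?gens"
    then consider a where "a \<in> F2 D" "x = translation D a" |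
      H where "flat D (D - 1) H" "x = hyperplane_sign D H"
      by (auto simp: affine_subspace_iff_flat)
    then show "x \<in> R"
    proof cases
      case 1
      then show ?thesis using wr_in_R[of "(a, 0)"] by (simp add: translation_eq lab_def)
    next
      case 2
      obtain c l where "l \<in> F2 D" "\<And>v. v \<in> F2 D \<Longrightarrow> v \<in> H \<longleftrightarrow> c + dot l v = 1"
        using hyperplane_eq[OF 2(1) D] by blast
      then show ?thesis using 2 hyperplane_sign_eq[of H c l] wr_in_R[of "(0, l)"] by (simp add: lab_def)
    qed
  qed
  then show "extraspecial D \<subseteq> R"
    unfolding extraspecial_def using group.generate_subgroup_incl[OF group_G _ subgroup_R] by blast
  let ?S = "extraspecial D"
  have mult: "wr (c + c' + tw p q) (p + q) \<in> ?S"
    if "wr c p \<in> ?S" "wr c' q \<in> ?S" "p \<in> lab" "q \<in> lab" for c c' p q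
    using generate.eng[of "wr c p" G ?gens "wr c' q"] that unfolding extraspecial_def wr_mult[OF that(3,4)]
    by blast
  have tr: "wr 0 (a, 0) \<in> ?S" if "a \<in> F2 D" for a
    unfolding extraspecial_def translation_eq[OF that, symmetric] using that by (intro generate.incl) blast
  have E: "wr 0 (0, unit_vec i) \<in> ?S" if "i < D" for i
  proof -
    have "hyperplane_sign D {v \<in> F2 D. v i = 1} = wr 0 (0, unit_vec i)"
      using that by (intro hyperplane_sign_eq) simp
    moreover have "hyperplane_sign D {v \<in> F2 D. v i = 1} \<in> ?S"
      unfolding extraspecial_def using coordinate_hyperplane[OF that] D
      by (intro generate.incl) (auto simp: affine_subspace_iff_flat)
    ultimately show ?thesis by simp
  qed
  have El: "wr 0 (0, l) \<in> ?S" if "l \<in> F2 n" "n \<le> D" for l n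
    using that
  proof (induction n arbitrary: l)
    case 0
    then show ?case using tr[of 0] by (simp add: F2_0)
  next
    case (Suc n)
    from Suc.prems(1) show ?case
    proof (cases rule: F2_Suc_cases)
      case (2 w)
      have "wr (0 + 0 + tw (0, w) (0, unit_vec n)) ((0, w) + (0, unit_vec n)) \<in> ?S"
        using 2 Suc E by (intro mult) (auto simp: lab_def intro: F2_mono)
      then show ?thesis by (simp add: 2 tw_def)
    qed (use Suc in auto)
  qed
  have neg: "wr c 0 \<in> ?S" for c
  proof (cases c)
    case zero
    then show ?thesis using tr[of 0] by (simp add: zero_prod_def)
  next
    case one
    \<comment> \<open>The translation by \<open>?u\<close> and the character of \<open>?u\<close>
      multiply to an element of order 4, whose square is minus the identity.\<close>
    let ?u = "unit_vec 0"
    have l: "(0, ?u) \<in> lab" "(?u, 0) \<in> lab" "(?u, ?u) \<in> lab" using D by (auto simp: lab_def)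
    have "wr (0 + 0 + tw (0, ?u) (?u, 0)) ((0, ?u) + (?u, 0)) \<in> ?S"
      using D by (intro mult tr E l) auto
    then have "wr 0 (?u, ?u) \<in> ?S" by (simp add: tw_def)
    from mult[OF this this l(3) l(3)] show ?thesis
      using D one by (simp add: qf_def unit_vec_apply)
  qed
  show "R \<subseteq> ?S"
  proof
    fix x assume "x \<in> R"
    then obtain c p where p: "x = wr c p" "p \<in> lab" by (rule R_cases)
    then obtain a l where x: "x = wr c (a, l)" "a \<in> F2 D" "l \<in> F2 D"
      unfolding lab_def by blast
    have "wr (0 + 0 + tw (0, l) (a, 0)) ((0, l) + (a, 0)) \<in> ?S"
      using x by (intro mult tr El[of l D]) (auto simp: lab_def)
    then have "wr 0 (a, l) \<in> ?S" by (simp add: tw_def)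
    moreover have "(a, l) \<in> lab" using x by (simp add: lab_def)
    ultimately show "x \<in> ?S"
      using mult[OF neg[of c] _ lab_zero] x by force
  qed
qed

section \<open>Expansion of an involution in Pauli operators\<close>

lemma sum_chi_dot:
  assumes "u \<in> F2 D"
  shows "(\<Sum>k\<in>F2 D. chi (dot k u)) = (if u = 0 then 2 ^ D else 0)"
proof (cases "u = 0")
  case False
  then obtain i where ui: "u i = 1"
    by (auto simp: fun_eq_iff fun_pt)
  then have i: "i < D" "u i = 1"
    using assms by (cases "i < D"; simp add: F2_def)+
  have "(\<Sum>k\<in>F2 D. chi (dot k u)) = (\<Sum>k\<in>F2 D. chi (dot (k + unit_vec i) u))"
    using sum_F2_translate[of "unit_vec i" D "\<lambda>k. chi (dot k u)"] i by simp
  also have "\<dots> = - (\<Sum>k\<in>F2 D. chi (dot k u))"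
    using i by (simp add: chi_add sum_negf)
  finally show ?thesis using False by simp
qed (simp add: card_F2)

lemma omp_nondegenerate:
  assumes "p \<in> lab" "\<And>q. q \<in> lab \<Longrightarrow> omp p q = 0"
  shows "p = 0"
proof (rule ccontr)
  assume "p \<noteq> 0"
  then have "fst p \<noteq> 0 \<or> snd p \<noteq> 0" by (simp add: prod_eq_iff zero_prod_def)
  moreover have "fst p \<in> F2 D" "snd p \<in> F2 D" using assms(1) by (auto simp: lab_def)
  ultimately have "\<exists>b\<in>F2 D. \<exists>m\<in>F2 D. om b m (fst p) (snd p) = 1"
    by (intro om_nondegenerate)
  then obtain b m where "b \<in> F2 D" "m \<in> F2 D" "om b m (fst p) (snd p) = 1"
    by (elim bexE)
  then show False
    using assms(2)[of "(b, m)"] by (simp add: lab_def omp_def add.commute)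
qed

lemma additive_dichotomy:
  fixes f h :: "'b::ab_group_add \<Rightarrow> bit"
  assumes "\<And>x y. x \<in> K \<Longrightarrow> y \<in> K \<Longrightarrow> x + y \<in> K"
    and "\<And>x y. x \<in> K \<Longrightarrow> y \<in> K \<Longrightarrow> f (x + y) = f x + f y"
    and "\<And>x y. x \<in> K \<Longrightarrow> y \<in> K \<Longrightarrow> h (x + y) = h x + h y"
    and "\<And>x. x \<in> K \<Longrightarrow> f x = 0 \<Longrightarrow> h x = 0"
  shows "(\<forall>x\<in>K. h x = 0) \<or> (\<forall>x\<in>K. h x = f x)"
proof (cases "\<forall>x\<in>K. f x = 0")
  case False
  then obtain y where y: "y \<in> K" "f y = 1" by auto
  have "h x = (if f x = 0 then 0 else h y)" if "x \<in> K" for x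
  proof (cases "f x")
    case one
    then have "h x + h y = 0" using assms that y by (metis bit_add_self)
    then have "h x = h y" by (cases "h x"; cases "h y") simp_all
    then show ?thesis using one by simp
  qed (use assms that in simp)
  then show ?thesis by (cases "h y") auto
qed (use assms in auto)

text \<open>The double orthogonal space of a span of two labels is that span. Over two elements, an
  additive form that vanishes wherever \<open>f\<close> does is 0 or \<open>f\<close>; this is used
  on the kernel of \<open>omp w1\<close>, and then on all labels.\<close>

lemma double_perp:
  assumes "w1 \<in> lab" "w2 \<in> lab" "u \<in> lab"
    and perp: "\<And>y. y \<in> lab \<Longrightarrow> omp w1 y = 0 \<Longrightarrow> omp w2 y = 0 \<Longrightarrow> omp u y = 0"
  shows "u \<in> {0, w1, w2, w1 + w2}"
proof -
  have eqI: "p = q" if "p \<in> lab" "q \<in> lab" "\<forall>y\<in>lab. omp p y = omp q y" for p q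
  proof -
    have "p + q = 0"
      using that by (intro omp_nondegenerate) auto
    then have "p + (p + q) = p" by simp
    then show ?thesis by simp
  qed
  let ?K = "{y \<in> lab. omp w1 y = 0}"
  have "(\<forall>y\<in>?K. omp u y = 0) \<or> (\<forall>y\<in>?K. omp u y = omp w2 y)"
    using perp by (intro additive_dichotomy) auto
  then show ?thesis
  proof
    assume "\<forall>y\<in>?K. omp u y = 0"
    then have "(\<forall>y\<in>lab. omp u y = 0) \<or> (\<forall>y\<in>lab. omp u y = omp w1 y)"
      by (intro additive_dichotomy) auto
    then show ?thesis using eqI[of u 0] eqI[of u w1] assms by auto
  next
    assume "\<forall>y\<in>?K. omp u y = omp w2 y"
    then have "(\<forall>y\<in>lab. omp (u + w2) y = 0) \<or> (\<forall>y\<in>lab. omp (u + w2) y = omp w1 y)"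
      by (intro additive_dichotomy) auto
    then have "u + w2 = 0 \<or> u + w2 = w1"
      using eqI[of "u + w2" 0] eqI[of "u + w2" w1] assms by auto
    moreover have "u = (u + w2) + w2" by (simp only: add.assoc pair_add_self add_0_right)
    ultimately show ?thesis by (metis add_0_left insertCI)
  qed
qed

end

section \<open>The action of an involution of the normalizer on labels\<close>

locale brw_involution = pauli +
  fixes t
  assumes D: "1 \<le> D"
    and t_BRW: "t \<in> BRW D" and t_square: "t \<cdot> t = \<one>\<^bsub>G\<^esub>"
begin

lemma t_carrier: "t \<in> carrier G"
  using t_BRW by (simp add: BRW_def normalizer_def stabilizer_def)

lemma t_inv: "invG t = t"
  by (rule group.inv_equality[OF group_G t_square t_carrier t_carrier])

lemma t_conj: "x \<in> R \<Longrightarrow> t \<cdot> x \<cdot> t \<in> R"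
proof -
  assume x: "x \<in> R"
  have "R \<subseteq> carrier G" using subgroup_R by (rule subgroup.subset)
  then have "t <#\<^bsub>G\<^esub> R #>\<^bsub>G\<^esub> t = R"
    using t_BRW unfolding BRW_def extraspecial_eq[OF D] normalizer_def stabilizer_def t_inv
    by (simp add: t_inv)
  then show ?thesis
    using x unfolding l_coset_def r_coset_def by blast
qed

lemma t_lat: "f \<in> L \<Longrightarrow> t f \<in> L"
  using t_carrier unfolding G_carrier Bij_def by (auto simp: bij_betw_def)

lemma t_t: "f \<in> L \<Longrightarrow> t (t f) = f"
  using fun_cong[OF t_square, of f] t_carrier
  by (simp add: G_mult G_one compose_eq wr_def del: One_nat_def)

lemma t_add: "f \<in> L \<Longrightarrow> h \<in> L \<Longrightarrow> t (f + h) = t f + t h"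
  and t_ip: "f \<in> L \<Longrightarrow> h \<in> L \<Longrightarrow> ip D (t f) (t h) = ip D f h"
  using t_carrier unfolding G_carrier isometry_def points_BW form_BW by auto

lemma t_zero: "t 0 = 0"
  using t_add[of 0 0] by simp

lemma t_minus: "f \<in> L \<Longrightarrow> t (- f) = - t f"
  using t_add[of f "- f"] by (simp add: lat_minus t_zero eq_neg_iff_add_eq_0 add.commute del: One_nat_def)

lemma t_sc_chi: "f \<in> L \<Longrightarrow> t (sc (chi c) f) = sc (chi c) (t f)"
  by (cases c) (simp_all add: sc_neg_1 t_minus del: One_nat_def)

lemma t_conj_WP:
  assumes "p \<in> lab"
  shows "\<exists>c' q. q \<in> lab \<and> t \<cdot> wr c p \<cdot> t = wr c' q \<and> (\<forall>f\<in>L. t (WP c p f) = WP c' q (t f))"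
proof -
  interpret group G by (rule group_G)
  have x: "wr c p \<in> carrier G" by (rule wr_carrier[OF assms])
  obtain c' q where q: "t \<cdot> wr c p \<cdot> t = wr c' q" "q \<in> lab"
    using t_conj[OF wr_in_R[OF assms]] by (rule R_cases)
  have y: "wr c' q \<in> carrier G" by (rule wr_carrier[OF q(2)])
  have "t \<cdot> wr c p = t \<cdot> wr c p \<cdot> t \<cdot> t"
    using x t_carrier by (simp only: m_assoc t_square r_one m_closed)
  then have eq: "t \<cdot> wr c p = wr c' q \<cdot> t"
    by (simp only: q)
  have "t (WP c p f) = WP c' q (t f)" if "f \<in> L" for f
    using fun_cong[OF eq, of f] that t_carrier x y t_lat[OF that]
    by (simp add: G_mult compose_eq wr_def del: One_nat_def)
  then show ?thesis using q by blast
qed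

text \<open>Conjugation by \<open>t\<close> takes the Pauli operator with label \<open>p\<close> to the one with label \<open>\<rho> p\<close>, with
  sign \<open>\<kappa> p\<close>.\<close>

definition \<rho>\<kappa> :: "vec \<times> vec \<Rightarrow> (vec \<times> vec) \<times> bit"
  where "\<rho>\<kappa> p = (SOME r. fst r \<in> lab \<and> (\<forall>f\<in>L. t (WP 0 p f) = WP (snd r) (fst r) (t f)))"

definition \<rho> where "\<rho> p = fst (\<rho>\<kappa> p)"
definition \<kappa> where "\<kappa> p = snd (\<rho>\<kappa> p)"

lemma \<rho>: "p \<in> lab \<Longrightarrow> \<rho> p \<in> lab"
  and t_WP_0: "p \<in> lab \<Longrightarrow> f \<in> L \<Longrightarrow> t (WP 0 p f) = WP (\<kappa> p) (\<rho> p) (t f)"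
proof -
  have *: "fst (\<rho>\<kappa> p) \<in> lab \<and> (\<forall>f\<in>L. t (WP 0 p f) = WP (snd (\<rho>\<kappa> p)) (fst (\<rho>\<kappa> p)) (t f))" if p: "p \<in> lab" for p
  proof -
    obtain c' q where "q \<in> lab \<and> (\<forall>f\<in>L. t (WP 0 p f) = WP c' q (t f))"
      using t_conj_WP[OF p, of 0] by blast
    then have "\<exists>r. fst r \<in> lab \<and> (\<forall>f\<in>L. t (WP 0 p f) = WP (snd r) (fst r) (t f))"
      by (intro exI[of _ "(q, c')"]) simp
    then show ?thesis unfolding \<rho>\<kappa>_def by (rule someI_ex)
  qed
  show "p \<in> lab \<Longrightarrow> \<rho> p \<in> lab" and "p \<in> lab \<Longrightarrow> f \<in> L \<Longrightarrow> t (WP 0 p f) = WP (\<kappa> p) (\<rho> p) (t f)"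
    using * by (auto simp: \<rho>_def \<kappa>_def)
qed

lemma WP_sign: "WP (c + e) p f = sc (chi e) (WP c p f)"
  unfolding WP_def by (rule W_sign)

lemma t_WP: "p \<in> lab \<Longrightarrow> f \<in> L \<Longrightarrow> t (WP c p f) = WP (c + \<kappa> p) (\<rho> p) (t f)"
  using WP_sign[of 0 c p f] WP_sign[of "\<kappa> p" c "\<rho> p" "t f"] t_sc_chi[of "WP 0 p f" c] WP_lat[of p f 0]
  by (simp add: t_WP_0 add.commute[of c "\<kappa> p"] del: One_nat_def)

lemma WP_t_inj:
  assumes "p \<in> lab" "q \<in> lab" "\<And>f. f \<in> L \<Longrightarrow> WP c p (t f) = WP c' q (t f)"
  shows "c = c'" "p = q"
proof -
  have "c = c' \<and> p = q"
    using assms t_t t_lat by (intro WP_inj) metis+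
  then show "c = c'" "p = q" by auto
qed

lemma \<rho>_eqI:
  assumes "p \<in> lab" "q \<in> lab" "\<And>f. f \<in> L \<Longrightarrow> t (WP c p f) = WP c' q (t f)"
  shows "\<rho> p = q" "c' = c + \<kappa> p"
  using WP_t_inj[of "\<rho> p" q "c + \<kappa> p" c'] assms \<rho> t_WP by metis+

lemma \<rho>_add_aux:
  assumes "p \<in> lab" "q \<in> lab"
  shows "\<rho> (p + q) = \<rho> p + \<rho> q \<and> \<kappa> p + \<kappa> q + tw (\<rho> p) (\<rho> q) = tw p q + \<kappa> (p + q)"
proof -
  have "t (WP (tw p q) (p + q) f) = WP (\<kappa> p + \<kappa> q + tw (\<rho> p) (\<rho> q)) (\<rho> p + \<rho> q) (t f)"
    if "f \<in> L" for f
  proof -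
    have "t (WP 0 p (WP 0 q f)) = WP (\<kappa> p) (\<rho> p) (WP (\<kappa> q) (\<rho> q) (t f))"
      using assms that WP_lat by (simp only: t_WP_0)
    then show ?thesis by (simp add: WP_WP)
  qed
  then show ?thesis
    using \<rho>_eqI[of "p + q" "\<rho> p + \<rho> q"] assms \<rho> lab_add by metis
qed

lemma \<rho>_add: "p \<in> lab \<Longrightarrow> q \<in> lab \<Longrightarrow> \<rho> (p + q) = \<rho> p + \<rho> q"
  using \<rho>_add_aux by blast

lemma omp_\<rho>:
  assumes "p \<in> lab" "q \<in> lab"
  shows "omp (\<rho> p) (\<rho> q) = omp p q"
proof -
  have "\<kappa> p + \<kappa> q + tw (\<rho> p) (\<rho> q) = tw p q + \<kappa> (p + q)"
    "\<kappa> p + \<kappa> q + tw (\<rho> q) (\<rho> p) = tw q p + \<kappa> (p + q)"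
    using \<rho>_add_aux[OF assms] \<rho>_add_aux[OF assms(2,1)] by (simp_all add: ac_simps)
  then have "tw (\<rho> p) (\<rho> q) + tw (\<rho> q) (\<rho> p) = tw p q + tw q p"
    by (cases "\<kappa> p"; cases "\<kappa> q"; cases "\<kappa> (p + q)"; cases "tw p q"; cases "tw q p";
      cases "tw (\<rho> p) (\<rho> q)"; cases "tw (\<rho> q) (\<rho> p)") simp_all
  then show ?thesis by (simp add: tw_omp)
qed

lemma \<rho>_\<rho>:
  assumes "p \<in> lab"
  shows "\<rho> (\<rho> p) = p"
proof (rule \<rho>_eqI)
  fix f assume f: "f \<in> L"
  have "WP (\<kappa> p) (\<rho> p) f = t (WP 0 p (t f))"
    using t_WP_0[OF assms t_lat[OF f]] t_t[OF f] by simp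
  then show "t (WP (\<kappa> p) (\<rho> p) f) = WP 0 p (t f)"
    using t_t WP_lat[OF assms t_lat[OF f]] by simp
qed (use \<rho> assms in auto)

definition Wc where "Wc = (\<lambda>x. x + \<rho> x) ` lab"

lemma Wc_lab: "w \<in> Wc \<Longrightarrow> w \<in> lab"
  using \<rho> by (auto simp: Wc_def)

lemma Wc_add: "v \<in> Wc \<Longrightarrow> w \<in> Wc \<Longrightarrow> v + w \<in> Wc"
proof -
  assume "v \<in> Wc" "w \<in> Wc"
  then obtain x y where x: "x \<in> lab" "v = x + \<rho> x" and y: "y \<in> lab" "w = y + \<rho> y"
    by (auto simp: Wc_def)
  have "v + w = (x + y) + \<rho> (x + y)" by (simp add: x y \<rho>_add ac_simps)
  then show ?thesis unfolding Wc_def using x y by blast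
qed

lemma Wc_zero: "0 \<in> Wc"
proof -
  have "\<rho> (0 + 0) = \<rho> 0 + \<rho> 0" by (rule \<rho>_add) simp_all
  then show ?thesis unfolding Wc_def by (intro image_eqI[of _ _ 0]) auto
qed

text \<open>\<open>\<rho>\<close> is an isometric involution for \<open>omp\<close>, so
  \<open>1 + \<rho>\<close> is self-adjoint. Its kernel therefore contains everything orthogonal to
  its image \<open>Wc\<close>.\<close>

lemma \<rho>_fix_perp:
  assumes x: "x \<in> lab" and perp: "\<And>w. w \<in> Wc \<Longrightarrow> omp x w = 0"
  shows "\<rho> x = x"
proof -
  have "x + \<rho> x = 0"
  proof (rule omp_nondegenerate)
    fix y assume y: "y \<in> lab"
    have "omp x (y + \<rho> y) = 0"
      by (rule perp) (use y in \<open>simp add: Wc_def\<close>)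
    moreover have "omp x (\<rho> y) = omp (\<rho> x) y"
      using omp_\<rho>[OF x \<rho>[OF y]] \<rho>_\<rho>[OF y] by simp
    ultimately show "omp (x + \<rho> x) y = 0" by simp
  qed (rule lab_add[OF x \<rho>[OF x]])
  then have "x + (x + \<rho> x) = x" by simp
  then show ?thesis by simp
qed

section \<open>The matrix of \<open>t\<close> and its Pauli coefficients\<close>

definition M :: "vec \<Rightarrow> qfun"
  where "M w v = t (ev v) w / of_nat N"

text \<open>The coefficients of \<open>t\<close> as a linear combination of the operators \<open>WP 0 p\<close>.\<close>

definition Cf :: "vec \<times> vec \<Rightarrow> rat"
  where "Cf p = (\<Sum>w\<in>F2 D. chi (dot (snd p) w) * M w (w + fst p)) / 2 ^ D"

lemma M_conj:
  assumes x: "(a, l) \<in> lab" "\<rho> (a, l) = (a', l')" and v: "v \<in> F2 D"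
  shows "M (w + a') v = chi (\<kappa> (a, l) + dot l' w + dot l (v + a)) * M w (v + a)"
proof -
  have a: "a \<in> F2 D" using x by (simp add: lab_def)
  have "t (WP 0 (a, l) (ev v)) = WP (\<kappa> (a, l)) (a', l') (t (ev v))"
    using t_WP_0[OF x(1) ev_lat[OF v]] x(2) by simp
  moreover have "WP 0 (a, l) (ev v) = sc (chi (dot l (v + a))) (ev (v + a))"
    by (simp only: WP_def fst_conv snd_conv W_ev add_0_left)
  ultimately have "sc (chi (dot l (v + a))) (t (ev (v + a))) = WP (\<kappa> (a, l)) (a', l') (t (ev v))"
    using t_sc_chi[OF ev_lat[OF F2_add[OF v a]]] by simp
  from fun_cong[OF this, of w]
  have 1: "chi (dot l (v + a)) * t (ev (v + a)) w = chi (\<kappa> (a, l) + dot l' w) * t (ev v) (w + a')"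
    by (simp only: sc_def WP_def W_def fst_conv snd_conv)
  have "t (ev v) (w + a') = chi (\<kappa> (a, l) + dot l' w) * (chi (\<kappa> (a, l) + dot l' w) * t (ev v) (w + a'))"
    by (simp flip: mult.assoc)
  also have "\<dots> = chi (\<kappa> (a, l) + dot l' w) * (chi (dot l (v + a)) * t (ev (v + a)) w)"
    by (simp only: 1)
  finally show ?thesis
    by (simp add: M_def chi_add mult.assoc)
qed

text \<open>Moving the operator at \<open>x\<close> through \<open>t\<close> turns it into the one
  at \<open>\<rho> x\<close> up to sign; comparing coefficients on both sides gives the relation. So
  the absolute value of \<open>Cf\<close> is constant on cosets of \<open>Wc\<close>.\<close>

lemma Cf_conj:
  assumes x: "x \<in> lab" and p: "p \<in> lab"
  shows "Cf p = chi (\<kappa> x + qf x + dot (snd x) (fst (\<rho> x)) + dot (snd p) (fst (\<rho> x)) + dot (snd x) (fst p))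
    * Cf (p + x + \<rho> x)"
proof -
  obtain a l a' l' b k where e: "x = (a, l)" "\<rho> x = (a', l')" "p = (b, k)"
    by (metis surj_pair)
  have "(a', l') \<in> lab" using \<rho>[OF x] e(2) by metis
  then have F: "a' \<in> F2 D" "b \<in> F2 D" using p by (auto simp: e(3) lab_def)
  let ?s = "chi (\<kappa> x + qf x + dot l a' + dot k a' + dot l b)"
  have "(\<Sum>w\<in>F2 D. chi (dot k w) * M w (w + b)) = (\<Sum>w\<in>F2 D. chi (dot k (w + a')) * M (w + a') (w + a' + b))"
    using sum_F2_translate[OF F(1), of "\<lambda>w. chi (dot k w) * M w (w + b)"] by simp
  also have "\<dots> = (\<Sum>w\<in>F2 D. ?s * (chi (dot (k + l + l') w) * M w (w + (b + a + a'))))"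
  proof (rule sum.cong[OF refl])
    fix w assume w: "w \<in> F2 D"
    have "M (w + a') (w + a' + b) =
        chi (\<kappa> x + dot l' w + dot l (w + a' + b + a)) * M w (w + a' + b + a)"
      using M_conj[of a l a' l' "w + a' + b" w] x e w F by (auto intro!: F2_add)
    moreover have "w + a' + b + a = w + (b + a + a')" by (simp only: ac_simps)
    moreover have "chi (dot k (w + a')) * chi (\<kappa> x + dot l' w + dot l (w + (b + a + a')))
        = ?s * chi (dot (k + l + l') w)"
      by (simp add: e qf_def ac_simps flip: chi_add)
    ultimately show "chi (dot k (w + a')) * M (w + a') (w + a' + b) =
        ?s * (chi (dot (k + l + l') w) * M w (w + (b + a + a')))"
      by (simp flip: mult.assoc)
  qed
  finally have S: "(\<Sum>w\<in>F2 D. chi (dot k w) * M w (w + b)) =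
      ?s * (\<Sum>w\<in>F2 D. chi (dot (k + l + l') w) * M w (w + (b + a + a')))"
    by (simp only: sum_distrib_left)
  show ?thesis
    using S unfolding Cf_def e(2) unfolding e(1,3) fst_conv snd_conv add_Pair by simp
qed

lemma ip_ev: "w \<in> F2 D \<Longrightarrow> ip D f (ev w) = f w * of_nat N"
  by (simp add: ip_def ev_apply if_distrib[of "\<lambda>x. _ * x"] cong: if_cong)

lemma M_sym:
  assumes "v \<in> F2 D" "w \<in> F2 D"
  shows "M w v = M v w"
proof -
  note e = ev_lat[OF assms(1)] ev_lat[OF assms(2)]
  have "ip D (t (ev v)) (ev w) = ip D (ev v) (t (ev w))"
    using t_ip[OF t_lat[OF e(1)] e(2)] t_t[OF e(1)] by simp
  then have "t (ev v) w * of_nat N = t (ev w) v * of_nat N"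
    using ip_ev assms by (simp add: ip_commute[of D "ev v"])
  then show ?thesis by (simp add: M_def)
qed

text \<open>\<open>t\<close> is an isometry and an involution, hence symmetric, while the operator
  at \<open>p\<close> is skew when \<open>qf p = 1\<close>. Transposition therefore multiplies the
  coefficient at \<open>p\<close> by \<open>chi (qf p)\<close>.\<close>

lemma Cf_nonzero_singular:
  assumes "p \<in> lab" "Cf p \<noteq> 0"
  shows "qf p = 0"
proof -
  obtain b k where p: "p = (b, k)" by (cases p)
  have b: "b \<in> F2 D" using assms by (simp add: p lab_def)
  have "(\<Sum>w\<in>F2 D. chi (dot k w) * M w (w + b)) = (\<Sum>w\<in>F2 D. chi (dot k (w + b)) * M (w + b) (w + b + b))"
    using sum_F2_translate[OF b, of "\<lambda>w. chi (dot k w) * M w (w + b)"] by simp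
  also have "\<dots> = (\<Sum>w\<in>F2 D. chi (qf p) * (chi (dot k w) * M w (w + b)))"
  proof (rule sum.cong[OF refl])
    fix w assume w: "w \<in> F2 D"
    have "w + b + b = w" by (simp only: add.assoc vec_add_self add_0_right)
    then show "chi (dot k (w + b)) * M (w + b) (w + b + b) = chi (qf p) * (chi (dot k w) * M w (w + b))"
      using M_sym[OF w F2_add[OF w b]] by (simp add: p qf_def chi_add)
  qed
  finally have "(\<Sum>w\<in>F2 D. chi (dot k w) * M w (w + b)) = chi (qf p) * (\<Sum>w\<in>F2 D. chi (dot k w) * M w (w + b))"
    by (simp only: sum_distrib_left[symmetric])
  then have "Cf p = chi (qf p) * Cf p"
    unfolding Cf_def times_divide_eq_right p fst_conv snd_conv by (rule arg_cong)
  then show ?thesis using assms(2) by (cases "qf p") auto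
qed

lemma lat_integral: "f \<in> lat n j \<Longrightarrow> \<exists>k. f v = of_int k"
proof (induction n arbitrary: j f v)
  case 0
  then obtain k where "f \<in> fsup 0" "f 0 = of_int k * 2 ^ (j div 2)" by (auto simp: mem_lat_0)
  then show ?case
    by (cases "v = 0") (auto simp: fsup_def F2_0 intro: exI[of _ "k * 2 ^ (j div 2)"] exI[of _ 0])
next
  case (Suc n)
  have x: "lo n f \<in> lat n j" and z: "hi n f - lo n f \<in> lat n (Suc j)" and f: "f \<in> fsup (Suc n)"
    using Suc.prems by auto
  consider "v \<in> F2 n" | w where "w \<in> F2 n" "v = w + unit_vec n" | "v \<notin> F2 (Suc n)"
    using F2_Suc_cases by blast
  then show ?case
  proof cases
    case 1
    then show ?thesis using Suc.IH[OF x, of v] by (simp add: lo_def)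
  next
    case (2 w)
    obtain k m where "lo n f w = of_int k" "(hi n f - lo n f) w = of_int m"
      using Suc.IH[OF x] Suc.IH[OF z] by blast
    then have "f v = of_int (k + m)" using 2 by (simp add: lo_def hi_def fun_pt)
    then show ?thesis by blast
  next
    case 3
    then show ?thesis using f by (auto simp: fsup_def intro: exI[of _ 0])
  qed
qed

lemma t_sc_int:
  assumes "f \<in> L"
  shows "t (sc (of_int k) f) = sc (of_int k) (t f)" "sc (of_int k) f \<in> L"
proof -
  have nat: "sc (of_nat i) f \<in> L \<and> t (sc (of_nat i) f) = sc (of_nat i) (t f)" for i
  proof (induction i)
    case 0
    have "sc 0 h = 0" for h :: "vec \<Rightarrow> rat" by (simp add: sc_def fun_eq_iff fun_pt)
    then show ?case by (simp add: t_zero)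
  next
    case (Suc i)
    have "sc (of_nat (Suc i)) h = h + sc (of_nat i) h" for h :: "vec \<Rightarrow> rat"
      by (simp add: sc_def fun_eq_iff fun_pt algebra_simps)
    then show ?case using Suc assms t_add by (metis lat_add)
  qed
  have "t (sc (of_int k) f) = sc (of_int k) (t f) \<and> sc (of_int k) f \<in> L"
  proof (cases k rule: int_cases2)
    case (nonpos i)
    have "sc (of_int k) h = - sc (of_nat i) h" for h :: "vec \<Rightarrow> rat"
      by (simp add: nonpos sc_def fun_eq_iff fun_pt)
    then show ?thesis using nat[of i] t_minus lat_minus by metis
  qed (use nat in simp)
  then show "t (sc (of_int k) f) = sc (of_int k) (t f)" "sc (of_int k) f \<in> L" by auto
qed

lemma t_sum:
  assumes "finite A" "\<And>i. i \<in> A \<Longrightarrow> h i \<in> L"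
  shows "t (\<Sum>i\<in>A. h i) = (\<Sum>i\<in>A. t (h i)) \<and> (\<Sum>i\<in>A. h i) \<in> L"
  using assms
proof (induction A rule: finite_induct)
  case (insert i A)
  then have "h i \<in> L" "(\<Sum>i\<in>A. h i) \<in> L" "t (\<Sum>i\<in>A. h i) = (\<Sum>i\<in>A. t (h i))" by auto
  then show ?case
    using insert(1,2) t_add lat_add by (metis sum.insert)
qed (simp add: t_zero)

lemma sum_fun_apply: "(\<Sum>i\<in>A. h i) w = (\<Sum>i\<in>A. h i w)"
  for h :: "'i \<Rightarrow> qfun"
  by (induction A rule: infinite_finite_induct) (simp_all add: fun_pt)

text \<open>\<open>t\<close> is known to be additive on the lattice only. Since \<open>f\<close> has
  integer values, \<open>N\<close> times \<open>f\<close> is an integral combination of the lattice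
  vectors \<open>ev v\<close>, and the factor is divided out at the end.\<close>

lemma t_matrix:
  assumes f: "f \<in> L"
  shows "t f w = (\<Sum>v\<in>F2 D. M w v * f v)"
proof -
  have "\<exists>k. \<forall>v. f v = of_int (k v)"
    using lat_integral[OF f] by metis
  then obtain k where k: "\<And>v. f v = of_int (k v)" by blast
  have eq: "sc (of_int (int N)) f = (\<Sum>v\<in>F2 D. sc (of_int (k v)) (ev v))"
  proof
    fix w
    have "(\<Sum>v\<in>F2 D. sc (of_int (k v)) (ev v)) w = (\<Sum>v\<in>F2 D. if v = w then of_int (k v) * of_nat N else 0)"
      unfolding sum_fun_apply by (rule sum.cong) (auto simp: sc_def ev_apply)
    also have "\<dots> = of_nat N * f w"
      using lat_subset_fsup[OF f] by (auto simp: fsup_def k)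
    finally show "sc (of_int (int N)) f w = (\<Sum>v\<in>F2 D. sc (of_int (k v)) (ev v)) w"
      by (simp add: sc_def)
  qed
  have "sc (of_int (int N)) (t f) = t (\<Sum>v\<in>F2 D. sc (of_int (k v)) (ev v))"
    using t_sc_int(1)[OF f, of "int N"] eq by simp
  also have "\<dots> = (\<Sum>v\<in>F2 D. t (sc (of_int (k v)) (ev v)))"
    by (rule conjunct1[OF t_sum[OF finite_F2]], rule t_sc_int(2), rule ev_lat)
  also have "\<dots> = (\<Sum>v\<in>F2 D. sc (of_int (k v)) (t (ev v)))"
    by (rule sum.cong[OF refl]) (rule t_sc_int(1)[OF ev_lat])
  finally have "of_nat N * t f w = (\<Sum>v\<in>F2 D. f v * t (ev v) w)"
    by (simp add: fun_eq_iff sum_fun_apply sc_def k)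
  then have "t f w = (\<Sum>v\<in>F2 D. f v * t (ev v) w) / of_nat N"
    by (simp add: field_simps)
  then show ?thesis
    by (simp add: M_def sum_divide_distrib mult.commute)
qed

lemma M_Cf:
  assumes "w \<in> F2 D" "b \<in> F2 D"
  shows "M w (w + b) = (\<Sum>k\<in>F2 D. Cf (b, k) * chi (dot k w))"
proof -
  have "(\<Sum>k\<in>F2 D. Cf (b, k) * chi (dot k w)) =
      (\<Sum>k\<in>F2 D. \<Sum>u\<in>F2 D. chi (dot k (u + w)) * M u (u + b) / 2 ^ D)"
    by (rule sum.cong[OF refl])
      (simp add: Cf_def sum_divide_distrib sum_distrib_left chi_add mult_ac)
  also have "\<dots> = (\<Sum>u\<in>F2 D. (\<Sum>k\<in>F2 D. chi (dot k (u + w))) * M u (u + b) / 2 ^ D)"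
    by (subst sum.swap) (simp add: sum_divide_distrib sum_distrib_right)
  also have "\<dots> = (\<Sum>u\<in>F2 D. if u = w then M u (u + b) else 0)"
  proof (rule sum.cong[OF refl])
    fix u assume "u \<in> F2 D"
    then show "(\<Sum>k\<in>F2 D. chi (dot k (u + w))) * M u (u + b) / 2 ^ D = (if u = w then M u (u + b) else 0)"
      using sum_chi_dot[OF F2_add[OF _ assms(1)], of u] vec_add_eq_iff[of u w 0] by simp
  qed
  also have "\<dots> = M w (w + b)" using assms by simp
  finally show ?thesis by simp
qed

lemma t_expand:
  assumes f: "f \<in> L"
  shows "t f = (\<Sum>p\<in>lab. sc (Cf p) (WP 0 p f))"
proof
  fix w
  show "t f w = (\<Sum>p\<in>lab. sc (Cf p) (WP 0 p f)) w"
  proof (cases "w \<in> F2 D")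
    case True
    have "t f w = (\<Sum>b\<in>F2 D. M w (w + b) * f (w + b))"
      unfolding t_matrix[OF f] using sum_F2_translate[OF True, of "\<lambda>v. M w v * f v"]
      by (simp add: add.commute)
    also have "\<dots> = (\<Sum>b\<in>F2 D. \<Sum>k\<in>F2 D. Cf (b, k) * (chi (dot k w) * f (w + b)))"
      by (rule sum.cong[OF refl]) (simp add: M_Cf[OF True] sum_distrib_right mult.assoc)
    also have "\<dots> = (\<Sum>p\<in>lab. sc (Cf p) (WP 0 p f)) w"
      unfolding sum_fun_apply lab_def sum.cartesian_product
      by (rule sum.cong) (auto simp: sc_def WP_def W_def)
    finally show ?thesis .
  next
    case False
    have "WP 0 p f w = 0" if "p \<in> lab" for p
      using WP_fsup[OF that lat_subset_fsup[OF f], of 0] False by (auto simp: fsup_def)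
    moreover have "t f w = 0"
      using lat_subset_fsup[OF t_lat[OF f]] False by (auto simp: fsup_def)
    ultimately show ?thesis by (simp add: sum_fun_apply sc_def)
  qed
qed

lemma Cf_nonzero: "\<exists>r\<in>lab. Cf r \<noteq> 0"
proof (rule ccontr)
  assume "\<not> ?thesis"
  then have "\<And>p. p \<in> lab \<Longrightarrow> sc (Cf p) (WP 0 p (ev 0)) = 0"
    by (simp add: sc_def fun_eq_iff fun_pt)
  then have "t (ev 0) = 0"
    using t_expand[OF ev_lat[OF F2_zero]] by simp
  then have "ev 0 = 0" using t_t[OF ev_lat[OF F2_zero]] t_zero by simp
  then have "ev 0 0 = 0" by (simp add: fun_pt)
  then show False by (simp add: ev_apply)
qed

section \<open>The quotient of \<open>R\<close> by its center and the commutator space\<close>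

definition K where "K p = {wr c p | c. True}"

lemma wr_in_K [simp]: "wr c p \<in> K p"
  by (auto simp: K_def)

lemma K_inj:
  assumes "p \<in> lab" "q \<in> lab" "K p = K q"
  shows "p = q"
proof -
  have "wr 0 p \<in> K q" using assms(3) wr_in_K by metis
  then obtain c where "wr 0 p = wr c q" by (auto simp: K_def)
  then show ?thesis using wr_eq_iff assms by metis
qed

lemma wr_commute_iff:
  assumes "p \<in> lab" "q \<in> lab"
  shows "wr c p \<cdot> wr c' q = wr c' q \<cdot> wr c p \<longleftrightarrow> omp p q = 0"
proof -
  have "wr c p \<cdot> wr c' q = wr c' q \<cdot> wr c p \<longleftrightarrow> tw p q = tw q p"
    using wr_eq_iff[OF lab_add[OF assms] lab_add[OF assms(2,1)]]
    by (simp add: wr_mult assms ac_simps)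
  also have "\<dots> \<longleftrightarrow> omp p q = 0"
    unfolding tw_omp[symmetric] by (cases "tw p q"; cases "tw q p") simp_all
  finally show ?thesis .
qed

lemma center_R: "group_center G R = K 0"
proof
  show "group_center G R \<subseteq> K 0"
  proof
    fix z assume z: "z \<in> group_center G R"
    then have "z \<in> R" by (simp add: group_center_def)
    then obtain c p where p: "z = wr c p" "p \<in> lab" by (rule R_cases)
    have "p = 0"
    proof (rule omp_nondegenerate[OF p(2)])
      fix q assume q: "q \<in> lab"
      then have "z \<cdot> wr 0 q = wr 0 q \<cdot> z"
        using z wr_in_R by (simp add: group_center_def)
      then show "omp p q = 0" using wr_commute_iff p q by simp
    qed
    then show "z \<in> K 0" using p by simp
  qed
  show "K 0 \<subseteq> group_center G R"
  proof
    fix z assume "z \<in> K 0"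
    then obtain c where z: "z = wr c 0" by (auto simp: K_def)
    have "z \<cdot> x = x \<cdot> z" if "x \<in> R" for x
    proof -
      from that obtain c' q where "x = wr c' q" "q \<in> lab" by (rule R_cases)
      then show ?thesis using wr_commute_iff[of 0 q c c'] z by simp
    qed
    then show "z \<in> group_center G R"
      using wr_in_R[OF lab_zero] by (simp add: group_center_def z)
  qed
qed

lemma K_coset: "p \<in> lab \<Longrightarrow> K 0 #>\<^bsub>G\<^esub> wr c p = K p"
proof -
  assume p: "p \<in> lab"
  have "wr c' p = wr (c' + c) 0 \<cdot> wr c p" "wr c' 0 \<cdot> wr c p = wr (c' + c) p" for c'
    using p by (simp_all add: wr_mult add.assoc)
  then show ?thesis
    unfolding r_coset_def K_def by blast
qed

lemma K_mult: "p \<in> lab \<Longrightarrow> q \<in> lab \<Longrightarrow> K p <#>\<^bsub>G\<^esub> K q = K (p + q)"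
proof -
  assume pq: "p \<in> lab" "q \<in> lab"
  have "wr c (p + q) = wr (c + tw p q) p \<cdot> wr 0 q"
    "wr c p \<cdot> wr c' q = wr (c + c' + tw p q) (p + q)" for c c'
    using pq by (simp_all add: wr_mult add.assoc)
  then show ?thesis
    unfolding set_mult_def K_def by blast
qed

abbreviation Q where "Q \<equiv> center_quotient G R"

lemma Q_simps:
  "carrier Q = K ` lab" "\<one>\<^bsub>Q\<^esub> = K 0"
  "p \<in> lab \<Longrightarrow> q \<in> lab \<Longrightarrow> K p \<otimes>\<^bsub>Q\<^esub> K q = K (p + q)"
proof -
  have "carrier Q = (\<lambda>x. K 0 #>\<^bsub>G\<^esub> x) ` R"
    by (simp add: center_quotient_def carrier_FactGroup center_R r_coset_def)
  also have "\<dots> = K ` lab"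
  proof
    show "(\<lambda>x. K 0 #>\<^bsub>G\<^esub> x) ` R \<subseteq> K ` lab"
      using K_coset by (auto elim!: R_cases)
    show "K ` lab \<subseteq> (\<lambda>x. K 0 #>\<^bsub>G\<^esub> x) ` R"
    proof
      fix y assume "y \<in> K ` lab"
      then obtain p where p: "p \<in> lab" "y = K p" by blast
      then show "y \<in> (\<lambda>x. K 0 #>\<^bsub>G\<^esub> x) ` R"
        using K_coset[OF p(1), of 0] wr_in_R[OF p(1), of 0] by blast
    qed
  qed
  finally show "carrier Q = K ` lab" .
  show "\<one>\<^bsub>Q\<^esub> = K 0" by (simp add: center_quotient_def center_R)
  show "K p \<otimes>\<^bsub>Q\<^esub> K q = K (p + q)" if "p \<in> lab" "q \<in> lab"
    using K_mult[OF that] by (simp add: center_quotient_def FactGroup_def set_mult_def)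
qed

lemma group_Q: "group Q"
proof (rule groupI)
  show "x \<otimes>\<^bsub>Q\<^esub> y \<in> carrier Q" if "x \<in> carrier Q" "y \<in> carrier Q" for x y
    using that lab_add unfolding Q_simps(1) by (auto simp only: Q_simps(3) image_iff)
  show "\<one>\<^bsub>Q\<^esub> \<in> carrier Q" unfolding Q_simps by (rule imageI) (rule lab_zero)
  show "x \<otimes>\<^bsub>Q\<^esub> y \<otimes>\<^bsub>Q\<^esub> z = x \<otimes>\<^bsub>Q\<^esub> (y \<otimes>\<^bsub>Q\<^esub> z)"
    if "x \<in> carrier Q" "y \<in> carrier Q" "z \<in> carrier Q" for x y z
    using that lab_add unfolding Q_simps(1) by (auto simp only: Q_simps(3) image_iff add.assoc)
  show "\<one>\<^bsub>Q\<^esub> \<otimes>\<^bsub>Q\<^esub> x = x" if "x \<in> carrier Q" for x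
    using that unfolding Q_simps(1,2) by (auto simp only: Q_simps(3) lab_zero add_0_left)
  show "\<exists>y\<in>carrier Q. y \<otimes>\<^bsub>Q\<^esub> x = \<one>\<^bsub>Q\<^esub>" if x: "x \<in> carrier Q" for x
  proof -
    obtain p where p: "p \<in> lab" "x = K p" using x unfolding Q_simps(1) by blast
    have "x \<otimes>\<^bsub>Q\<^esub> x = \<one>\<^bsub>Q\<^esub>"
      unfolding p(2) Q_simps(3)[OF p(1) p(1)] Q_simps(2) by simp
    then show ?thesis using x by blast
  qed
qed

lemma commutator_coset:
  assumes "p \<in> lab"
  shows "group_center G R #>\<^bsub>G\<^esub> (invG (wr c p) \<cdot> (invG t \<cdot> wr c p \<cdot> t)) = K (p + \<rho> p)"
proof -
  obtain c' q where q: "q \<in> lab" "t \<cdot> wr c p \<cdot> t = wr c' q" "\<forall>f\<in>L. t (WP c p f) = WP c' q (t f)"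
    using t_conj_WP[OF assms, of c] by blast
  have "q = \<rho> p" using \<rho>_eqI(1)[OF assms q(1)] q(3) by metis
  then show ?thesis
    unfolding center_R t_inv q(2) wr_inv[OF assms] using wr_mult[OF assms q(1)] K_coset[OF lab_add[OF assms q(1)]]
    by simp
qed

lemma commutator_space_eq: "commutator_space G R t = K ` Wc"
proof -
  have gens: "{group_center G R #>\<^bsub>G\<^esub> (invG x \<cdot> (invG t \<cdot> x \<cdot> t)) | x. x \<in> R} = K ` Wc"
    (is "?S = _")
  proof
    show "?S \<subseteq> K ` Wc"
    proof
      fix y assume "y \<in> ?S"
      then obtain x where x: "x \<in> R"
        "y = group_center G R #>\<^bsub>G\<^esub> (invG x \<cdot> (invG t \<cdot> x \<cdot> t))" by blast
      from x(1) obtain c p where "x = wr c p" "p \<in> lab" by (rule R_cases)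
      then show "y \<in> K ` Wc" using x(2) commutator_coset unfolding Wc_def by blast
    qed
    show "K ` Wc \<subseteq> ?S"
    proof
      fix y assume "y \<in> K ` Wc"
      then obtain p where p: "p \<in> lab" "y = K (p + \<rho> p)" unfolding Wc_def by blast
      then show "y \<in> ?S" using commutator_coset[OF p(1), of 0] wr_in_R[OF p(1), of 0] by blast
    qed
  qed
  have inv_K: "inv\<^bsub>Q\<^esub> (K w) = K w" if "w \<in> lab" for w
    by (rule group.inv_equality[OF group_Q]) (use that in \<open>simp_all add: Q_simps\<close>)
  have "x \<in> K ` Wc" if "x \<in> generate Q (K ` Wc)" for x
    using that
  proof (induction rule: generate.induct)
    case one
    show ?case unfolding Q_simps by (rule imageI[OF Wc_zero])
  next
    case (inv h)
    then obtain w where w: "w \<in> Wc" "h = K w" by blast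
    then show ?case
      using inv_K[OF Wc_lab[OF w(1)]] by simp
  next
    case (eng h1 h2)
    then obtain w1 w2 where w: "w1 \<in> Wc" "h1 = K w1" "w2 \<in> Wc" "h2 = K w2" by blast
    then show ?case
      using Q_simps(3)[OF Wc_lab[OF w(1)] Wc_lab[OF w(3)]] Wc_add by simp
  qed
  then have "generate Q (K ` Wc) \<subseteq> K ` Wc" by (rule subsetI)
  moreover have "K ` Wc \<subseteq> generate Q (K ` Wc)"
    by (rule subsetI) (rule generate.incl)
  ultimately show ?thesis
    unfolding commutator_space_def gens by (rule equalityI)
qed

lemma card_Wc:
  assumes "has_defect D t 1"
  shows "card Wc = 4"
proof -
  obtain B where B: "finite B" "card B = 2"
    "bij_betw (\<lambda>S. finprod Q (\<lambda>x. x) S) (Pow B) (K ` Wc)"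
    using assms unfolding has_defect_def has_F2_dim_def extraspecial_eq[OF D] commutator_space_eq by auto
  have "card (K ` Wc) = 2 ^ 2"
    using bij_betw_same_card[OF B(3)] B(1,2) by (simp add: card_Pow)
  moreover have "inj_on K Wc"
    using K_inj Wc_lab by (intro inj_onI) blast
  ultimately show ?thesis by (simp add: card_image)
qed

section \<open>The support of \<open>t\<close> and the split case\<close>

lemma Cf_shift:
  assumes "p \<in> lab" "w \<in> Wc"
  shows "\<exists>e. Cf (p + w) = chi e * Cf p"
proof -
  obtain x where x: "x \<in> lab" "w = x + \<rho> x" using assms(2) unfolding Wc_def by blast
  obtain e where "Cf p = chi e * Cf (p + w)"
    using Cf_conj[OF x(1) assms(1)] x(2) by (simp only: add.assoc)
  then have "Cf (p + w) = chi e * Cf p"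
    by (simp flip: mult.assoc)
  then show ?thesis by blast
qed

text \<open>For \<open>y\<close> fixed by \<open>\<rho>\<close> the shift
  \<open>y + \<rho> y\<close> is zero, so \<open>Cf_conj\<close> compares a nonzero coefficient with
  itself and its sign has to be 1. In consequence \<open>omp p y\<close> takes the same value for
  all \<open>p\<close> in the support of \<open>t\<close>.\<close>

lemma \<kappa>_fixed:
  assumes "p \<in> lab" "Cf p \<noteq> 0" "y \<in> lab" "\<rho> y = y"
  shows "\<kappa> y = omp p y"
proof -
  have "p + y + y = p" by (simp only: add.assoc pair_add_self add_0_right)
  then have "Cf p = chi (\<kappa> y + omp p y) * Cf p"
    using Cf_conj[OF assms(3,1)] unfolding assms(4)
    by (simp only: qf_def omp_def add.assoc bit_add_self_left)
  then have "chi (\<kappa> y + omp p y) = chi 0" using assms(2) by simp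
  then have "\<kappa> y + omp p y = 0" by (simp only: chi_eq_iff)
  then show ?thesis by (cases "\<kappa> y"; cases "omp p y") simp_all
qed

text \<open>A maximal totally singular subspace containing the support \<open>r + Wc\<close> of \<open>t\<close> and \<open>Wc\<close> gives
  a maximal elementary abelian subgroup of \<open>R\<close> that \<open>t\<close> centralizes.\<close>

lemma split_of_singular_commutators:
  assumes r: "r \<in> lab" "Cf r \<noteq> 0" and q0: "\<And>w. w \<in> Wc \<Longrightarrow> qf w = 0"
  shows "\<not> nonsplit D t"
proof -
  define good where "good S \<longleftrightarrow> S \<subseteq> lab \<and> 0 \<in> S \<and> (\<forall>x\<in>S. \<forall>y\<in>S. x + y \<in> S) \<and> (\<forall>x\<in>S. qf x = 0)" for S
  define S0 where "S0 = Wc \<union> (+) r ` Wc"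
  have "good S0"
    unfolding good_def
  proof (intro conjI ballI)
    show "S0 \<subseteq> lab" using Wc_lab r(1) lab_add unfolding S0_def by blast
    show "0 \<in> S0" using Wc_zero by (simp add: S0_def)
  next
    fix x y assume xy: "x \<in> S0" "y \<in> S0"
    have eq: "u + (r + v) = r + (u + v)" "(r + u) + v = r + (u + v)" "(r + u) + (r + v) = u + v"
      for u v by (simp_all add: ac_simps)
    show "x + y \<in> S0"
      using xy unfolding S0_def
    proof (elim UnE imageE)
      fix v assume "x \<in> Wc" "y = r + v" "v \<in> Wc"
      then show "x + y \<in> Wc \<union> (+) r ` Wc"
        using Wc_add[of x v] eq(1)[of x v] by blast
    next
      fix u assume "x = r + u" "u \<in> Wc" "y \<in> Wc"
      then show "x + y \<in> Wc \<union> (+) r ` Wc"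
        using Wc_add[of u y] eq(2)[of u y] by blast
    next
      fix u v assume "x = r + u" "u \<in> Wc" "y = r + v" "v \<in> Wc"
      then show "x + y \<in> Wc \<union> (+) r ` Wc"
        using Wc_add[of u v] eq(3)[of u v] by (metis UnI1)
    qed (use Wc_add in blast)
  next
    fix x assume "x \<in> S0"
    then show "qf x = 0"
    proof (cases "x \<in> Wc")
      case False
      then obtain w where w: "w \<in> Wc" "x = r + w" using \<open>x \<in> S0\<close> unfolding S0_def by blast
      obtain e where "Cf (r + w) = chi e * Cf r" using Cf_shift[OF r(1) w(1)] by blast
      then show ?thesis
        using Cf_nonzero_singular[OF lab_add[OF r(1) Wc_lab[OF w(1)]]] r(2) w(2) by simp
    qed (rule q0)
  qed
  have "finite {S. good S}"
    by (rule finite_subset[of _ "Pow lab"]) (auto simp: good_def)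
  from finite_has_maximal2[OF this, of S0] \<open>good S0\<close>
  obtain A where A: "good A" "S0 \<subseteq> A" and max: "\<And>B. good B \<Longrightarrow> A \<subseteq> B \<Longrightarrow> A = B"
    by auto
  have A_lab: "p \<in> lab" if "p \<in> A" for p using A(1) that by (auto simp: good_def)
  have A_omp: "omp p q = 0" if "p \<in> A" "q \<in> A" for p q
  proof -
    have "qf (p + q) = 0" "qf p = 0" "qf q = 0" using A(1) that unfolding good_def by blast+
    then show ?thesis by simp
  qed
  define E where "E = {wr c p | c p. p \<in> A}"
  have E_cases: "\<exists>c p. x = wr c p \<and> p \<in> A" if "x \<in> E" for x
    using that unfolding E_def by blast
  have E_in: "wr c p \<in> E" if "p \<in> A" for c p using that unfolding E_def by blast
  have "E \<subseteq> R" using E_cases A_lab wr_in_R by blast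
  have "subgroup E G"
  proof (rule group.subgroupI[OF group_G])
    show "E \<subseteq> carrier G" using \<open>E \<subseteq> R\<close> subgroup.subset[OF subgroup_R] by blast
    show "E \<noteq> {}" using E_in A(1) unfolding good_def by blast
  next
    fix x assume "x \<in> E"
    then obtain c p where x: "x = wr c p" "p \<in> A" using E_cases by blast
    show "invG x \<in> E" unfolding x(1) wr_inv[OF A_lab[OF x(2)]] by (rule E_in[OF x(2)])
  next
    fix x y assume "x \<in> E" "y \<in> E"
    then obtain c p c' q where x: "x = wr c p" "p \<in> A" and y: "y = wr c' q" "q \<in> A"
      using E_cases by metis
    have "p + q \<in> A" using A(1) x y unfolding good_def by blast
    then show "x \<cdot> y \<in> E"
      unfolding x(1) y(1) wr_mult[OF A_lab[OF x(2)] A_lab[OF y(2)]] by (rule E_in)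
  qed
  moreover have "x \<cdot> y = y \<cdot> x" if "x \<in> E" "y \<in> E" for x y
  proof -
    from that obtain c p c' q where "x = wr c p" "p \<in> A" "y = wr c' q" "q \<in> A"
      using E_cases by metis
    then show ?thesis using wr_commute_iff A_lab A_omp by simp
  qed
  moreover have "x \<cdot> x = \<one>\<^bsub>G\<^esub>" if "x \<in> E" for x
  proof -
    from that obtain c p where x: "x = wr c p" "p \<in> A" using E_cases by metis
    moreover have "qf p = 0" using A(1) x unfolding good_def by blast
    ultimately show ?thesis using A_lab by (simp add: wr_mult G_one)
  qed
  ultimately have el: "elementary_abelian_2 G E"
    by (simp add: elementary_abelian_2_def)
  have "E' = E" if "E' \<subseteq> R" "elementary_abelian_2 G E'" "E \<subseteq> E'" for E'
  proof -
    have sub: "subgroup E' G" and sq: "\<And>x. x \<in> E' \<Longrightarrow> x \<cdot> x = \<one>\<^bsub>G\<^esub>"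
      using that(2) by (auto simp: elementary_abelian_2_def)
    \<comment> \<open>Maximality is transferred to labels: squares in \<open>E'\<close> are trivial,
      so its labels form a totally singular subspace, and this one contains
      \<open>A\<close>.\<close>
    define A' where "A' = {p \<in> lab. \<exists>c. wr c p \<in> E'}"
    have AA': "A \<subseteq> A'" using E_in that(3) A_lab unfolding A'_def by blast
    have "good A'"
      unfolding good_def
    proof (intro conjI ballI)
      show "A' \<subseteq> lab" unfolding A'_def by blast
      show "0 \<in> A'" using AA' A(1) unfolding good_def by blast
    next
      fix x y assume "x \<in> A'" "y \<in> A'"
      then obtain c c' where x: "x \<in> lab" "wr c x \<in> E'" and y: "y \<in> lab" "wr c' y \<in> E'"
        unfolding A'_def by blast
      have "wr (c + c' + tw x y) (x + y) \<in> E'"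
        using subgroup.m_closed[OF sub x(2) y(2)] wr_mult[OF x(1) y(1)] by simp
      then show "x + y \<in> A'" using x y lab_add unfolding A'_def by blast
    next
      fix x assume "x \<in> A'"
      then obtain c where x: "x \<in> lab" "wr c x \<in> E'" unfolding A'_def by blast
      have "wr (qf x) 0 = wr 0 0" using sq[OF x(2)] by (simp add: wr_mult[OF x(1) x(1)] G_one)
      then show "qf x = 0" using wr_eq_iff[of 0 0] by simp
    qed
    then have "A' = A" using max[OF _ AA'] by simp
    have "E' \<subseteq> E"
    proof
      fix x assume x: "x \<in> E'"
      then have "x \<in> R" using that(1) by blast
      then obtain c p where p: "x = wr c p" "p \<in> lab" by (rule R_cases)
      then have "p \<in> A'" using x unfolding A'_def by blast
      then show "x \<in> E" using p E_in \<open>A' = A\<close> by simp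
    qed
    then show ?thesis using that(3) by blast
  qed
  then have "maximal_elementary_abelian_2 G R E"
    using \<open>E \<subseteq> R\<close> el unfolding maximal_elementary_abelian_2_def by blast
  moreover have "t \<cdot> x = x \<cdot> t" if "x \<in> E" for x
  proof -
    from that obtain c p where x: "x = wr c p" "p \<in> A" using E_cases by metis
    have p: "p \<in> lab" by (rule A_lab[OF x(2)])
    have rA: "r \<in> A" using A(2) Wc_zero unfolding S0_def by force
    \<comment> \<open>\<open>A\<close> contains \<open>Wc\<close> and is totally isotropic, so
      \<open>p\<close> is orthogonal to \<open>Wc\<close> and fixed by \<open>\<rho>\<close>. As
      \<open>r\<close> is in \<open>A\<close> too, the sign \<open>\<kappa> p\<close>, which equals
      \<open>omp r p\<close>, vanishes.\<close>
    have \<rho>p: "\<rho> p = p"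
      using A_omp[OF x(2)] A(2) by (intro \<rho>_fix_perp[OF p]) (auto simp: S0_def)
    have "\<kappa> p = 0" using \<kappa>_fixed[OF r p \<rho>p] A_omp[OF rA x(2)] by simp
    then have "t (WP c p f) = WP c p (t f)" if "f \<in> L" for f
      using t_WP[OF p that, of c] \<rho>p by simp
    then have "compose L t (wr c p) = compose L (wr c p) t"
      unfolding compose_def wr_def by (intro restrict_ext) (simp add: t_lat del: One_nat_def)
    then show ?thesis
      by (simp add: x(1) G_mult t_carrier wr_carrier[OF p] del: One_nat_def)
  qed
  ultimately show ?thesis
    unfolding nonsplit_def extraspecial_eq[OF D] by blast
qed

text \<open>All of \<open>r + Wc\<close> is singular, so on \<open>Wc\<close> the quadratic form
  agrees with the linear form \<open>omp r\<close>, and \<open>Wc\<close> is totally isotropic.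
  Since \<open>t\<close> is nonsplit, that linear form is nonzero; its kernel in \<open>Wc\<close>
  has one nonzero element \<open>s\<close>, which becomes the label of \<open>z\<close>.\<close>

lemma fixed_lattice:
  assumes D5: "5 \<le> D" and card: "card Wc = 4" and nonsplit: "nonsplit D t"
  shows "\<not> inherited (BW D) (fixed_sublattice (BW D) t) \<and>
    isometric (fixed_sublattice (BW D) t) (orth_sum (scaled 2 (BW (D - 2))) (scaled 2 (BW (D - 2))))"
proof -
  obtain r where r: "r \<in> lab" "Cf r \<noteq> 0" using Cf_nonzero by blast
  have qr: "qf r = 0" by (rule Cf_nonzero_singular[OF r])
  have qw: "qf w = omp r w" if w: "w \<in> Wc" for w
  proof -
    obtain e where "Cf (r + w) = chi e * Cf r" using Cf_shift[OF r(1) w] by blast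
    then have "qf (r + w) = 0"
      using Cf_nonzero_singular[OF lab_add[OF r(1) Wc_lab[OF w]]] r(2) by simp
    then show ?thesis using qr by (cases "qf w"; cases "omp r w") simp_all
  qed
  have iso: "omp v w = 0" if "v \<in> Wc" "w \<in> Wc" for v w
    using qw[OF that(1)] qw[OF that(2)] qw[OF Wc_add[OF that]] by simp
  obtain n where n: "n \<in> Wc" "qf n = 1"
    using split_of_singular_commutators[OF r] nonsplit by (metis bit_not_zero_iff)
  have n0: "n \<noteq> 0" using n(2) by auto
  have "\<not> Wc \<subseteq> {0, n}"
  proof
    assume "Wc \<subseteq> {0, n}"
    then have "card Wc \<le> card {0, n}" by (intro card_mono) simp_all
    also have "\<dots> \<le> 2" by (simp add: card_insert_if)
    finally show False using card by simp
  qed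
  then obtain w where w: "w \<in> Wc" "w \<noteq> 0" "w \<noteq> n" by blast
  define s where "s = (if qf w = 0 then w else w + n)"
  have s: "s \<in> Wc" "qf s = 0" "s \<noteq> 0" "s \<noteq> n"
  proof -
    show "s \<in> Wc" using w n Wc_add by (simp add: s_def)
    show qs: "qf s = 0" using iso[OF w(1) n(1)] n(2) by (simp add: s_def)
    have "w + n \<noteq> 0"
    proof
      assume "w + n = 0"
      then have "(w + n) + n = n" by simp
      then show False using w(3) by (simp only: add.assoc pair_add_self add_0_right)
    qed
    then show "s \<noteq> 0" using w by (simp add: s_def)
    show "s \<noteq> n" using qs n(2) by auto
  qed
  have ns: "n + s \<noteq> 0"
  proof
    assume "n + s = 0"
    then have "n + (n + s) = n" by simp
    then show False using s(4) by simp
  qed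
  have Wc_eq: "Wc = {0, n, s, n + s}"
  proof -
    have "card {0, n, s, n + s} = 4" using n0 s ns by auto
    moreover have "{0, n, s, n + s} \<subseteq> Wc" using Wc_zero n s Wc_add by simp
    moreover have "finite Wc" using card by (intro card_ge_0_finite) simp
    ultimately show ?thesis using card by (metis card_subset_eq)
  qed
  \<comment> \<open>Two labels of the support have the same product with every label fixed by
    \<open>\<rho>\<close>, in particular with everything orthogonal to \<open>Wc\<close>. Their sum
    thus lies in the double orthogonal space of \<open>Wc\<close>, which is
    \<open>Wc\<close>.\<close>
  have sup: "p \<in> (+) r ` Wc" if p: "p \<in> lab" "Cf p \<noteq> 0" for p
  proof -
    have "p + r \<in> {0, n, s, n + s}"
    proof (rule double_perp)
      fix y assume y: "y \<in> lab" "omp n y = 0" "omp s y = 0"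
      have "\<rho> y = y"
        by (rule \<rho>_fix_perp[OF y(1)]) (use y Wc_eq in \<open>auto simp: omp_commute[of y]\<close>)
      then show "omp (p + r) y = 0"
        using \<kappa>_fixed[OF p y(1)] \<kappa>_fixed[OF r y(1)] by simp
    qed (use n s Wc_lab p r lab_add in auto)
    then have "p + r \<in> Wc" by (simp add: Wc_eq)
    moreover have "p = r + (p + r)" by (simp add: ac_simps)
    ultimately show ?thesis by blast
  qed
  obtain e1 e2 e3 where e: "Cf (r + n) = chi e1 * Cf r" "Cf (r + s) = chi e2 * Cf r"
    "Cf (r + (n + s)) = chi e3 * Cf r"
    using Cf_shift[OF r(1) n(1)] Cf_shift[OF r(1) s(1)] Cf_shift[OF r(1) Wc_add[OF n(1) s(1)]] by blast
  define k where "k = Cf r"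
  have labs: "n \<in> lab" "s \<in> lab" "r + n \<in> lab" "r + s \<in> lab" "r + (n + s) \<in> lab"
    using Wc_lab n s r lab_add by auto
  have expand: "t f = sc k (WP 0 r f + WP e1 (r + n) f + WP e2 (r + s) f + WP e3 (r + (n + s)) f)"
    if f: "f \<in> L" for f
  proof -
    have "t f = (\<Sum>p\<in>(+) r ` Wc. sc (Cf p) (WP 0 p f))"
      unfolding t_expand[OF f]
    proof (rule sum.mono_neutral_right)
      show "(+) r ` Wc \<subseteq> lab" using r Wc_lab lab_add by blast
      have "sc 0 h = 0" for h :: "vec \<Rightarrow> rat" by (simp add: sc_def fun_eq_iff fun_pt)
      then show "\<forall>p\<in>lab - (+) r ` Wc. sc (Cf p) (WP 0 p f) = 0" using sup by fastforce
    qed simp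
    also have "\<dots> = (\<Sum>w\<in>Wc. sc (Cf (r + w)) (WP 0 (r + w) f))"
      by (subst sum.reindex) (auto simp: inj_on_def)
    also have "\<dots> = sc (Cf r) (WP 0 r f) + sc (Cf (r + n)) (WP 0 (r + n) f)
        + sc (Cf (r + s)) (WP 0 (r + s) f) + sc (Cf (r + (n + s))) (WP 0 (r + (n + s)) f)"
      unfolding Wc_eq using n0 s ns by (simp add: add.assoc)
    also have "\<dots> = sc k (WP 0 r f + WP e1 (r + n) f + WP e2 (r + s) f + WP e3 (r + (n + s)) f)"
      using WP_sign[of 0 e1 "r + n" f] WP_sign[of 0 e2 "r + s" f] WP_sign[of 0 e3 "r + (n + s)" f]
      by (simp add: e k_def sc_add mult.commute)
    finally show ?thesis .
  qed
  \<comment> \<open>\<open>z\<close> is the product of the operators at \<open>r\<close> and \<open>r + s\<close>, and the product of those at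
    \<open>r + n\<close> and \<open>r + n + s\<close> is \<open>\<plusminus> z\<close>; the sign \<open>+\<close> would make \<open>t\<close> singular.\<close>
  define \<zeta> where "\<zeta> = e2 + tw r s"
  define z where "z = WP \<zeta> s"
  define g where "g = WP 0 r"
  define a where "a = WP e1 (r + n)"
  have lins: "lin z" "lin g" "lin a" by (simp_all add: z_def g_def a_def WP_def lin_W)
  note nf = lin_simps[OF lins(1)] lin_simps[OF lins(2)] lin_simps[OF lins(3)]
  have zz: "z (z f) = f" for f by (simp add: z_def WP_WP s)
  have gg: "g (g f) = f" for f by (simp add: g_def WP_WP qr)
  have rn: "omp r n = 1" and rs: "omp r s = 0" using qw n s by auto
  have ns0: "omp n s = 0" by (rule iso[OF n(1) s(1)])
  have aa: "a (a f) = f" for f by (simp add: a_def WP_WP qr n rn)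
  have comm: "WP c p (WP c' q f) = WP c' q (WP c p f)" if "omp p q = 0" for c p c' q f
  proof -
    have "tw p q = tw q p" using tw_omp[of p q] that by (cases "tw p q"; cases "tw q p") simp_all
    then show ?thesis by (simp add: WP_WP ac_simps)
  qed
  have zg: "z (g f) = g (z f)" for f
    unfolding z_def g_def by (rule comm) (simp add: omp_commute[of s] rs)
  have za: "z (a f) = a (z f)" for f
    unfolding z_def a_def by (rule comm) (simp add: omp_commute[of s] rs ns0)
  have c_eq: "WP e2 (r + s) f = g (z f)" for f
    by (simp add: g_def z_def WP_WP \<zeta>_def add.assoc)
  define e4 where "e4 = e1 + \<zeta> + tw (r + n) s"
  have az: "a (z f) = WP e4 (r + (n + s)) f" for f
    by (simp add: a_def z_def WP_WP e4_def add.assoc)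
  have t2: "t f = sc k (g (f + z f) + a (f - z f))" if f: "f \<in> L" for f
  proof (cases "e3 = e4")
    case True
    have t3: "t h = sc k (g (h + z h) + a (h + z h))" if "h \<in> L" for h
      unfolding expand[OF that] c_eq nf az True by (simp add: g_def a_def algebra_simps)
    have "WP \<zeta> s h = WP 0 0 h" if "h \<in> L" for h
    proof -
      have zh: "z h \<in> L" unfolding z_def by (rule WP_lat[OF labs(2) that])
      have "t (z h) = t h"
        unfolding t3[OF that] t3[OF zh] zz by (simp add: add.commute)
      then have "z h = h" using t_t[OF that] t_t[OF zh] by simp
      then show ?thesis by (simp add: z_def)
    qed
    then have "s = 0" using WP_inj[OF labs(2) lab_zero] by blast
    then show ?thesis using s(3) by simp
  next
    case False
    then have "e3 = e4 + 1" by (cases e3; cases e4) simp_all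
    then have "WP e3 (r + (n + s)) f = - a (z f)"
      by (simp add: az WP_def W_neg)
    then show ?thesis
      unfolding expand[OF f] c_eq nf by (simp add: g_def a_def algebra_simps)
  qed
  \<comment> \<open>On the two eigenspaces of \<open>z\<close> the map \<open>t\<close> is
    \<open>2 * k\<close> times the involution \<open>g\<close> and \<open>a\<close>, respectively,
    so its square is multiplication by \<open>4 * k * k\<close>.\<close>
  have "4 * k * k = 1"
  proof -
    define f where "f = ev 0"
    have f: "f \<in> L" unfolding f_def by (rule ev_lat[OF F2_zero])
    have "t f + z (t f) = sc (2 * k) (g (f + z f))"
      unfolding t2[OF f] by (simp add: nf zg za zz sc_add sc_diff) (simp add: fun_eq_iff fun_pt sc_def algebra_simps)
    moreover have "t f - z (t f) = sc (2 * k) (a (f - z f))"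
      unfolding t2[OF f] by (simp add: nf zg za zz sc_add sc_diff) (simp add: fun_eq_iff fun_pt sc_def algebra_simps)
    ultimately have "t (t f) = sc k (sc (2 * k) (f + z f) + sc (2 * k) (f - z f))"
      unfolding t2[OF t_lat[OF f]] by (simp only: nf gg aa)
    then have "f = sc (4 * k * k) f"
      using t_t[OF f] by (simp add: fun_eq_iff fun_pt sc_def algebra_simps)
    from fun_cong[OF this, of 0] show ?thesis
      by (simp add: f_def ev_apply sc_def)
  qed
  then have "(2 * k - 1) * (2 * k + 1) = 0" by (simp add: algebra_simps)
  then have "k = 1 / 2 \<or> k = - (1 / 2)" by auto
  then obtain e where k: "k = 1 / 2 * chi e"
    by (elim disjE) (use chi_simps in \<open>metis mult.right_neutral mult_minus_right\<close>)+
  \<comment> \<open>The sign of \<open>k\<close> is absorbed into the signs of \<open>g\<close> and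
    \<open>a\<close>.\<close>
  have t4: "t f = sc (1/2) (WP e r (f + z f) + WP (e1 + e) (r + n) (f - z f))" if "f \<in> L" for f
    unfolding t2[OF that] using WP_sign[of 0 e r] WP_sign[of e1 e "r + n"]
    by (simp add: k g_def a_def sc_add)
  have F: "fst s \<in> F2 D" "snd s \<in> F2 D" "fst r \<in> F2 D" "snd r \<in> F2 D"
    "fst (r + n) \<in> F2 D" "snd (r + n) \<in> F2 D"
    using labs r unfolding lab_def mem_Times_iff by blast+
  show ?thesis
  proof (rule fixed_lattice_of_pauli_combination[OF D5 F(1,2) _ _ F(3,4) _ F(5,6)])
    show "dot (snd s) (fst s) = 0" "dot (snd r) (fst r) = 0" "dot (snd (r + n)) (fst (r + n)) = 0"
      using s(2) qr n(2) rn unfolding qf_def[symmetric] qf_simps by simp_all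
    show "fst s \<noteq> 0 \<or> snd s \<noteq> 0" using s(3) by (simp add: prod_eq_iff zero_prod_def)
    show "om (fst s) (snd s) (fst r) (snd r) = 0" "om (fst s) (snd s) (fst (r + n)) (snd (r + n)) = 0"
      "om (fst r) (snd r) (fst (r + n)) (snd (r + n)) = 1"
      unfolding omp_def[symmetric] omp_simps omp_commute[of s] by (simp_all only: rs rn ns0 add_0_left add_0_right)
    show "t f = sc (1/2) (W e (fst r) (snd r) (f + W \<zeta> (fst s) (snd s) f) +
        W (e1 + e) (fst (r + n)) (snd (r + n)) (f - W \<zeta> (fst s) (snd s) f))" if "f \<in> L" for f
      using t4[OF that] by (simp only: z_def WP_def)
  qed
qed

end

theorem theorem1p7:
  fixes d :: nat and t :: "((nat \<Rightarrow> bit) \<Rightarrow> rat) \<Rightarrow> (nat \<Rightarrow> bit) \<Rightarrow> rat"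
  assumes "d \<ge> 5"
    and "t \<in> BRW d" and "involution d t" and "nonsplit d t" and "has_defect d t 1"
  shows "\<not> inherited (BW d) (fixed_sublattice (BW d) t) \<and>
    isometric (fixed_sublattice (BW d) t)
      (orth_sum (scaled 2 (BW (d - 2))) (scaled 2 (BW (d - 2))))"
proof -
  interpret brw_involution d t
    using assms by unfold_locales (auto simp: involution_def)
  show ?thesis
    using fixed_lattice card_Wc assms by blast
qed

end
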